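(* Let $X=E_6/(Spin(10)\times_{\mathbb{Z}_4}U(1))\simeq G_{\mathbb{C}}/P$ be embedded in $\mathbb{P}(\mathbf{27}^* )=\mathbb{C}P^{26}$ by the Plücker coordinates, $[g]\mapsto[g\Phi_0]$. Then the image of $X\hookrightarrow\mathbb{C}P^{26}$ is cut out by the 27 quadratic Plücker equations $d(z,z,-)=0$, i.e. $$X=\{[z]\in\mathbb{C}P^{26}\;|\; d(z,z,-)=0\}.$$ Further, we can cover $\mathbb{C}P^{26}$ with 27 standard coordinate charts. On each of these open sets, we can solve the Plücker relations in terms of 16 local complex coordinates.
   Context: Clifford conventions: $V=\mathbb{C}^{10}$ has standard basis $e^1,\dots,e^{10}$ and complex bilinear inner product with $e^i\cdot e^j=\delta^{ij}$. The Clifford algebra $e^ie^j+e^je^i=2\delta^{ij}$ acts on $\Delta=(\mathbb{C}^2)^{\otimes5}$ by $e^{2k-1}=\sigma_3^{\otimes(k-1)}\otimes\sigma_1\otimes1^{\otimes(5-k)}$, $e^{2k}=\sigma_3^{\otimes(k-1)}\otimes\sigma_2\otimes1^{\otimes(5-k)}$ ($\sigma_i$ the Pauli matrices). $\Delta^\pm$ are the $\pm1$ eigenspaces (each of dimension 16) of $(-i)^5e^1\cdots e^{10}$. Put $C=e^1e^3e^5e^7e^9$, $(\phi\psi)=\phi^TC\psi$, and $(\phi\,a\,\psi)=\phi^TCa\psi$ for $a$ in the Clifford algebra. Representations: $E_6$ is the compact simply connected group and $G_{\mathbb{C}}$ its complexification, with Lie algebra $\mathfrak{so}(10,\mathbb{C})\oplus\Delta^+\oplus\Delta^-\oplus\mathbb{C}\varrho$.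 The representation $\mathbf{27}=V_2\oplus\Delta^+_{-1}\oplus\mathbb{C}_{-4}$ (subscripts are $U(1)$ weights) has vectors $[v;\psi;s]$, on which $\mathfrak{so}(10)$ acts by the vector, spinor and trivial representations respectively, $\varrho[v;\psi;s]=[2iv;-i\psi;-4is]$, $\xi[v;\psi;s]=[\frac1{\sqrt2}\sum_i(\xi e^i\psi)e^i;\,s\xi;\,0]$ for $\xi\in\Delta^+$, and $\eta[v;\psi;s]=[0;-\frac1{\sqrt2}v\eta;-(\eta\psi)]$ for $\eta\in\Delta^-$. The dual $\mathbf{27}^*=V_{-2}\oplus\Delta^-_{1}\oplus\mathbb{C}_4$ has vectors $[u;\phi;t]$, with pairing $u\cdot v+(\phi\psi)+ts$ with $\mathbf{27}$. $\Phi_0=[0;0;1]\in\mathbf{27}^*$ is the highest weight vector and $P\subset G_{\mathbb{C}}$ is the standard parabolic subgroup stabilising the line $\mathbb{C}\Phi_0$; one has $E_6/(Spin(10)\times_{\mathbb{Z}_4}U(1))\simeq G_{\mathbb{C}}/P$. The Plücker coordinates of $[g]$ are the 27 homogeneous coordinates $z_\Psi(g)=\langle\Psi|g|\Phi_0\rangle$, $\Psi\in\mathbf{27}$, i.e. the entries of the vector $z=g\Phi_0$. Cubic invariant: $d$ is the totally symmetric $E_6$-invariant cubic form on $\mathbf{27}^*$, $d(\Phi_1,\Phi_2,\Phi_3)=(u_1\cdot u_3)t_2-\frac1{\sqrt2}(\phi_1u_3\phi_2)+\text{cyclic permutations of }(1,2,3)$, where $\Phi_i=[u_i;\phi_i;t_i]$.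 The condition $d(z,z,-)=0$ means $d(z,z,\Phi)=0$ for all $\Phi\in\mathbf{27}^*$; for $z=[u;\phi;t]$ it reads $2tu-\frac1{\sqrt2}\sum_{i=1}^{10}(\phi e^i\phi)e^i=0$ (10 equations), $u\phi=0$ (16 equations), $u\cdot u=0$ (1 equation). *)

theory Defs
  imports "HOL-Analysis.Analysis" "HOL-Algebra.Bij" "HOL-Algebra.Generated_Groups"
    "HOL-Algebra.Left_Coset"
begin

section \<open>Clifford algebra and spinors\<close>

text \<open>
  Tensor factors are numbered by the type \<open>5\<close>, i.e. \<open>0 < 1 < 2 < 3 < 4\<close>.  With \<open>k :: 5\<close> standing for
  the factor number \<open>k + 1\<close>, the index \<open>(k, False)\<close> of a vector is the odd index \<open>2 (k + 1) - 1\<close>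
  and \<open>(k, True)\<close> is the even index \<open>2 (k + 1)\<close> of the usual numbering \<open>1, \<dots>, 10\<close>.
  A function \<open>5 \<Rightarrow> bool\<close> numbers the tensor basis of the fivefold tensor power of \<open>\<complex>\<^sup>2\<close>; \<open>False\<close> is
  the first basis vector of \<open>\<complex>\<^sup>2\<close>.
\<close>

type_synonym vidx = "5 \<times> bool"
type_synonym sidx = "5 \<Rightarrow> bool"
type_synonym V = "complex ^ vidx"
type_synonym \<Delta> = "complex ^ sidx"

text \<open>Entries are indexed by row first, then column.\<close>

definition \<sigma>\<^sub>0 :: "bool \<Rightarrow> bool \<Rightarrow> complex" where
  "\<sigma>\<^sub>0 a b = (if a = b then 1 else 0)"

definition \<sigma>\<^sub>1 :: "bool \<Rightarrow> bool \<Rightarrow> complex" where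
  "\<sigma>\<^sub>1 a b = (if a = b then 0 else 1)"

definition \<sigma>\<^sub>2 :: "bool \<Rightarrow> bool \<Rightarrow> complex" where
  "\<sigma>\<^sub>2 a b = (if a = b then 0 else if a then \<i> else - \<i>)"

definition \<sigma>\<^sub>3 :: "bool \<Rightarrow> bool \<Rightarrow> complex" where
  "\<sigma>\<^sub>3 a b = (if a = b then (if a then - 1 else 1) else 0)"

definition tensor5 :: "(5 \<Rightarrow> bool \<Rightarrow> bool \<Rightarrow> complex) \<Rightarrow> complex ^ sidx ^ sidx" where
  "tensor5 A = (\<chi> s s'. \<Prod>k\<in>UNIV. A k (s k) (s' k))"

definition gam :: "vidx \<Rightarrow> complex ^ sidx ^ sidx" where
  "gam i = tensor5 (\<lambda>l. if l < fst i then \<sigma>\<^sub>3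
                         else if l = fst i then (if snd i then \<sigma>\<^sub>2 else \<sigma>\<^sub>1)
                         else \<sigma>\<^sub>0)"

definition volume :: "complex ^ sidx ^ sidx" where
  "volume = foldr (**) (map gam
     [(0, False), (0, True), (1, False), (1, True), (2, False), (2, True),
      (3, False), (3, True), (4, False), (4, True)]) (mat 1)"

definition \<Delta>\<^sub>p :: "\<Delta> set" where
  "\<Delta>\<^sub>p = {\<psi>. (- \<i>) ^ 5 *s (volume *v \<psi>) = \<psi>}"

definition \<Delta>\<^sub>m :: "\<Delta> set" where
  "\<Delta>\<^sub>m = {\<psi>. (- \<i>) ^ 5 *s (volume *v \<psi>) = - \<psi>}"

definition Cmat :: "complex ^ sidx ^ sidx" where
  "Cmat = gam (0, False) ** gam (1, False) ** gam (2, False) ** gam (3, False) ** gam (4, False)"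

text \<open>\<open>bil \<phi> \<psi>\<close> is \<open>(\<phi>\<psi>)\<close>, so that \<open>(\<phi> a \<psi>)\<close> is \<open>bil \<phi> (a \<psi>)\<close>.\<close>

definition bil :: "\<Delta> \<Rightarrow> \<Delta> \<Rightarrow> complex" where
  "bil \<phi> \<psi> = scalar_product \<phi> (Cmat *v \<psi>)"

definition cliff :: "V \<Rightarrow> \<Delta> \<Rightarrow> \<Delta>" where
  "cliff v \<psi> = (\<Sum>i\<in>UNIV. v $ i *s (gam i *v \<psi>))"

definition bilvec :: "\<Delta> \<Rightarrow> \<Delta> \<Rightarrow> V" where
  "bilvec \<phi> \<psi> = (\<chi> i. bil \<phi> (gam i *v \<psi>))"


section \<open>The representation 27 and its dual\<close>

text \<open>
  Both modules are subspaces of \<open>V \<times> \<Delta> \<times> \<complex>\<close>.  The library has no scaling of pairs by complex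
  numbers, hence \<open>cscale\<close>.
\<close>

type_synonym E = "V \<times> \<Delta> \<times> complex"

definition cscale :: "complex \<Rightarrow> E \<Rightarrow> E" where
  "cscale c = (\<lambda>(v, \<psi>, s). (c *s v, c *s \<psi>, c * s))"

definition rep27 :: "E set" where
  "rep27 = UNIV \<times> \<Delta>\<^sub>p \<times> UNIV"

definition dual27 :: "E set" where
  "dual27 = UNIV \<times> \<Delta>\<^sub>m \<times> UNIV"

definition pairing :: "E \<Rightarrow> E \<Rightarrow> complex" where
  "pairing = (\<lambda>(u, \<phi>, t) (v, \<psi>, s). scalar_product u v + bil \<phi> \<psi> + t * s)"

text \<open>
  \<open>\<ss>\<oo>(10,\<complex>)\<close> consists of the antisymmetric matrices \<open>A\<close>; the spinor action is normalised by
  \<open>[spin A, cliff v] = cliff (A v)\<close>.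
\<close>

definition spin :: "complex ^ vidx ^ vidx \<Rightarrow> \<Delta> \<Rightarrow> \<Delta>" where
  "spin A \<psi> = (1 / 4) *s (\<Sum>i\<in>UNIV. \<Sum>j\<in>UNIV. A $ i $ j *s (gam i *v (gam j *v \<psi>)))"

text \<open>The action on 27 of \<open>A + \<xi> + \<eta> + c \<rho>\<close>.\<close>

definition e6_act :: "complex ^ vidx ^ vidx \<Rightarrow> \<Delta> \<Rightarrow> \<Delta> \<Rightarrow> complex \<Rightarrow> E \<Rightarrow> E" where
  "e6_act A \<xi> \<eta> c = (\<lambda>(v, \<psi>, s).
     (A *v v + complex_of_real (1 / sqrt 2) *s bilvec \<xi> \<psi> + (2 * \<i> * c) *s v,
      spin A \<psi> + s *s \<xi> - complex_of_real (1 / sqrt 2) *s cliff v \<eta> - (\<i> * c) *s \<psi>,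
      - bil \<eta> \<psi> - 4 * \<i> * c * s))"

definition e6_lie :: "(E \<Rightarrow> E) set" where
  "e6_lie = {e6_act A \<xi> \<eta> c | A \<xi> \<eta> c. transpose A = - A \<and> \<xi> \<in> \<Delta>\<^sub>p \<and> \<eta> \<in> \<Delta>\<^sub>m}"

definition op_exp :: "(E \<Rightarrow> E) \<Rightarrow> E \<Rightarrow> E" where
  "op_exp X v = (\<Sum>n. (1 / fact n) *\<^sub>R (X ^^ n) v)"


section \<open>The group and its homogeneous space\<close>

text \<open>
  The representation 27 of the simply connected complex group of type \<open>E\<^sub>6\<close> is faithful, and a connected Lie
  group is generated by the exponentials of its Lie algebra.  The group is therefore taken to be
  its image in the group of bijections of 27.
\<close>

definition G\<^sub>C :: "(E \<Rightarrow> E) monoid" where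
  "G\<^sub>C = (BijGroup rep27)
     \<lparr>carrier := generate (BijGroup rep27) ((\<lambda>X. restrict (op_exp X) rep27) ` e6_lie)\<rparr>"

text \<open>The contragredient action of \<open>g\<close> on the dual.\<close>

definition dual_act :: "(E \<Rightarrow> E) \<Rightarrow> E \<Rightarrow> E" where
  "dual_act g \<Phi> =
     (THE \<Phi>'. \<Phi>' \<in> dual27 \<and> (\<forall>\<Psi>\<in>rep27. pairing \<Phi>' (g \<Psi>) = pairing \<Phi> \<Psi>))"

definition \<Phi>\<^sub>0 :: E where
  "\<Phi>\<^sub>0 = (0, 0, 1)"

text \<open>
  A point of the projective space is the set of its representatives, a punctured line.
  Open sets are those of the quotient topology.
\<close>

definition proj_point :: "E \<Rightarrow> E set" where
  "proj_point z = {cscale c z | c. c \<noteq> 0}"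

definition CP26 :: "E set set" where
  "CP26 = proj_point ` (dual27 - {0})"

definition cp_open :: "E set set \<Rightarrow> bool" where
  "cp_open W \<longleftrightarrow> W \<subseteq> CP26 \<and>
     openin (top_of_set (dual27 - {0})) {z \<in> dual27 - {0}. proj_point z \<in> W}"

definition P\<^sub>0 :: "(E \<Rightarrow> E) set" where
  "P\<^sub>0 = {g \<in> carrier G\<^sub>C. proj_point (dual_act g \<Phi>\<^sub>0) = proj_point \<Phi>\<^sub>0}"

definition G_mod_P :: "(E \<Rightarrow> E) set set" where
  "G_mod_P = lcosets\<^bsub>G\<^sub>C\<^esub> P\<^sub>0"

text \<open>The map sending the coset of \<open>g\<close> to the line through \<open>g \<Phi>\<^sub>0\<close>.\<close>

definition plucker :: "(E \<Rightarrow> E) set \<Rightarrow> E set" where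
  "plucker x = the_elem ((\<lambda>g. proj_point (dual_act g \<Phi>\<^sub>0)) ` x)"


section \<open>The Pluecker relations\<close>

definition cubic :: "E \<Rightarrow> E \<Rightarrow> E \<Rightarrow> complex" where
  "cubic \<Phi>\<^sub>1 \<Phi>\<^sub>2 \<Phi>\<^sub>3 =
     (let d' = (\<lambda>(u\<^sub>1, \<phi>\<^sub>1, t\<^sub>1) (u\<^sub>2, \<phi>\<^sub>2, t\<^sub>2) (u\<^sub>3, \<phi>\<^sub>3, t\<^sub>3).
            scalar_product u\<^sub>1 u\<^sub>3 * t\<^sub>2 - complex_of_real (1 / sqrt 2) * bil \<phi>\<^sub>1 (cliff u\<^sub>3 \<phi>\<^sub>2))
      in d' \<Phi>\<^sub>1 \<Phi>\<^sub>2 \<Phi>\<^sub>3 + d' \<Phi>\<^sub>2 \<Phi>\<^sub>3 \<Phi>\<^sub>1 + d' \<Phi>\<^sub>3 \<Phi>\<^sub>1 \<Phi>\<^sub>2)"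

definition plucker_locus :: "E set set" where
  "plucker_locus =
     {proj_point z | z. z \<in> dual27 - {0} \<and> (\<forall>\<Phi>\<in>dual27. cubic z z \<Phi> = 0)}"


section \<open>Charts\<close>

text \<open>
  Homogeneous coordinates are the pairings with the members of a basis of 27.  In the basis of
  weight vectors, the orthonormal vectors of \<open>V\<close> are replaced by the isotropic vectors
  \<open>e\<^bsup>2k-1\<^esup> \<plusminus> \<i> e\<^bsup>2k\<^esup>\<close>; the tensor basis of the spinors already consists of weight vectors.
  The orthonormal chart \<open>u\<^sub>i \<noteq> 0\<close> admits no global choice of 16 independent coordinates: \<open>u \<cdot> u = 0\<close>
  rules out taking all the other \<open>u\<^sub>j\<close>, and determines an omitted one only up to sign.
\<close>

definition spinor_basis :: "E set" where
  "spinor_basis = {(0, axis s 1, 0) | s. axis s 1 \<in> \<Delta>\<^sub>p}"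

definition std_basis :: "E set" where
  "std_basis = {(axis i 1, 0, 0) | i. True} \<union> spinor_basis \<union> {(0, 0, 1)}"

definition weight_basis :: "E set" where
  "weight_basis = {(axis (k, False) 1 + \<epsilon> *s axis (k, True) 1, 0, 0) | k \<epsilon>. \<epsilon> \<in> {\<i>, - \<i>}}
     \<union> spinor_basis \<union> {(0, 0, 1)}"

definition chart :: "E \<Rightarrow> E set set" where
  "chart \<Psi> = proj_point ` {z \<in> dual27 - {0}. pairing z \<Psi> \<noteq> 0}"

text \<open>The affine coordinate \<open>z\<^sub>\<Psi>\<^sub>' / z\<^sub>\<Psi>\<close> of a point \<open>p\<close> of \<open>chart \<Psi>\<close>.\<close>

definition affine_coord :: "E \<Rightarrow> E \<Rightarrow> E set \<Rightarrow> complex" where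
  "affine_coord \<Psi> \<Psi>' p = the_elem ((\<lambda>z. pairing z \<Psi>' / pairing z \<Psi>) ` p)"

definition holomorphic_several :: "(complex ^ 'n \<Rightarrow> complex) \<Rightarrow> (complex ^ 'n) set \<Rightarrow> bool" where
  "holomorphic_several f D \<longleftrightarrow>
     (\<forall>x\<in>D. \<exists>L. (f has_derivative L) (at x) \<and> (\<forall>c v. L (c *s v) = c * L v))"

text \<open>
  The solutions of the Pluecker relations in a part \<open>W\<close> of \<open>chart \<Psi>\<close> are parametrised by 16 of the
  26 affine coordinates, which range freely over an open set \<open>D\<close>, and all the affine coordinates
  are holomorphic functions \<open>F\<close> of these 16.
\<close>

definition plucker_solvable :: "E set \<Rightarrow> E \<Rightarrow> E set set \<Rightarrow> bool" where
  "plucker_solvable B \<Psi> W \<longleftrightarrow>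
     (\<exists>(j :: 16 \<Rightarrow> E) (D :: (complex ^ 16) set) (F :: E \<Rightarrow> complex ^ 16 \<Rightarrow> complex).
        let y = (\<lambda>p. \<chi> m. affine_coord \<Psi> (j m) p) in
        inj j \<and> range j \<subseteq> B - {\<Psi>} \<and> open D \<and>
        (\<forall>\<Psi>'\<in>B. holomorphic_several (F \<Psi>') D) \<and>
        bij_betw y (W \<inter> plucker_locus) D \<and>
        (\<forall>p\<in>W \<inter> plucker_locus. \<forall>\<Psi>'\<in>B. affine_coord \<Psi> \<Psi>' p = F \<Psi>' (y p)))"

end

theory Submission
  imports Defs
begin

text \<open>
  In the tensor basis a gamma matrix flips one bit of the index and multiplies by a phase.  Hence
  Clifford multiplication by \<open>u\<close> is a sum of five terms (\<open>cliff_apply\<close>), whose coefficients are, up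
  to signs, the coordinates of \<open>u\<close> in the isotropic basis of weight vectors.  All the spinor algebra
  is derived from this formula.

  \<^bold>\<open>The orbit lies in the zero set.\<close>  On the dual of 27 the cubic form
  \<open>N(u, \<phi>, t) = (u \<cdot> u) t - (\<phi>u\<phi>) / \<surd>2\<close> is killed by the contragredient Lie algebra
  (\<open>cubic_infinitesimal\<close>).  Everything in this cancels by the Clifford relations, except one term in
  the direction of \<open>\<eta>\<close>, which is the ten-dimensional Fierz identity \<open>\<Sum>\<^sub>i (\<phi>e\<^sup>i\<phi>) e\<^sup>i\<phi> = 0\<close> (\<open>fierz\<close>).
  Differentiating along one-parameter groups shows that the group preserves \<open>N\<close>, and hence its
  polarisation \<open>d\<close> and the cone \<open>d(z, z, -) = 0\<close> (\<open>dual_act_cone\<close>).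

  \<^bold>\<open>The zero set is one orbit.\<close>  If \<open>t \<noteq> 0\<close>, the ten equations \<open>2tu = (\<phi>e\<phi>) / \<surd>2\<close> determine \<open>u\<close>, and
  the point is \<open>t\<close> times the exponential of \<open>\<eta> = \<phi> / t\<close> applied to \<open>\<Phi>\<^sub>0\<close> (\<open>big_cell_orbit\<close>).  The
  exponential of \<open>\<xi>\<close> replaces the last coordinate by \<open>t - (\<phi>\<xi>) + (u\<xi> \<xi>) / (2\<surd>2)\<close>.  As a polynomial in \<open>\<xi>\<close>
  this vanishes identically only at the origin, so that every nonzero point of the cone can be moved
  to \<open>t \<noteq> 0\<close> (\<open>cone_orbit\<close>).

  \<^bold>\<open>Charts.\<close>  The charts are treated by the coordinate that does not vanish.
  For \<open>t\<close> the 16 components of \<open>\<phi>\<close> are free (\<open>big_cell_cone\<close>).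
  For a weight coordinate of \<open>u\<close>, isotropy determines the opposite weight coordinate, \<open>u\<phi> = 0\<close>
  expresses half of the components of \<open>\<phi>\<close> by the other half, and \<open>(\<phi>e\<phi>)\<close> is then automatically a
  multiple of \<open>u\<close>, which yields \<open>t\<close> (\<open>vector_cone\<close>).
  For a component \<open>\<phi>\<^sub>q\<close>, the equation \<open>u\<phi> = 0\<close> expresses five weight coordinates of \<open>u\<close> by the five
  opposite ones, and \<open>2tu = (\<phi>e\<phi>) / \<surd>2\<close> expresses the five components of \<open>\<phi>\<close> that are farthest from
  \<open>q\<close> (\<open>spinor_cone\<close>).  That the remaining equations follow is checked for \<open>t \<noteq> 0\<close> by comparison with
  the big cell; it extends to \<open>t = 0\<close> because the equations are polynomial in \<open>t\<close>.

  In orthonormal coordinates of \<open>u\<close> the vector charts need a square root, since \<open>u \<cdot> u = 0\<close> determines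
  the omitted coordinate up to sign.  In the spinor charts the five weight coordinates are replaced
  by five orthonormal ones, one for each tensor factor; they can be chosen such that the resulting
  linear system is invertible near a given point (\<open>exists_signs_det_nonzero\<close>).
\<close>

section \<open>Gamma matrices in the tensor basis\<close>

lemma exhaust_5: "x = 0 \<or> x = 1 \<or> x = 2 \<or> x = 3 \<or> x = 4" for x :: 5
proof (induct x)
  case (of_int z)
  then have "0 \<le> z" and "z < 5" by simp_all
  then have "z = 0 \<or> z = 1 \<or> z = 2 \<or> z = 3 \<or> z=4" by arith
  then show ?case by auto
qed

lemma UNIV_5: "(UNIV :: 5 set) = {0, 1, 2, 3, 4}"
  using exhaust_5 by auto

lemmas less_5 = less_bit1_def bit1.Rep_numeral bit1.Rep_0 bit1.Rep_1

lemma lessThan_5: "{..<0::5} = {}" "{..<1::5} = {0}" "{..<2::5} = {0,1}" "{..<3::5} = {0,1,2}" "{..<4::5} = {0,1,2,3}"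
proof -
  have *: "k < l \<longleftrightarrow> k \<in> (if l = 0 then {} else if l = 1 then {0} else if l = 2 then {0,1} else if l = 3 then {0,1,2} else {0,1,2,3})" for k l :: 5
    using exhaust_5[of k] exhaust_5[of l] by (elim disjE) (simp_all add: less_5)
  show "{..<0::5} = {}" "{..<1::5} = {0}" "{..<2::5} = {0,1}" "{..<3::5} = {0,1,2}" "{..<4::5} = {0,1,2,3}"
    unfolding lessThan_def * by auto
qed

definition sg :: "bool \<Rightarrow> complex" where "sg b = (if b then -1 else 1)"

definition unit_i :: "bool \<Rightarrow> complex" where "unit_i b = (if b then \<i> else - \<i>)"

definition flip :: "5 \<Rightarrow> sidx \<Rightarrow> sidx" where "flip k r = r(k := \<not> r k)"

definition opp :: "sidx \<Rightarrow> sidx" where "opp r = (\<lambda>l. \<not> r l)"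

text \<open>
  The Jordan-Wigner sign, with which the factors \<open>\<sigma>\<^sub>3\<close> to the left of factor \<open>k\<close> act on a basis
  vector.
\<close>

definition jw :: "5 \<Rightarrow> sidx \<Rightarrow> complex" where "jw k r = (\<Prod>l<k. sg (r l))"

text \<open>Up to a factor, the coordinates of \<open>u\<close> in the isotropic basis of weight vectors.\<close>

definition wt :: "5 \<Rightarrow> bool \<Rightarrow> V \<Rightarrow> complex" where
  "wt k b u = u $ (k, False) + unit_i b * u $ (k, True)"

text \<open>The chirality of a basis vector, see \<open>volume_eigen\<close>.\<close>

definition chi :: "sidx \<Rightarrow> complex" where "chi r = (\<Prod>l\<in>UNIV. sg (r l))"

text \<open>The nonzero entries of the matrix \<open>C\<close>, see \<open>Cmat_apply\<close>.\<close>

definition csign :: "sidx \<Rightarrow> complex" where "csign r = sg (r 1) * sg (r 3)"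

lemma flip_simps [simp]: "flip k r k = (\<not> r k)" "l \<noteq> k \<Longrightarrow> flip k r l = r l" "flip k (flip k r) = r"
  by (auto simp: flip_def)

lemma flip_commute: "flip k (flip l r) = flip l (flip k r)"
  by (auto simp: flip_def fun_eq_iff)

lemma opp_simps [simp]: "opp r k = (\<not> r k)" "opp (opp r) = r" "opp (flip k r) = flip k (opp r)"
  by (auto simp: flip_def opp_def fun_eq_iff)

lemma sg_simps [simp]: "sg True = -1" "sg False = 1" "sg b * sg b = 1" "sg (\<not> b) = - sg b" "sg b \<noteq> 0"
  by (auto simp: sg_def)

lemma unit_i_simps [simp]: "unit_i True = \<i>" "unit_i False = - \<i>" "unit_i (\<not> b) = - unit_i b"
  "unit_i b * unit_i b = -1"
  by (auto simp: unit_i_def)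

lemma jw_nz [simp]: "jw k r \<noteq> 0" by (simp add: jw_def)

lemma jw_sq [simp]: "jw k r * jw k r = 1"
  unfolding jw_def by (simp flip: prod.distrib)

lemma chi_flip [simp]: "chi (flip k r) = - chi r"
proof -
  have "chi (flip k r) = sg (flip k r k) * (\<Prod>l\<in>UNIV - {k}. sg (flip k r l))"
    unfolding chi_def by (simp add: prod.remove[of _ k])
  also have "(\<Prod>l\<in>UNIV - {k}. sg (flip k r l)) = (\<Prod>l\<in>UNIV - {k}. sg (r l))"
    by (rule prod.cong) auto
  finally show ?thesis unfolding chi_def by (simp add: prod.remove[of _ k])
qed

lemma chi_cases: "chi r = 1 \<or> chi r = -1"
proof -
  have "chi r * chi r = 1" unfolding chi_def by (simp flip: prod.distrib)
  then show ?thesis by (metis power2_eq_1_iff power2_eq_square)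
qed

text \<open>
  All factors of the tensor product are diagonal except factor \<open>k\<close>, which is off-diagonal. Hence a
  row has a single nonzero entry, in the column with bit \<open>k\<close> flipped.
\<close>

lemma gam_apply:
  "(gam (k, b) *v \<psi>) $ r = jw k r * (if b then unit_i (r k) else 1) * \<psi> $ flip k r"
proof -
  define A where "A = (\<lambda>l. if l < k then \<sigma>\<^sub>3 else if l = k then (if b then \<sigma>\<^sub>2 else \<sigma>\<^sub>1) else \<sigma>\<^sub>0)"
  have g: "gam (k, b) $ r $ s = (\<Prod>l\<in>UNIV. A l (r l) (s l))" for s
    unfolding gam_def tensor5_def A_def fst_conv snd_conv by (simp cong: if_cong)
  have zero: "gam (k, b) $ r $ s = 0" if ne: "s \<noteq> flip k r" for s
  proof -
    obtain l where "s l \<noteq> flip k r l" using ne unfolding fun_eq_iff by blast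
    then have "A l (r l) (s l) = 0"
      by (cases "l = k") (auto simp: A_def \<sigma>\<^sub>0_def \<sigma>\<^sub>1_def \<sigma>\<^sub>2_def \<sigma>\<^sub>3_def)
    then show ?thesis unfolding g by (meson UNIV_I finite prod_zero)
  qed
  have "gam (k, b) $ r $ flip k r = (\<Prod>l\<in>UNIV. (if l \<in> {..<k} then sg (r l) else 1) * (if l = k then if b then unit_i (r k) else 1 else 1))"
    unfolding g by (rule prod.cong)
      (auto simp: A_def \<sigma>\<^sub>0_def \<sigma>\<^sub>1_def \<sigma>\<^sub>2_def \<sigma>\<^sub>3_def sg_def unit_i_def)
  also have "\<dots> = jw k r * (if b then unit_i (r k) else 1)"
    unfolding prod.distrib jw_def by (simp add: prod.If_cases lessThan_def)
  finally have nz: "gam (k, b) $ r $ flip k r = jw k r * (if b then unit_i (r k) else 1)" .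
  have "(gam (k, b) *v \<psi>) $ r = (\<Sum>s\<in>UNIV. if s = flip k r then gam (k, b) $ r $ flip k r * \<psi> $ flip k r else 0)"
    unfolding matrix_vector_mult_def vec_lambda_beta by (rule sum.cong) (simp_all add: zero)
  then show ?thesis by (simp add: nz)
qed

lemma sum_vidx: "(\<Sum>i\<in>UNIV. f i) = (\<Sum>k\<in>UNIV. f (k, False) + f (k, True))" for f :: "vidx \<Rightarrow> 'a::comm_monoid_add"
proof -
  have "(\<Sum>i\<in>UNIV. f i) = (\<Sum>k\<in>UNIV. \<Sum>b\<in>UNIV. f (k, b))"
    by (simp add: sum.cartesian_product flip: UNIV_Times_UNIV)
  then show ?thesis by (simp add: UNIV_bool add.commute)
qed

text \<open>
  The two gamma matrices of a tensor factor have the same support, and their phases differ by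
  \<open>\<plusminus> \<i>\<close> according to the bit. So they combine with the components of \<open>u\<close> to a weight coordinate.
\<close>

lemma cliff_apply: "cliff u \<psi> $ r = (\<Sum>k\<in>UNIV. jw k r * wt k (r k) u * \<psi> $ flip k r)"
  by (auto simp: cliff_def sum_vidx gam_apply wt_def algebra_simps intro!: sum.cong)

lemma scalar_product_wt: "scalar_product u v = (\<Sum>k\<in>UNIV. (wt k True u * wt k False v + wt k False u * wt k True v) / 2)"
  by (auto simp: scalar_product_def sum_vidx wt_def algebra_simps intro!: sum.cong)

lemma wt_linear: "wt k b (u + v) = wt k b u + wt k b v" "wt k b (c *s u) = c * wt k b u"
  "wt k b (u - v) = wt k b u - wt k b v" "wt k b 0 = 0" "wt k b (- u) = - wt k b u"
  by (simp_all add: wt_def algebra_simps)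

lemma wt_eqI: assumes "\<And>k b. wt k b u = wt k b v" shows "u = v"
proof -
  have "u $ (k, False) = (wt k True u + wt k False u) / 2" "u $ (k, True) = (wt k True u - wt k False u) / (2 * \<i>)" for k u
    by (simp_all add: wt_def field_simps)
  then have "u $ (k, b) = v $ (k, b)" for k b
    by (metis (full_types) assms)
  then show ?thesis by (auto simp: vec_eq_iff)
qed

definition of_wt :: "(5 \<Rightarrow> bool \<Rightarrow> complex) \<Rightarrow> V" where
  "of_wt f = (\<chi> i. if snd i then (f (fst i) True - f (fst i) False) / (2 * \<i>) else (f (fst i) True + f (fst i) False) / 2)"

lemma wt_of_wt [simp]: "wt k b (of_wt f) = f k b"
  by (cases b) (auto simp: wt_def of_wt_def field_simps)

lemma of_wt_wt: "of_wt (\<lambda>k b. wt k b u) = u" by (rule wt_eqI) simp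

lemma jw_flip: "jw k (flip l r) = (if l < k then - jw k r else jw k r)"
proof (cases "l < k")
  case True
  then have 1: "jw k f = sg (f l) * (\<Prod>m\<in>{..<k} - {l}. sg (f m))" for f
    unfolding jw_def by (simp add: prod.remove[of _ l])
  have "(\<Prod>m\<in>{..<k} - {l}. sg (flip l r m)) = (\<Prod>m\<in>{..<k} - {l}. sg (r m))"
    by (rule prod.cong) auto
  then show ?thesis using True by (simp add: 1)
next
  case False
  then show ?thesis by (auto simp: jw_def intro!: prod.cong)
qed

lemma Cmat_apply: "(Cmat *v \<psi>) $ r = csign r * \<psi> $ opp r"
proof -
  have "flip 4 (flip 3 (flip 2 (flip 1 (flip 0 r)))) = opp r"
    using exhaust_5 by (auto simp: flip_def opp_def fun_eq_iff)
  moreover have "jw 0 r * (jw 1 r * (jw 2 r * (jw 3 r * jw 4 r))) = csign r"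
    by (auto simp: jw_def lessThan_5 csign_def sg_def)
  ultimately show ?thesis
    by (simp add: Cmat_def gam_apply jw_flip less_5 mult.assoc flip: matrix_vector_mul_assoc)
qed

lemma bil_apply: "bil \<phi> \<psi> = (\<Sum>r\<in>UNIV. csign r * \<phi> $ r * \<psi> $ opp r)"
  by (auto simp: bil_def scalar_product_def Cmat_apply intro!: sum.cong)

lemma bij_opp: "bij opp" by (rule o_bij[of opp]) auto

lemma csign_opp [simp]: "csign (opp r) = csign r" by (simp add: csign_def)

lemma csign_nz [simp]: "csign r \<noteq> 0" by (simp add: csign_def)

lemma sum_opp: "(\<Sum>r\<in>UNIV. f (opp r)) = (\<Sum>r\<in>UNIV. f r)"
  using sum.reindex_bij_betw[OF bij_opp] .

lemma bij_flip: "bij (flip k)" by (rule o_bij[of "flip k"]) auto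

lemma sum_flip: "(\<Sum>r\<in>UNIV. f (flip k r)) = (\<Sum>r\<in>UNIV. f r)"
  using sum.reindex_bij_betw[OF bij_flip] .

lemma bil_sym: "bil \<phi> \<psi> = bil \<psi> \<phi>"
  unfolding bil_apply by (subst sum_opp[symmetric]) (simp add: ac_simps)

lemma cliff_linear: "cliff (u + v) \<psi> = cliff u \<psi> + cliff v \<psi>" "cliff (c *s u) \<psi> = c *s cliff u \<psi>"
  "cliff u (\<psi> + \<phi>) = cliff u \<psi> + cliff u \<phi>" "cliff u (c *s \<psi>) = c *s cliff u \<psi>"
  "cliff 0 \<psi> = 0" "cliff u 0 = 0"  "cliff u (\<psi> - \<phi>) = cliff u \<psi> - cliff u \<phi>"  "cliff u (- \<phi>) = - cliff u \<phi>"
   "cliff (u - v) \<psi> = cliff u \<psi> - cliff v \<psi>"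
  by (auto simp: vec_eq_iff cliff_apply wt_linear algebra_simps sum.distrib sum_distrib_left sum_subtractf sum_negf)

lemma bil_linear: "bil (u + v) \<psi> = bil u \<psi> + bil v \<psi>" "bil (c *s u) \<psi> = c * bil u \<psi>"
  "bil u (\<psi> + \<phi>) = bil u \<psi> + bil u \<phi>" "bil u (c *s \<psi>) = c * bil u \<psi>"
  "bil 0 \<psi> = 0" "bil u 0 = 0"  "bil u (\<psi> - \<phi>) = bil u \<psi> - bil u \<phi>"  "bil (u - v) \<psi> = bil u \<psi> - bil v \<psi>"
   "bil u (- \<phi>) = - bil u \<phi>"  "bil (- u) \<phi> = - bil u \<phi>"
  by (auto simp: bil_apply algebra_simps sum.distrib sum_distrib_left sum_subtractf sum_negf)

text \<open>In terms of entries, this is the symmetry of the matrices \<open>C e\<^sup>i\<close>.\<close>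

lemma csign_jw: "csign r * jw k (opp r) = csign (flip k r) * jw k (flip k r)"
  using exhaust_5[of k] by (auto simp: csign_def jw_def lessThan_5 sg_def)

lemma bil_cliff: "bil \<phi> (cliff u \<psi>) = bil (cliff u \<phi>) \<psi>"
proof -
  note s = csign_jw
  have "bil \<phi> (cliff u \<psi>) = (\<Sum>k\<in>UNIV. \<Sum>r\<in>UNIV. csign r * jw k (opp r) * wt k (\<not> r k) u * \<phi> $ r * \<psi> $ flip k (opp r))"
    unfolding bil_apply cliff_apply by (simp add: sum_distrib_left ac_simps) (subst sum.swap, rule refl)
  also have "\<dots> = (\<Sum>k\<in>UNIV. \<Sum>r\<in>UNIV. csign r * jw k r * wt k (r k) u * \<phi> $ flip k r * \<psi> $ opp r)"
  proof (rule sum.cong[OF refl])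
    fix k :: 5
    show "(\<Sum>r\<in>UNIV. csign r * jw k (opp r) * wt k (\<not> r k) u * \<phi> $ r * \<psi> $ flip k (opp r)) =
      (\<Sum>r\<in>UNIV. csign r * jw k r * wt k (r k) u * \<phi> $ flip k r * \<psi> $ opp r)"
      by (subst (2) sum_flip[symmetric, of _ k]) (simp add: s)
  qed
  also have "\<dots> = bil (cliff u \<phi>) \<psi>"
    unfolding bil_apply cliff_apply by (simp add: sum_distrib_left sum_distrib_right ac_simps) (subst sum.swap, rule refl)
  finally show ?thesis .
qed

text \<open>
  Flipping an earlier bit changes the sign of a later Jordan-Wigner factor, so the terms with two
  different flips cancel in pairs, and only the double flips of one bit remain.
\<close>

lemma cliff_cliff: "cliff u (cliff v \<psi>) + cliff v (cliff u \<psi>) = (2 * scalar_product u v) *s \<psi>"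
proof -
  have "(cliff u (cliff v \<psi>) + cliff v (cliff u \<psi>)) $ r = 2 * scalar_product u v * \<psi> $ r" for r
  proof -
    let ?t = "\<lambda>k l. jw k r * jw l (flip k r) * (wt k (r k) u * wt l (flip k r l) v + wt k (r k) v * wt l (flip k r l) u) * \<psi> $ flip l (flip k r)"
    have off: "?t k l + ?t l k = 0" if "k < l" for k l
      using that by (simp add: jw_flip flip_commute[of k l] algebra_simps)
    have diag: "?t k k = (wt k (r k) u * wt k (\<not> r k) v + wt k (r k) v * wt k (\<not> r k) u) * \<psi> $ r" for k
      by (simp add: jw_flip)
    have "(cliff u (cliff v \<psi>) + cliff v (cliff u \<psi>)) $ r = (\<Sum>k\<in>UNIV. \<Sum>l\<in>UNIV. ?t k l)"
      by (simp add: cliff_apply sum_distrib_left sum.distrib algebra_simps)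
    also have "\<dots> = (\<Sum>k\<in>UNIV. (wt k (r k) u * wt k (\<not> r k) v + wt k (r k) v * wt k (\<not> r k) u) * \<psi> $ r)"
    proof -
      have "(\<Sum>k\<in>UNIV. \<Sum>l\<in>UNIV. ?t k l) = (\<Sum>k\<in>UNIV. \<Sum>l\<in>UNIV. ?t l k)"
        by (rule sum.swap)
      then have "2 * (\<Sum>k\<in>UNIV. \<Sum>l\<in>UNIV. ?t k l) = (\<Sum>k\<in>UNIV. \<Sum>l\<in>UNIV. ?t k l + ?t l k)"
        by (simp only: sum.distrib mult_2)
      also have "\<dots> = (\<Sum>k\<in>UNIV. \<Sum>l\<in>UNIV. if l = k then 2 * ?t k k else 0)"
        using off by (intro sum.cong refl) (metis (no_types, lifting) add.commute linorder_neqE mult_2)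
      also have "\<dots> = 2 * (\<Sum>k\<in>UNIV. ?t k k)"
        unfolding sum_distrib_left by (intro sum.cong refl) (subst sum.delta, auto)
      finally have "(\<Sum>k\<in>UNIV. \<Sum>l\<in>UNIV. ?t k l) = (\<Sum>k\<in>UNIV. ?t k k)" by (simp only: mult_cancel_left) simp
      then show ?thesis unfolding diag .
    qed
    also have "\<dots> = 2 * scalar_product u v * \<psi> $ r"
      unfolding scalar_product_wt sum_distrib_left sum_distrib_right
    proof (rule sum.cong[OF refl])
      fix k show "(wt k (r k) u * wt k (\<not> r k) v + wt k (r k) v * wt k (\<not> r k) u) * \<psi> $ r
         = 2 * ((wt k True u * wt k False v + wt k False u * wt k True v) / 2) * \<psi> $ r"
        by (cases "r k") (auto simp: algebra_simps)
    qed
    finally show ?thesis .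
  qed
  then show ?thesis by (simp add: vec_eq_iff)
qed

lemma cliff_sq: "cliff u (cliff u \<psi>) = scalar_product u u *s \<psi>"
proof -
  have "(2::complex) *s cliff u (cliff u \<psi>) = 2 *s (scalar_product u u *s \<psi>)"
    using cliff_cliff[of u u \<psi>] by (simp add: vec_eq_iff)
  then show ?thesis by (simp add: vec_eq_iff)
qed

section \<open>Chirality and the Fierz identity\<close>

lemma chi_prod: "chi r = sg (r 0) * sg (r 1) * sg (r 2) * sg (r 3) * sg (r 4)"
  unfolding chi_def UNIV_5 by (simp add: mult.assoc)

lemma i_pow_5: "\<i> ^ 5 = \<i>" using power_add[of \<i> 4 1] by simp

text \<open>
  The product of the two gamma matrices of a factor is \<open>\<i> \<sigma>\<^sub>3\<close> in that factor, which is why the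
  chirality operator is diagonal.
\<close>

lemma gam_pair: "gam (k, False) *v (gam (k, True) *v \<psi>) = (\<chi> r. \<i> * (sg (r k) * \<psi> $ r))"
proof -
  have "(gam (k, False) *v (gam (k, True) *v \<psi>)) $ r = \<i> * (sg (r k) * \<psi> $ r)" for r
  proof -
    have "(gam (k, False) *v (gam (k, True) *v \<psi>)) $ r = (jw k r * jw k r) * (unit_i (\<not> r k) * \<psi> $ r)"
      unfolding gam_apply jw_flip flip_simps by (simp only: if_True if_False less_irrefl mult_1_right mult_1_left mult_ac)
    moreover have "unit_i (\<not> r k) = \<i> * sg (r k)" by (cases "r k") simp_all
    ultimately show ?thesis by (simp only: jw_sq mult_1_left mult.assoc)
  qed
  then show ?thesis unfolding vec_eq_iff vec_lambda_beta by blast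
qed

lemma volume_apply: "(volume *v \<psi>) $ r = \<i> * chi r * \<psi> $ r"
proof -
  have "volume *v \<psi> = (\<chi> r. \<i> * (sg (r 0) * (\<i> * (sg (r 1) * (\<i> * (sg (r 2) * (\<i> * (sg (r 3) * (\<i> * (sg (r 4) * \<psi> $ r))))))))))"
    unfolding volume_def list.map foldr_Cons foldr_Nil comp_def id_def matrix_vector_mul_assoc[symmetric]
      matrix_vector_mul_lid gam_pair vec_lambda_beta ..
  then have "(volume *v \<psi>) $ r = \<i> ^ 5 * chi r * \<psi> $ r"
    unfolding chi_prod by (simp only: vec_lambda_beta eval_nat_numeral BitM.simps power_Suc power_0 mult_1_right mult_ac)
  then show ?thesis by (simp add: i_pow_5)
qed

lemma volume_eigen: "((- \<i>) ^ 5 *s (volume *v \<psi>)) $ r = chi r * \<psi> $ r"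
proof -
  have "(- \<i>) ^ 5 = - \<i>" using i_pow_5 by simp
  then show ?thesis by (simp only: vector_smult_component volume_apply mult.assoc) simp
qed

lemma eq_minus_self_iff: "x = - x \<longleftrightarrow> x = 0" "- x = x \<longleftrightarrow> x = 0" for x :: complex
  by (auto simp: complex_eq_iff)

lemma Delta_p_iff: "\<psi> \<in> \<Delta>\<^sub>p \<longleftrightarrow> (\<forall>r. chi r = -1 \<longrightarrow> \<psi> $ r = 0)"
  unfolding \<Delta>\<^sub>p_def mem_Collect_eq vec_eq_iff volume_eigen
proof (rule iff_allI)
  show "(chi r * \<psi> $ r = \<psi> $ r) \<longleftrightarrow> (chi r = -1 \<longrightarrow> \<psi> $ r = 0)" for r
    by (rule disjE[OF chi_cases[of r]]) (simp_all add: eq_minus_self_iff)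
qed

lemma Delta_m_iff: "\<psi> \<in> \<Delta>\<^sub>m \<longleftrightarrow> (\<forall>r. chi r = 1 \<longrightarrow> \<psi> $ r = 0)"
  unfolding \<Delta>\<^sub>m_def mem_Collect_eq vec_eq_iff volume_eigen vector_uminus_component
proof (rule iff_allI)
  show "(chi r * \<psi> $ r = - \<psi> $ r) \<longleftrightarrow> (chi r = 1 \<longrightarrow> \<psi> $ r = 0)" for r
    by (rule disjE[OF chi_cases[of r]]) (simp_all add: eq_minus_self_iff)
qed

lemma chi_opp [simp]: "chi (opp r) = - chi r" by (simp add: chi_prod)

lemma bilvec_scalar_product: "scalar_product (bilvec \<phi> \<psi>) u = bil \<phi> (cliff u \<psi>)"
proof -
  have "bil \<phi> (\<Sum>i\<in>I. f i) = (\<Sum>i\<in>I. bil \<phi> (f i))" if "finite I" for I :: "vidx set" and f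
    using that by (induct I) (auto simp: bil_linear)
  then show ?thesis
    by (simp add: scalar_product_def bilvec_def cliff_def bil_linear mult.commute)
qed

lemma scalar_product_sym: "scalar_product u v = scalar_product v u" for u v :: V
  by (simp add: scalar_product_def mult.commute)

lemma scalar_product_linear: "scalar_product (u + v) w = scalar_product u w + scalar_product v w"
  "scalar_product (c *s u) w = c * scalar_product u w"
  "scalar_product u (v + w) = scalar_product u v + scalar_product u w"
  "scalar_product u (c *s w) = c * scalar_product u w"
  "scalar_product (u - v) w = scalar_product u w - scalar_product v w"
  "scalar_product u (v - w) = scalar_product u v - scalar_product u w"
  "scalar_product 0 w = 0" "scalar_product u 0 = 0" 
  for u v w :: V
  by (simp_all add: scalar_product_def algebra_simps sum.distrib sum_distrib_left sum_subtractf)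

definition wvec :: "5 \<Rightarrow> bool \<Rightarrow> V" where "wvec k b = axis (k, False) 1 + unit_i b *s axis (k, True) 1"

lemma wvec_scalar_product: "scalar_product u (wvec k b) = wt k b u"
proof -
  have "scalar_product u (axis i 1) = u $ i" for i 
    by (simp add: scalar_product_def axis_def if_distrib cong: if_cong)
  then show ?thesis by (simp add: wvec_def scalar_product_linear wt_def)
qed

lemma wt_wvec: "wt l c (wvec k b) = (if l = k \<and> c \<noteq> b then 2 else 0)"
  by (cases b; cases c) (auto simp: wt_def wvec_def axis_def)

lemma cliff_wvec: "cliff (wvec k b) \<psi> $ r = (if r k = b then 0 else 2 * jw k r * \<psi> $ flip k r)"
proof -
  have "cliff (wvec k b) \<psi> $ r = (\<Sum>l\<in>UNIV. if l = k then if r k = b then 0 else 2 * jw k r * \<psi> $ flip k r else 0)"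
    unfolding cliff_apply by (rule sum.cong) (auto simp: wt_wvec)
  then show ?thesis by simp
qed

lemma wt_bilvec: "wt k b (bilvec \<phi> \<psi>) = (\<Sum>r | r k = b. 2 * csign r * jw k (opp r) * \<phi> $ r * \<psi> $ flip k (opp r))"
proof -
  have "wt k b (bilvec \<phi> \<psi>) = (\<Sum>r\<in>UNIV. if r k = b then 2 * csign r * jw k (opp r) * \<phi> $ r * \<psi> $ flip k (opp r) else 0)"
    unfolding wvec_scalar_product[symmetric] bilvec_scalar_product bil_apply
    by (rule sum.cong) (auto simp: cliff_wvec)
  then show ?thesis by (simp add: sum.If_cases)
qed

definition bits :: "bool \<Rightarrow> bool \<Rightarrow> bool \<Rightarrow> bool \<Rightarrow> bool \<Rightarrow> sidx" where
  "bits a b c d e = (\<lambda>l. if l = 0 then a else if l = 1 then b else if l = 2 then c else if l = 3 then d else e)"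

lemma bits_apply: "bits a b c d e 0 = a" "bits a b c d e 1 = b" "bits a b c d e 2 = c" "bits a b c d e 3 = d" "bits a b c d e 4 = e"
  by (simp_all add: bits_def)

lemma bits_flip: "flip 0 (bits a b c d e) = bits (\<not>a) b c d e" "flip 1 (bits a b c d e) = bits a (\<not>b) c d e"
   "flip 2 (bits a b c d e) = bits a b (\<not>c) d e" "flip 3 (bits a b c d e) = bits a b c (\<not>d) e" "flip 4 (bits a b c d e) = bits a b c d (\<not>e)"
proof -
  have "flip k (bits a b c d e) = bits (if k = 0 then \<not> a else a) (if k = 1 then \<not> b else b) (if k = 2 then \<not> c else c)
    (if k = 3 then \<not> d else d) (if k = 4 then \<not> e else e)" for k
  proof
    fix l show "flip k (bits a b c d e) l = bits (if k = 0 then \<not> a else a) (if k = 1 then \<not> b else b) (if k = 2 then \<not> c else c)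
      (if k = 3 then \<not> d else d) (if k = 4 then \<not> e else e) l"
      using exhaust_5[of l] by (elim disjE) (simp_all add: flip_def bits_def)
  qed
  note * = this
  show "flip 0 (bits a b c d e) = bits (\<not>a) b c d e" "flip 1 (bits a b c d e) = bits a (\<not>b) c d e"
   "flip 2 (bits a b c d e) = bits a b (\<not>c) d e" "flip 3 (bits a b c d e) = bits a b c (\<not>d) e" "flip 4 (bits a b c d e) = bits a b c d (\<not>e)"
    unfolding * by simp_all
qed

lemma bits_opp: "opp (bits a b c d e) = bits (\<not>a) (\<not>b) (\<not>c) (\<not>d) (\<not>e)"
  by (auto simp: opp_def bits_def)

lemma bits_surj: "bits (r 0) (r 1) (r 2) (r 3) (r 4) = r"
proof
  fix l show "bits (r 0) (r 1) (r 2) (r 3) (r 4) l = r l"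
    using exhaust_5[of l] by (elim disjE) (simp_all add: bits_def)
qed

lemma sum_bits: "(\<Sum>r\<in>UNIV. f r) = (\<Sum>a\<in>UNIV. \<Sum>b\<in>UNIV. \<Sum>c\<in>UNIV. \<Sum>d\<in>UNIV. \<Sum>e\<in>UNIV. f (bits a b c d e))" for f :: "sidx \<Rightarrow> 'a::comm_monoid_add"
proof -
  have "bij (\<lambda>(a,b,c,d,e). bits a b c d e)"
    by (rule o_bij[of "\<lambda>r. (r 0, r 1, r 2, r 3, r 4)"]) (auto simp: fun_eq_iff bits_surj bits_apply)
  then have "(\<Sum>r\<in>UNIV. f r) = (\<Sum>x\<in>UNIV. f ((\<lambda>(a,b,c,d,e). bits a b c d e) x))"
    by (rule sum.reindex_bij_betw[symmetric])
  also have "\<dots> = (\<Sum>a\<in>UNIV. \<Sum>b\<in>UNIV. \<Sum>c\<in>UNIV. \<Sum>d\<in>UNIV. \<Sum>e\<in>UNIV. f (bits a b c d e))"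
    by (simp add: sum.cartesian_product case_prod_beta flip: UNIV_Times_UNIV)
  finally show ?thesis .
qed

text \<open>
  Of the 16 indices that agree with \<open>r\<close> in bit \<open>k\<close>, eight have the parity opposite to that of \<open>r\<close>:
  four differ from \<open>r\<close> in one bit and four in three bits. The symmetry of \<open>f\<close> exchanges the two
  kinds.
\<close>

lemma sum_half_cube:
  fixes f :: "sidx \<Rightarrow> complex"
  assumes r: "chi r = 1" and zero: "\<And>q. chi q = 1 \<Longrightarrow> f q = 0" and sym: "\<And>q. f (opp (flip k q)) = f q"
  shows "(\<Sum>q | q k = r k. f q) = 2 * (\<Sum>l\<in>UNIV - {k}. f (flip l r))"
proof -
  obtain a b c d e where re: "r = bits a b c d e" using bits_surj by metis
  have chi: "sg a * sg b * sg c * sg d * sg e = 1" using r by (simp add: re chi_prod bits_apply)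
  have z: "f (bits a' b' c' d' e') = 0" if "sg a' * sg b' * sg c' * sg d' * sg e' = 1" for a' b' c' d' e'
    using that by (intro zero) (simp add: chi_prod bits_apply)
  have S: "(\<Sum>q | q k = r k. f q) = (\<Sum>q\<in>UNIV. if q k = r k then f q else 0)"
    by (simp add: sum.If_cases)
  have minus: "UNIV - {k} = set (filter (\<lambda>l. l \<noteq> k) [0,1,2,3,4])" unfolding UNIV_5 by auto
  have sy: "f (opp (flip k (flip l (bits a b c d e)))) = f (flip l (bits a b c d e))" for l
    by (rule sym)
  have expand: "(\<Sum>q\<in>UNIV. g q) = (\<Sum>a'\<in>{a, \<not> a}. \<Sum>b'\<in>{b, \<not> b}. \<Sum>c'\<in>{c, \<not> c}. \<Sum>d'\<in>{d, \<not> d}. \<Sum>e'\<in>{e, \<not> e}. g (bits a' b' c' d' e'))" for g :: "sidx \<Rightarrow> complex"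
  proof -
    have "{x, \<not> x} = UNIV" for x by auto
    then show ?thesis by (simp only: sum_bits)
  qed
  note syl = sy[of 0] sy[of 1] sy[of 2] sy[of 3] sy[of 4]
  from exhaust_5[of k] show ?thesis
    unfolding S expand minus unfolding re using syl
    by (elim disjE; hypsubst) (simp_all add: bits_apply bits_flip bits_opp z chi)
qed

lemma jw_opp: "jw k r * jw k (opp r) = (if k \<in> {1, 3} then -1 else 1)"
proof -
  have "jw k r * jw k (opp r) = (\<Prod>l<k. -1)"
    unfolding jw_def by (simp flip: prod.distrib)
  then show ?thesis using exhaust_5[of k] by (elim disjE) (simp_all add: lessThan_5)
qed

lemma csign_flip: "csign (flip l r) = (if l \<in> {1, 3} then - csign r else csign r)"
  using exhaust_5[of l] by (elim disjE) (simp_all add: csign_def)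

text \<open>The sign that makes the terms of the Fierz identity cancel.\<close>

lemma fierz_sign:
  assumes "k \<noteq> l"
  shows "jw k r * csign (flip l r) * jw k (flip l (opp r)) = - (jw l r * csign (flip k r) * jw l (flip k (opp r)))"
proof -
  have *: "jw k r * csign (flip l r) * jw k (flip l (opp r)) =
    (jw k r * jw k (opp r)) * (csign r * (if l \<in> {1, 3} then -1 else 1) * (if l < k then -1 else 1))" for k l
    by (simp add: csign_flip jw_flip)
  show ?thesis unfolding * jw_opp using assms by auto
qed

lemma sum_antisym: fixes f :: "'a::finite \<Rightarrow> 'a \<Rightarrow> complex"
  assumes "\<And>k l. f k l = - f l k" shows "(\<Sum>k\<in>UNIV. \<Sum>l\<in>UNIV. f k l) = 0"
proof -
  have "(\<Sum>k\<in>UNIV. \<Sum>l\<in>UNIV. f k l) = (\<Sum>k\<in>UNIV. \<Sum>l\<in>UNIV. - f k l)"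
    by (rule trans[OF sum.swap]) (intro sum.cong refl assms)
  then show ?thesis by (simp add: sum_negf)
qed

text \<open>
  By weights, the only monomials in the component at \<open>r\<close> are products of three components of \<open>\<phi>\<close>
  whose indices differ from \<open>r\<close> in the bit \<open>k\<close>, in the bit \<open>l\<close>, and in the three other bits. Each
  occurs twice, as \<open>(k, l)\<close> and as \<open>(l, k)\<close>, with opposite signs.
\<close>

lemma fierz:
  assumes "\<phi> \<in> \<Delta>\<^sub>m" shows "cliff (bilvec \<phi> \<phi>) \<phi> = 0"
proof -
  have z: "\<phi> $ r = 0" if "chi r = 1" for r
    using assms that by (simp add: Delta_m_iff)
  have "cliff (bilvec \<phi> \<phi>) \<phi> $ r = 0" for r
  proof (cases "chi r = 1")
    case True
    define f where "f k q = 2 * csign q * jw k (opp q) * \<phi> $ q * \<phi> $ flip k (opp q)" for k q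
    have f: "(\<Sum>q | q k = r k. f k q) = 2 * (\<Sum>l\<in>UNIV - {k}. f k (flip l r))" for k
    proof (rule sum_half_cube)
      fix q show "f k (opp (flip k q)) = f k q"
        using csign_jw[of q k] by (simp add: f_def csign_flip)
    qed (simp_all add: True f_def z)
    \<comment> \<open>the summand of the ordered pair \<open>(k, l)\<close>\<close>
    define h where "h k l = (if l = k then 0 else jw k r * \<phi> $ flip k r * f k (flip l r))" for k l
    have hh: "h k l = - h l k" for k l
    proof (cases "k = l")
      case True then show ?thesis by (simp add: h_def)
    next
      case False
      have "h k l = 2 * (jw k r * csign (flip l r) * jw k (flip l (opp r))) * (\<phi> $ flip k r * \<phi> $ flip l r * \<phi> $ flip k (flip l (opp r)))"
        if "k \<noteq> l" for k l
        using that by (simp add: h_def f_def)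
      from this[OF False] this[of l k] show ?thesis using fierz_sign[OF False, of r] False
        by (simp add: flip_commute[of k l])
    qed
    have "cliff (bilvec \<phi> \<phi>) \<phi> $ r = (\<Sum>k\<in>UNIV. jw k r * (\<Sum>q | q k = r k. f k q) * \<phi> $ flip k r)"
      by (simp add: cliff_apply wt_bilvec f_def)
    also have "\<dots> = 2 * (\<Sum>k\<in>UNIV. \<Sum>l\<in>UNIV - {k}. h k l)"
      unfolding f by (auto simp: sum_distrib_left sum_distrib_right h_def mult_ac intro!: sum.cong)
    also have "(\<Sum>k\<in>UNIV. \<Sum>l\<in>UNIV - {k}. h k l) = (\<Sum>k\<in>UNIV. \<Sum>l\<in>UNIV. h k l)"
      by (intro sum.cong refl sum.mono_neutral_left) (auto simp: h_def)
    finally show ?thesis using sum_antisym[OF hh] by simp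
  next
    case False
    then have "chi r = -1" using chi_cases[of r] by simp
    then show ?thesis by (simp add: cliff_apply z)
  qed
  then show ?thesis by (simp add: vec_eq_iff)
qed

section \<open>The Lie algebra on the dual and its cubic form\<close>

definition rsqrt2 :: complex where "rsqrt2 = complex_of_real (1 / sqrt 2)"

lemma rsqrt2_sq: "rsqrt2 * rsqrt2 = 1 / 2" "rsqrt2 * (rsqrt2 * x) = x / 2"
proof -
  show 1: "rsqrt2 * rsqrt2 = 1 / 2" unfolding rsqrt2_def of_real_mult[symmetric] by simp
  show "rsqrt2 * (rsqrt2 * x) = x / 2" unfolding mult.assoc[symmetric] 1 by simp
qed

lemma gam_cliff: "gam i *v \<psi> = cliff (axis i 1) \<psi>"
proof -
  have "cliff (axis i 1) \<psi> = (\<Sum>j\<in>UNIV. if j = i then gam i *v \<psi> else 0)"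
    unfolding cliff_def by (rule sum.cong) (auto simp: axis_def)
  then show ?thesis by simp
qed

lemma bilvec_nth: "bilvec \<phi> \<psi> $ i = bil \<phi> (cliff (axis i 1) \<psi>)"
  by (simp add: bilvec_def gam_cliff)

lemma bilvec_sym: "bilvec \<phi> \<psi> = bilvec \<psi> \<phi>"
proof -
  have "bil \<phi> (cliff u \<psi>) = bil \<psi> (cliff u \<phi>)" for u by (metis bil_cliff bil_sym)
  then show ?thesis by (simp only: vec_eq_iff bilvec_nth) blast
qed

lemma bilvec_linear: "bilvec (\<phi> + \<omega>) \<psi> = bilvec \<phi> \<psi> + bilvec \<omega> \<psi>" "bilvec (c *s \<phi>) \<psi> = c *s bilvec \<phi> \<psi>"
  "bilvec \<phi> (\<psi> + \<omega>) = bilvec \<phi> \<psi> + bilvec \<phi> \<omega>" "bilvec \<phi> (c *s \<psi>) = c *s bilvec \<phi> \<psi>"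
  "bilvec 0 \<psi> = 0" "bilvec \<psi> 0 = 0"
  by (simp_all add: vec_eq_iff bilvec_nth bil_linear cliff_linear)

lemma spin_cliff: "spin A \<psi> = (1 / 4) *s (\<Sum>i\<in>UNIV. \<Sum>j\<in>UNIV. A $ i $ j *s cliff (axis i 1) (cliff (axis j 1) \<psi>))"
  by (simp add: spin_def gam_cliff)

lemma bil_sum: "bil \<phi> (\<Sum>i\<in>I. f i) = (\<Sum>i\<in>I. bil \<phi> (f i))" "bil (\<Sum>i\<in>I. f i) \<phi> = (\<Sum>i\<in>I. bil (f i) \<phi>)"
  by (induct I rule: infinite_finite_induct) (auto simp: bil_linear)

lemma cliff_sum: "cliff (\<Sum>i\<in>I. g i) \<phi> = (\<Sum>i\<in>I. cliff (g i) \<phi>)" "cliff u (\<Sum>i\<in>I. f i) = (\<Sum>i\<in>I. cliff u (f i))"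
  by (induct I rule: infinite_finite_induct) (auto simp: cliff_linear)

lemma antisym_nth: "transpose A = - A \<Longrightarrow> A $ j $ i = - A $ i $ j" for A :: "complex ^ 'n ^ 'n"
proof -
  assume "transpose A = - A"
  then have "transpose A $ i $ j = (- A) $ i $ j" by simp
  then show ?thesis by (simp only: transpose_def vec_lambda_beta vector_uminus_component)
qed

text \<open>
  An antisymmetric matrix changes sign when the two indices of the other factor are exchanged;
  this is what both forms being invariant under \<open>\<ss>\<oo>(10,\<complex>)\<close> comes down to.
\<close>

lemma sum_antisym_swap:
  fixes A :: "complex ^ 'n ^ 'n" assumes "transpose A = - A"
  shows "(\<Sum>i\<in>UNIV. \<Sum>j\<in>UNIV. A $ i $ j * f i j) = - (\<Sum>i\<in>UNIV. \<Sum>j\<in>UNIV. A $ i $ j * f j i)"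
proof -
  have "(\<Sum>i\<in>UNIV. \<Sum>j\<in>UNIV. A $ i $ j * f i j) = (\<Sum>i\<in>UNIV. \<Sum>j\<in>UNIV. A $ j $ i * f j i)"
    by (rule sum.swap)
  also have "\<dots> = (\<Sum>i\<in>UNIV. \<Sum>j\<in>UNIV. - (A $ i $ j * f j i))"
    by (intro sum.cong refl, subst antisym_nth[OF assms]) simp
  finally show ?thesis by (simp add: sum_negf)
qed

lemma scalar_product_antisym:
  fixes u v :: V assumes "transpose A = - A" shows "scalar_product (A *v u) v = - scalar_product u (A *v v)"
proof -
  have 1: "scalar_product (A *v u) v = (\<Sum>i\<in>UNIV. \<Sum>j\<in>UNIV. A $ i $ j * (u $ j * v $ i))"
    by (simp only: scalar_product_def matrix_vector_mult_def vec_lambda_beta sum_distrib_right mult.assoc)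
  have 2: "scalar_product u (A *v v) = (\<Sum>i\<in>UNIV. \<Sum>j\<in>UNIV. A $ i $ j * (u $ i * v $ j))"
    by (simp only: scalar_product_def matrix_vector_mult_def vec_lambda_beta sum_distrib_left mult.left_commute)
  show ?thesis unfolding 1 2 by (rule sum_antisym_swap[OF assms])
qed

lemma bil_spin:
  assumes "transpose A = - A" shows "bil (spin A \<phi>) \<psi> = - bil \<phi> (spin A \<psi>)"
proof -
  let ?g = "\<lambda>i. cliff (axis i 1)"
  have 1: "bil (spin A \<phi>) \<psi> = 1 / 4 * (\<Sum>i\<in>UNIV. \<Sum>j\<in>UNIV. A $ i $ j * bil \<phi> (?g j (?g i \<psi>)))"
    by (simp only: spin_cliff bil_linear bil_sum bil_cliff[symmetric])
  have 2: "bil \<phi> (spin A \<psi>) = 1 / 4 * (\<Sum>i\<in>UNIV. \<Sum>j\<in>UNIV. A $ i $ j * bil \<phi> (?g i (?g j \<psi>)))"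
    by (simp only: spin_cliff bil_linear bil_sum)
  show ?thesis
    unfolding 1 2 by (subst sum_antisym_swap[OF assms]) (simp only: mult_minus_right)
qed

lemma scalar_product_axis: "scalar_product (axis i 1) u = u $ i" "scalar_product u (axis i 1) = u $ i" for u :: V
proof -
  have "scalar_product (axis i 1) u = (\<Sum>j\<in>UNIV. if j = i then u $ i else 0)"
    unfolding scalar_product_def by (rule sum.cong) (simp_all add: axis_def)
  then show "scalar_product (axis i 1) u = u $ i" by simp
  then show "scalar_product u (axis i 1) = u $ i" by (simp only: scalar_product_sym)
qed

lemma cliff_nth: "cliff u \<psi> $ r = (\<Sum>i\<in>UNIV. u $ i * cliff (axis i 1) \<psi> $ r)"
  by (simp add: cliff_def[of u] gam_cliff)

lemma spin_nth: "spin A \<psi> $ r = (\<Sum>i\<in>UNIV. \<Sum>j\<in>UNIV. A $ i $ j * cliff (axis i 1) (cliff (axis j 1) \<psi>) $ r) / 4"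
  by (simp add: spin_cliff)

text \<open>
  The spinor action is compatible with the vector action, as in the normalisation of \<open>spin\<close>: move
  \<open>u\<close> to the left past both gamma matrices by the Clifford relations.
\<close>

lemma spin_cliff_commutator:
  assumes "transpose A = - A"
  shows "spin A (cliff u \<psi>) - cliff u (spin A \<psi>) = cliff (A *v u) \<psi>"
proof -
  let ?g = "\<lambda>i. cliff (axis i 1)"
  have com: "?g i (cliff u \<omega>) = (2 * u $ i) *s \<omega> - cliff u (?g i \<omega>)" for i \<omega>
    using cliff_cliff[of "axis i 1" u \<omega>] by (simp add: scalar_product_axis eq_diff_eq)
  have d: "?g i (?g j (cliff u \<psi>)) $ r - cliff u (?g i (?g j \<psi>)) $ r
    = 2 * (u $ j * ?g i \<psi> $ r) - 2 * (u $ i * ?g j \<psi> $ r)" for i j r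
    by (simp add: com cliff_linear)
  have "(spin A (cliff u \<psi>) - cliff u (spin A \<psi>)) $ r = cliff (A *v u) \<psi> $ r" for r
  proof -
    have "4 * cliff u (spin A \<psi>) $ r = (\<Sum>i\<in>UNIV. \<Sum>j\<in>UNIV. A $ i $ j * cliff u (?g i (?g j \<psi>)) $ r)"
      by (simp add: spin_cliff cliff_linear cliff_sum)
    then have "4 * (spin A (cliff u \<psi>) - cliff u (spin A \<psi>)) $ r =
      (\<Sum>i\<in>UNIV. \<Sum>j\<in>UNIV. A $ i $ j * ?g i (?g j (cliff u \<psi>)) $ r) - (\<Sum>i\<in>UNIV. \<Sum>j\<in>UNIV. A $ i $ j * cliff u (?g i (?g j \<psi>)) $ r)"
      by (simp add: spin_nth right_diff_distrib)
    also have "\<dots> = (\<Sum>i\<in>UNIV. \<Sum>j\<in>UNIV. A $ i $ j * (?g i (?g j (cliff u \<psi>)) $ r - cliff u (?g i (?g j \<psi>)) $ r))"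
      by (simp only: right_diff_distrib sum_subtractf)
    also have "\<dots> = (\<Sum>i\<in>UNIV. \<Sum>j\<in>UNIV. A $ i $ j * (2 * (u $ j * ?g i \<psi> $ r))) - (\<Sum>i\<in>UNIV. \<Sum>j\<in>UNIV. A $ i $ j * (2 * (u $ i * ?g j \<psi> $ r)))"
      unfolding d by (simp only: right_diff_distrib sum_subtractf)
    also have "\<dots> = 2 * (\<Sum>i\<in>UNIV. \<Sum>j\<in>UNIV. A $ i $ j * (2 * (u $ j * ?g i \<psi> $ r)))"
      by (subst (2) sum_antisym_swap[OF assms]) (simp only: mult_2 diff_minus_eq_add)
    also have "\<dots> = 2 * (2 * (\<Sum>i\<in>UNIV. \<Sum>j\<in>UNIV. A $ i $ j * (u $ j * ?g i \<psi> $ r)))"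
      by (simp only: sum_distrib_left mult.left_commute)
    also have "\<dots> = 4 * (\<Sum>i\<in>UNIV. \<Sum>j\<in>UNIV. A $ i $ j * (u $ j * ?g i \<psi> $ r))"
      by simp
    also have "\<dots> = 4 * cliff (A *v u) \<psi> $ r"
      unfolding cliff_nth[of "A *v u"] by (simp only: matrix_vector_mult_def vec_lambda_beta sum_distrib_right mult.assoc)
    finally show ?thesis by (simp only: mult_cancel_left) simp
  qed
  then show ?thesis unfolding vec_eq_iff by blast
qed

text \<open>The contragredient of \<open>e6_act\<close>, i.e. the negative of its adjoint for the pairing.\<close>

definition dual_lie :: "complex ^ vidx ^ vidx \<Rightarrow> \<Delta> \<Rightarrow> \<Delta> \<Rightarrow> complex \<Rightarrow> E \<Rightarrow> E" where
  "dual_lie A \<xi> \<eta> c = (\<lambda>(u, \<phi>, t).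
     (A *v u + rsqrt2 *s bilvec \<phi> \<eta> - (2 * \<i> * c) *s u,
      spin A \<phi> - rsqrt2 *s cliff u \<xi> + t *s \<eta> + (\<i> * c) *s \<phi>,
      4 * \<i> * c * t - bil \<phi> \<xi>))"

lemma pairing_dual_lie:
  assumes "transpose A = - A"
  shows "pairing (dual_lie A \<xi> \<eta> c z) w = - pairing z (e6_act A \<xi> \<eta> c w)"
proof -
  obtain u \<phi> t where z: "z = (u, \<phi>, t)" by (cases z)
  obtain v \<psi> s where w: "w = (v, \<psi>, s)" by (cases w)
  have 1: "bil (cliff u \<xi>) \<psi> = scalar_product u (bilvec \<xi> \<psi>)"
    by (simp add: scalar_product_sym[of u] bilvec_scalar_product bil_cliff)
  have 2: "scalar_product (bilvec \<phi> \<eta>) v = bil \<phi> (cliff v \<eta>)" by (rule bilvec_scalar_product)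
  show ?thesis
    by (simp add: z w pairing_def dual_lie_def e6_act_def[folded rsqrt2_def] scalar_product_linear bil_linear 1 2
      scalar_product_antisym[OF assms] bil_spin[OF assms] algebra_simps)
qed

definition cubic_form :: "E \<Rightarrow> complex" where
  "cubic_form = (\<lambda>(u, \<phi>, t). scalar_product u u * t - rsqrt2 * bil \<phi> (cliff u \<phi>))"

text \<open>
  In the third argument this is the differential at \<open>(u, \<phi>, t)\<close> of the cubic form, and its
  coefficients are the 27 quadrics.
\<close>

lemma cubic_diag: "cubic (u, \<phi>, t) (u, \<phi>, t) (v, \<psi>, s) =
   2 * t * scalar_product u v + s * scalar_product u u - rsqrt2 * bil \<phi> (cliff v \<phi>) - 2 * rsqrt2 * bil \<psi> (cliff u \<phi>)"
proof -
  have "bil \<phi> (cliff u \<psi>) = bil \<psi> (cliff u \<phi>)" by (metis bil_cliff bil_sym)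
  then show ?thesis
    by (simp add: cubic_def[folded rsqrt2_def] scalar_product_sym[of v u] algebra_simps)
qed

text \<open>
  The part of \<open>\<xi>\<close> cancels by \<open>u u \<xi> = (u \<cdot> u) \<xi>\<close>, the part of \<open>A\<close> by invariance of the two
  bilinear forms, and the part of \<open>c\<close> by weights. In the part of \<open>\<eta>\<close> the terms with \<open>t\<close> cancel;
  the remaining one, of degree three in \<open>\<phi>\<close>, is zero by the Fierz identity.
\<close>

lemma cubic_infinitesimal:
  assumes A: "transpose A = - A" and z: "z \<in> dual27" 
  shows "cubic z z (dual_lie A \<xi> \<eta> c z) = 0"
proof -
  obtain u \<phi> t where z': "z = (u, \<phi>, t)" by (cases z)
  have \<phi>: "\<phi> \<in> \<Delta>\<^sub>m" using z by (simp add: z' dual27_def)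
  have 1: "scalar_product u (A *v u) = 0"
    using scalar_product_antisym[OF A, of u u] by (simp add: scalar_product_sym eq_minus_self_iff)
  have "bil \<phi> (spin A (cliff u \<phi>)) = - bil (spin A \<phi>) (cliff u \<phi>)" by (simp add: bil_spin[OF A])
  moreover have "bil \<phi> (cliff u (spin A \<phi>)) = bil (spin A \<phi>) (cliff u \<phi>)"  by (metis bil_cliff bil_sym)
  ultimately have 2: "bil \<phi> (cliff (A *v u) \<phi>) = - 2 * bil (spin A \<phi>) (cliff u \<phi>)"
    using arg_cong[OF spin_cliff_commutator[OF A, of u \<phi>], of "bil \<phi>"] by (simp add: bil_linear)
  have 3: "bil (cliff u \<xi>) (cliff u \<phi>) = scalar_product u u * bil \<xi> \<phi>"
    by (simp add: bil_cliff[symmetric] cliff_sq bil_linear)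
  have 4: "scalar_product u (bilvec \<phi> \<eta>) = bil \<eta> (cliff u \<phi>)"
    using bilvec_scalar_product[of \<phi> \<eta> u] by (metis bil_cliff bil_sym scalar_product_sym)
  have "bil \<phi> (cliff (bilvec \<phi> \<eta>) \<phi>) = scalar_product (bilvec \<phi> \<phi>) (bilvec \<phi> \<eta>)"
    by (simp add: bilvec_scalar_product)
  also have "\<dots> = bil \<eta> (cliff (bilvec \<phi> \<phi>) \<phi>)" 
    using bilvec_scalar_product[of \<phi> \<eta> "bilvec \<phi> \<phi>"] by (metis bil_cliff bil_sym scalar_product_sym)
  finally have 5: "bil \<phi> (cliff (bilvec \<phi> \<eta>) \<phi>) = 0" by (simp add: fierz[OF \<phi>] bil_linear)
  show ?thesis
    unfolding z' dual_lie_def prod.case cubic_diag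
    by (simp add: scalar_product_linear cliff_linear bil_linear 1 2 3 4 5 rsqrt2_sq bil_sym[of \<xi> \<phi>] algebra_simps)
qed

section \<open>Exponentials of linear maps\<close>

lemma op_exp_term_bound:
  fixes X :: "'a::euclidean_space \<Rightarrow> 'a" assumes "linear X"
  obtains K where "K > 0" "\<And>n v. norm ((X ^^ n) v) \<le> K ^ n * norm v"
proof -
  obtain K where K: "K > 0" "\<And>v. norm (X v) \<le> K * norm v"
    using linear_bounded_pos[OF assms] by blast
  have "norm ((X ^^ n) v) \<le> K ^ n * norm v" for n v
  proof (induct n)
    case (Suc n)
    have "norm ((X ^^ Suc n) v) \<le> K * norm ((X ^^ n) v)" using K(2) by simp
    also have "\<dots> \<le> K * (K ^ n * norm v)" using Suc K(1) by simp
    finally show ?case by simp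
  qed simp
  with K(1) that show ?thesis by blast
qed

text \<open>The exponential of \<open>\<tau> X\<close> applied to \<open>v\<close>, arranged as a power series in \<open>\<tau>\<close>.\<close>

definition exp_curve :: "('a::euclidean_space \<Rightarrow> 'a) \<Rightarrow> 'a \<Rightarrow> real \<Rightarrow> 'a" where
  "exp_curve X v \<tau> = (\<Sum>n. \<tau> ^ n *\<^sub>R ((1 / fact n) *\<^sub>R (X ^^ n) v))"

lemma exp_curve_summable:
  fixes X :: "'a::euclidean_space \<Rightarrow> 'a" assumes "linear X"
  shows "summable (\<lambda>n. \<tau> ^ n *\<^sub>R ((1 / fact n) *\<^sub>R (X ^^ n) v))"
proof -
  obtain K where K: "K > 0" "\<And>n v. norm ((X ^^ n) v) \<le> K ^ n * norm v"
    using op_exp_term_bound[OF assms] by blast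
  have "summable (\<lambda>n. (inverse (fact n) * (\<bar>\<tau>\<bar> * K) ^ n) * norm v)"
    by (intro summable_mult2 summable_exp)
  then show ?thesis
  proof (rule summable_comparison_test'[where N = 0])
    fix n
    have "norm (\<tau> ^ n *\<^sub>R ((1 / fact n) *\<^sub>R (X ^^ n) v)) = \<bar>\<tau>\<bar> ^ n * (1 / fact n) * norm ((X ^^ n) v)"
      by (simp add: power_abs)
    also have "\<dots> \<le> \<bar>\<tau>\<bar> ^ n * (1 / fact n) * (K ^ n * norm v)"
      by (intro mult_left_mono K(2)) simp
    finally show "norm (\<tau> ^ n *\<^sub>R ((1 / fact n) *\<^sub>R (X ^^ n) v)) \<le> inverse (fact n) * (\<bar>\<tau>\<bar> * K) ^ n * norm v"
      by (simp add: power_mult_distrib field_simps)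
  qed
qed

text \<open>
  Every component of the curve is an everywhere convergent real power series, which may be
  differentiated term by term.
\<close>

lemma exp_curve_has_vector_derivative:
  fixes X :: "'a::euclidean_space \<Rightarrow> 'a" assumes X: "linear X"
  shows "(exp_curve X v has_vector_derivative X (exp_curve X v \<tau>)) (at \<tau>)"
proof -
  let ?a = "\<lambda>n. (1 / fact n) *\<^sub>R (X ^^ n) v"
  have bX: "bounded_linear X" using X by (simp add: linear_conv_bounded_linear)
  have "((\<lambda>x. exp_curve X v x \<bullet> b) has_real_derivative X (exp_curve X v \<tau>) \<bullet> b) (at \<tau>)" for b
  proof -
    have s: "(\<lambda>n. (?a n \<bullet> b) * x ^ n) sums (exp_curve X v x \<bullet> b)" for x
      using bounded_linear.sums[OF bounded_linear_inner_left summable_sums[OF exp_curve_summable[OF X, of x v]]]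
      by (simp add: exp_curve_def mult_ac)
    have "(\<lambda>n. X (\<tau> ^ n *\<^sub>R ?a n) \<bullet> b) sums (X (exp_curve X v \<tau>) \<bullet> b)"
      using bounded_linear.sums[OF bounded_linear_inner_left bounded_linear.sums[OF bX summable_sums[OF exp_curve_summable[OF X, of \<tau> v]]]]
      by (simp add: exp_curve_def)
    moreover have "X (\<tau> ^ n *\<^sub>R ?a n) \<bullet> b = diffs (\<lambda>n. ?a n \<bullet> b) n * \<tau> ^ n" for n
    proof -
      have "real (Suc n) * (1 / fact (Suc n)) = 1 / fact n"
        by (simp add: divide_simps del: of_nat_Suc)
      then have "diffs (\<lambda>n. ?a n \<bullet> b) n = 1 / fact n * (X ((X ^^ n) v) \<bullet> b)"
        by (simp only: diffs_def inner_scaleR_left mult.assoc[symmetric] funpow.simps comp_def)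
      then show ?thesis by (simp add: linear_cmul[OF X])
    qed
    ultimately have d: "(\<lambda>n. diffs (\<lambda>n. ?a n \<bullet> b) n * \<tau> ^ n) sums (X (exp_curve X v \<tau>) \<bullet> b)" by simp
    have "((\<lambda>x. \<Sum>n. (?a n \<bullet> b) * x ^ n) has_real_derivative (\<Sum>n. diffs (\<lambda>n. ?a n \<bullet> b) n * \<tau> ^ n)) (at \<tau>)"
      by (rule termdiffs_strong_converges_everywhere) (use s in \<open>auto simp: sums_iff\<close>)
    then show ?thesis using s d by (simp add: sums_iff)
  qed
  then show ?thesis
    unfolding has_vector_derivative_def has_derivative_componentwise_within[of "exp_curve X v"]
    by (simp add: has_field_derivative_def mult_commute_abs)
qed

lemma exp_curve_0: "exp_curve X v 0 = v"
proof -
  have "exp_curve X v 0 = (\<Sum>n. if n = 0 then v else 0)"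
    unfolding exp_curve_def by (rule suminf_cong) auto
  then show ?thesis by (subst (asm) suminf_finite[of "{0}"]) auto
qed

lemma exp_curve_1: "exp_curve X v 1 = op_exp X v"
  by (simp add: exp_curve_def op_exp_def)

text \<open>
  Subspaces of a Euclidean space are closed, so they contain the sum of the exponential series.
\<close>

lemma exp_curve_mem:
  fixes X :: "'a::euclidean_space \<Rightarrow> 'a" assumes X: "linear X" and S: "subspace S" and inv: "\<And>v. v \<in> S \<Longrightarrow> X v \<in> S" and v: "v \<in> S"
  shows "exp_curve X v \<tau> \<in> S"
proof -
  have "(X ^^ n) v \<in> S" for n by (induct n) (auto intro: inv v)
  then have 1: "(\<Sum>i<n. \<tau> ^ i *\<^sub>R ((1 / fact i) *\<^sub>R (X ^^ i) v)) \<in> S" for n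
    by (intro subspace_sum[OF S] subspace_scale[OF S])
  have 2: "(\<lambda>n. \<Sum>i<n. \<tau> ^ i *\<^sub>R ((1 / fact i) *\<^sub>R (X ^^ i) v)) \<longlonglongrightarrow> exp_curve X v \<tau>"
    using summable_sums[OF exp_curve_summable[OF X, of \<tau> v]] unfolding sums_def exp_curve_def .
  show ?thesis
    by (rule closed_sequentially[OF closed_subspace[OF S] 1 2])
qed

lemma exp_curve_invariant:
  fixes f :: "real \<Rightarrow> complex"
  assumes "\<And>\<tau>. (f has_vector_derivative 0) (at \<tau>)" shows "f 1 = f 0"
  using has_vector_derivative_zero_constant[of UNIV f] assms by (metis UNIV_I convex_UNIV)

lemma op_exp_nilpotent:
  assumes "(X ^^ 3) v = 0" and "X 0 = 0"
  shows "op_exp X v = v + X v + (1 / 2) *\<^sub>R X (X v)"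
proof -
  have "(X ^^ (n + 3)) v = 0" for n
  proof -
    have "(X ^^ n) 0 = 0" by (induct n) (simp_all add: assms(2))
    then show ?thesis by (simp add: funpow_add assms(1) del: funpow.simps)
  qed
  then have "(X ^^ n) v = 0" if "n \<ge> 3" for n using that by (metis le_add_diff_inverse2)
  then have "op_exp X v = (\<Sum>n\<in>{0,1,2}. (1 / fact n) *\<^sub>R (X ^^ n) v)"
    unfolding op_exp_def by (intro suminf_finite) (auto simp: not_le_imp_less)
  then show ?thesis by (simp add: numeral_2_eq_2 add.assoc)
qed

lemma scaleR_smult: "c *\<^sub>R x = complex_of_real c *s x" for x :: "complex ^ 'n"
  unfolding vec_eq_iff vector_scaleR_component vector_smult_component by (simp add: scaleR_conv_of_real)

lemma spin_linear: "spin A (\<phi> + \<psi>) = spin A \<phi> + spin A \<psi>" "spin A (c *s \<phi>) = c *s spin A \<phi>"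
  by (simp_all add: vec_eq_iff spin_nth cliff_linear sum.distrib sum_distrib_left distrib_left add_divide_distrib mult_ac)

lemma scaleR_complex: "c *\<^sub>R x = complex_of_real c * x"
  by (simp add: scaleR_conv_of_real)

lemma linear_dual_lie: "linear (dual_lie A \<xi> \<eta> c)"
  by (rule linearI, auto simp: dual_lie_def scaleR_smult scaleR_complex spin_linear bilvec_linear cliff_linear bil_linear
    matrix_vector_right_distrib vector_scalar_commute vec_eq_iff algebra_simps)

lemma linear_e6_act: "linear (e6_act A \<xi> \<eta> c)"
  by (rule linearI, auto simp: e6_act_def scaleR_smult scaleR_complex spin_linear bilvec_linear cliff_linear bil_linear
    matrix_vector_right_distrib vector_scalar_commute vec_eq_iff algebra_simps)

lemma cliff_chirality: "\<psi> \<in> \<Delta>\<^sub>p \<Longrightarrow> cliff u \<psi> \<in> \<Delta>\<^sub>m" "\<psi> \<in> \<Delta>\<^sub>m \<Longrightarrow> cliff u \<psi> \<in> \<Delta>\<^sub>p"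
  by (auto simp: Delta_p_iff Delta_m_iff cliff_apply)

lemma Delta_closed:
  "0 \<in> \<Delta>\<^sub>p" "0 \<in> \<Delta>\<^sub>m" 
  "\<phi> \<in> \<Delta>\<^sub>p \<Longrightarrow> \<psi> \<in> \<Delta>\<^sub>p \<Longrightarrow> \<phi> + \<psi> \<in> \<Delta>\<^sub>p" "\<phi> \<in> \<Delta>\<^sub>p \<Longrightarrow> c *s \<phi> \<in> \<Delta>\<^sub>p"
  "\<phi> \<in> \<Delta>\<^sub>m \<Longrightarrow> \<psi> \<in> \<Delta>\<^sub>m \<Longrightarrow> \<phi> + \<psi> \<in> \<Delta>\<^sub>m" "\<phi> \<in> \<Delta>\<^sub>m \<Longrightarrow> c *s \<phi> \<in> \<Delta>\<^sub>m"
  "\<phi> \<in> \<Delta>\<^sub>p \<Longrightarrow> \<psi> \<in> \<Delta>\<^sub>p \<Longrightarrow> \<phi> - \<psi> \<in> \<Delta>\<^sub>p" 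
  "\<phi> \<in> \<Delta>\<^sub>m \<Longrightarrow> \<psi> \<in> \<Delta>\<^sub>m \<Longrightarrow> \<phi> - \<psi> \<in> \<Delta>\<^sub>m"
  "\<phi> \<in> \<Delta>\<^sub>p \<Longrightarrow> - \<phi> \<in> \<Delta>\<^sub>p" "\<phi> \<in> \<Delta>\<^sub>m \<Longrightarrow> - \<phi> \<in> \<Delta>\<^sub>m"
  by (auto simp: Delta_p_iff Delta_m_iff)

lemma spin_chirality: "\<psi> \<in> \<Delta>\<^sub>p \<Longrightarrow> spin A \<psi> \<in> \<Delta>\<^sub>p" "\<psi> \<in> \<Delta>\<^sub>m \<Longrightarrow> spin A \<psi> \<in> \<Delta>\<^sub>m"
  using cliff_chirality by (auto simp: Delta_p_iff Delta_m_iff spin_nth intro!: sum.neutral)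

lemma dual_lie_mem: "\<xi> \<in> \<Delta>\<^sub>p \<Longrightarrow> \<eta> \<in> \<Delta>\<^sub>m \<Longrightarrow> z \<in> dual27 \<Longrightarrow> dual_lie A \<xi> \<eta> c z \<in> dual27"
  by (auto simp: dual27_def dual_lie_def intro!: Delta_closed spin_chirality cliff_chirality)

lemma e6_act_mem: "\<xi> \<in> \<Delta>\<^sub>p \<Longrightarrow> \<eta> \<in> \<Delta>\<^sub>m \<Longrightarrow> z \<in> rep27 \<Longrightarrow> e6_act A \<xi> \<eta> c z \<in> rep27"
  by (auto simp: rep27_def e6_act_def intro!: Delta_closed spin_chirality cliff_chirality)

lemma subspace_dual27: "subspace dual27" and subspace_rep27: "subspace rep27"
  by (auto simp: subspace_def dual27_def rep27_def scaleR_smult zero_prod_def intro!: Delta_closed)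

section \<open>Exponentials and the contragredient action\<close>

lemma bil_axis: "bil \<phi> (axis s 1) = csign s * \<phi> $ opp s"
proof -
  have "bil \<phi> (axis s 1) = (\<Sum>r\<in>UNIV. csign (opp r) * \<phi> $ opp r * axis s 1 $ opp (opp r))"
    unfolding bil_apply by (rule sum_opp[symmetric])
  also have "\<dots> = (\<Sum>r\<in>UNIV. if r = s then csign s * \<phi> $ opp s else 0)"
    by (rule sum.cong) (auto simp: axis_def)
  finally show ?thesis by simp
qed

lemma axis_Delta_p: "axis s 1 \<in> \<Delta>\<^sub>p \<longleftrightarrow> chi s = 1"
proof -
  have "axis s 1 \<in> \<Delta>\<^sub>p \<longleftrightarrow> chi s \<noteq> -1" by (auto simp: Delta_p_iff axis_def)
  then show ?thesis using chi_cases[of s] by (auto simp: eq_minus_self_iff)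
qed

lemma pairing_sym: "pairing z w = pairing w z"
  by (cases z; cases w) (simp add: pairing_def bil_sym scalar_product_sym mult.commute)

lemma pairing_simps: "pairing (u, \<phi>, t) (v, 0, 0) = scalar_product u v" "pairing (u, \<phi>, t) (0, \<psi>, 0) = bil \<phi> \<psi>"
  "pairing (u, \<phi>, t) (0, 0, s) = t * s"
  by (simp_all add: pairing_def bil_linear scalar_product_linear)

text \<open>
  The bilinear form pairs spinors of opposite chirality, because it pairs an index with its
  complement, which has the opposite parity.
\<close>

lemma pairing_nondegenerate:
  assumes "z \<in> dual27" "z' \<in> dual27" "\<And>\<Psi>. \<Psi> \<in> rep27 \<Longrightarrow> pairing z \<Psi> = pairing z' \<Psi>" shows "z = z'"
proof -
  obtain u \<phi> t u' \<phi>' t' where z: "z = (u, \<phi>, t)" "z' = (u', \<phi>', t')" by (cases z; cases z')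
  have m: "(v, 0, 0) \<in> rep27" "(0, 0, s) \<in> rep27" for v s by (simp_all add: rep27_def Delta_closed)
  have "u = u'" using assms(3)[OF m(1)] by (simp add: vec_eq_iff z pairing_simps) (metis scalar_product_axis(2))
  moreover have "t = t'" using assms(3)[OF m(2), of 1] by (simp add: z pairing_simps)
  moreover have "\<phi> $ r = \<phi>' $ r" for r
  proof (cases "chi r = 1")
    case True then show ?thesis using assms(1,2) by (simp add: z dual27_def Delta_m_iff)
  next
    case False
    then have "chi (opp r) = 1" using chi_cases[of r] by simp
    then have "(0, axis (opp r) 1, 0) \<in> rep27" by (simp add: rep27_def axis_Delta_p)
    from assms(3)[OF this] show ?thesis by (simp add: z pairing_simps bil_axis)
  qed
  ultimately show ?thesis by (simp add: z vec_eq_iff)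
qed

text \<open>
  The ambient space contains both chiralities; the identities of exponentials are derived on all
  of it.
\<close>

lemma pairing_nondegenerate_right:
  assumes "\<And>\<Phi>. pairing \<Phi> a = pairing \<Phi> b" shows "a = b"
proof -
  obtain u \<phi> t u' \<phi>' t' where z: "a = (u, \<phi>, t)" "b = (u', \<phi>', t')" by (cases a; cases b)
  note as = assms[unfolded z pairing_sym[of _ "(u, _)"] pairing_sym[of _ "(u', _)"]]
  have "u $ i = u' $ i" for i using as[of "(axis i 1, 0, 0)"] by (simp only: pairing_simps scalar_product_axis)
  moreover have "\<phi> $ r = \<phi>' $ r" for r using as[of "(0, axis (opp r) 1, 0)"] by (simp add: pairing_simps bil_axis)
  moreover have "t = t'" using as[of "(0, 0, 1)"] by (simp only: pairing_simps) simp
  ultimately show ?thesis by (simp add: z vec_eq_iff)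
qed

lemma bounded_bilinear_pairing: "bounded_bilinear pairing"
  unfolding bilinear_conv_bounded_bilinear[symmetric] bilinear_def
  by (auto intro!: linearI simp: pairing_def scaleR_smult scaleR_complex bil_linear scalar_product_linear algebra_simps)

lemma bounded_bilinear_bil: "bounded_bilinear bil"
  unfolding bilinear_conv_bounded_bilinear[symmetric] bilinear_def
  by (auto intro!: linearI simp: scaleR_smult scaleR_complex bil_linear)

lemma bounded_bilinear_cliff: "bounded_bilinear cliff"
  unfolding bilinear_conv_bounded_bilinear[symmetric] bilinear_def
  by (auto intro!: linearI simp: scaleR_smult scaleR_complex cliff_linear)

lemma bounded_bilinear_scalar_product: "bounded_bilinear (scalar_product :: V \<Rightarrow> V \<Rightarrow> complex)"
  unfolding bilinear_conv_bounded_bilinear[symmetric] bilinear_def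
  by (auto intro!: linearI simp: scaleR_smult scaleR_complex scalar_product_linear)

lemma cubic_form_has_vector_derivative:
  assumes z: "(z has_vector_derivative z') (at \<tau>)"
  shows "((\<lambda>\<tau>. cubic_form (z \<tau>)) has_vector_derivative cubic (z \<tau>) (z \<tau>) z') (at \<tau>)"
proof -
  let ?u = "\<lambda>\<tau>. fst (z \<tau>)" and ?p = "\<lambda>\<tau>. fst (snd (z \<tau>))" and ?t = "\<lambda>\<tau>. snd (snd (z \<tau>))"
  have u: "(?u has_vector_derivative fst z') (at \<tau>)"
    by (rule bounded_linear.has_vector_derivative[OF bounded_linear_fst z])
  have s: "((\<lambda>\<tau>. snd (z \<tau>)) has_vector_derivative snd z') (at \<tau>)"
    by (rule bounded_linear.has_vector_derivative[OF bounded_linear_snd z])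
  have p: "(?p has_vector_derivative fst (snd z')) (at \<tau>)"
    by (rule bounded_linear.has_vector_derivative[OF bounded_linear_fst s])
  have t: "(?t has_vector_derivative snd (snd z')) (at \<tau>)"
    by (rule bounded_linear.has_vector_derivative[OF bounded_linear_snd s])
  note uu = bounded_bilinear.has_vector_derivative[OF bounded_bilinear_scalar_product u u]
  note uut = has_vector_derivative_mult[OF uu t]
  note pup = bounded_bilinear.has_vector_derivative[OF bounded_bilinear_bil p bounded_bilinear.has_vector_derivative[OF bounded_bilinear_cliff u p]]
  note all = has_vector_derivative_diff[OF uut has_vector_derivative_mult_right[OF pup, of rsqrt2]]
  have eq: "scalar_product u u * s + (scalar_product u v + scalar_product v u) * t
      - rsqrt2 * (bil p (cliff u q + cliff v p) + bil q (cliff u p)) = cubic (u, p, t) (u, p, t) (v, q, s)" for u p t v q s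
  proof -
    have "bil p (cliff u q) = bil q (cliff u p)" by (metis bil_cliff bil_sym)
    then show ?thesis
      by (simp add: cubic_diag bil_linear scalar_product_sym[of v u] algebra_simps)
  qed
  show ?thesis
    using all eq[of "?u \<tau>" "snd (snd z')" "fst z'" "?t \<tau>" "?p \<tau>" "fst (snd z')"]
    by (simp add: cubic_form_def case_prod_beta)
qed

text \<open>
  The second map is the contragredient of the first on the dual and preserves the cubic form. This
  property is stable under composition and holds for exponentials, hence for the whole group.
\<close>

definition contragredient :: "(E \<Rightarrow> E) \<Rightarrow> (E \<Rightarrow> E) \<Rightarrow> bool" where
  "contragredient g g' \<longleftrightarrow> g \<in> Bij rep27 \<and> (\<forall>\<Phi>\<in>dual27. g' \<Phi> \<in> dual27 \<and> cubic_form (g' \<Phi>) = cubic_form \<Phi> \<and>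
     (\<forall>\<Psi>\<in>rep27. pairing (g' \<Phi>) (g \<Psi>) = pairing \<Phi> \<Psi>))"

lemma e6_act_uminus: "e6_act (- A) (- \<xi>) (- \<eta>) (- c) z = - e6_act A \<xi> \<eta> c z"
proof -
  obtain v \<psi> s where z: "z = (v, \<psi>, s)" by (cases z)
  have "spin (- A) \<psi> = - spin A \<psi>" by (simp add: vec_eq_iff spin_nth sum_negf)
  moreover have "bilvec (- \<xi>) \<psi> = - bilvec \<xi> \<psi>" by (simp add: vec_eq_iff bilvec_nth bil_linear)
  moreover have "(- A) *v v = - (A *v v)" by (simp add: vec_eq_iff matrix_vector_mult_def sum_negf)
  ultimately show ?thesis by (simp add: z e6_act_def bil_linear cliff_linear vec_eq_iff)
qed

text \<open>Adjoint maps have adjoint exponentials, term by term.\<close>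

lemma pairing_op_exp:
  assumes X: "linear X" and Y: "linear Y" and XY: "\<And>\<Phi> \<Psi>. pairing \<Phi> (Y \<Psi>) = pairing (X \<Phi>) \<Psi>"
  shows "pairing \<Phi> (op_exp Y \<Psi>) = pairing (op_exp X \<Phi>) \<Psi>"
proof -
  have n: "pairing \<Phi> ((Y ^^ n) \<Psi>) = pairing ((X ^^ n) \<Phi>) \<Psi>" for n \<Phi>
  proof (induct n arbitrary: \<Phi>)
    case (Suc n)
    have "pairing \<Phi> ((Y ^^ Suc n) \<Psi>) = pairing ((X ^^ n) (X \<Phi>)) \<Psi>" by (simp add: XY Suc)
    then show ?case by (simp add: funpow_swap1)
  qed simp
  have l: "bounded_linear (pairing \<Phi>)" and r: "bounded_linear (\<lambda>z. pairing z \<Psi>)"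
    using bounded_bilinear_pairing by (simp_all add: bounded_bilinear.bounded_linear_left bounded_bilinear.bounded_linear_right)
  have sY: "summable (\<lambda>n. (1 / fact n) *\<^sub>R (Y ^^ n) \<Psi>)" using exp_curve_summable[OF Y, of 1] by simp
  have sX: "summable (\<lambda>n. (1 / fact n) *\<^sub>R (X ^^ n) \<Phi>)" using exp_curve_summable[OF X, of 1] by simp
  show ?thesis
    unfolding op_exp_def bounded_linear.suminf[OF l sY] bounded_linear.suminf[OF r sX]
    by (simp add: n bounded_bilinear.scaleR_left[OF bounded_bilinear_pairing] bounded_bilinear.scaleR_right[OF bounded_bilinear_pairing])
qed

text \<open>
  The derivative along the one-parameter groups vanishes, since the two actions are
  contragredient.
\<close>

lemma pairing_exp_invariant:
  assumes A: "transpose A = - A"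
  shows "pairing (op_exp (dual_lie A \<xi> \<eta> c) \<Phi>) (op_exp (e6_act A \<xi> \<eta> c) \<Psi>) = pairing \<Phi> \<Psi>"
proof -
  let ?f = "\<lambda>\<tau>. pairing (exp_curve (dual_lie A \<xi> \<eta> c) \<Phi> \<tau>) (exp_curve (e6_act A \<xi> \<eta> c) \<Psi> \<tau>)"
  have "(?f has_vector_derivative 0) (at \<tau>)" for \<tau>
    by (rule has_vector_derivative_eq_rhs[OF bounded_bilinear.has_vector_derivative[OF bounded_bilinear_pairing
      exp_curve_has_vector_derivative[OF linear_dual_lie] exp_curve_has_vector_derivative[OF linear_e6_act]]])
      (simp add: pairing_dual_lie[OF A])
  then have "?f 1 = ?f 0" by (rule exp_curve_invariant)
  then show ?thesis by (simp add: exp_curve_0 exp_curve_1)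
qed

text \<open>
  The exponential of the negative is adjoint to the exponential on the dual, and the latter is
  contragredient to the exponential of the element. So the product has the same pairings as the
  identity.
\<close>

lemma op_exp_inverse:
  assumes A: "transpose A = - A"
  shows "op_exp (e6_act (- A) (- \<xi>) (- \<eta>) (- c)) (op_exp (e6_act A \<xi> \<eta> c) \<Psi>) = \<Psi>"
proof (rule pairing_nondegenerate_right)
  fix \<Phi>
  have "pairing \<Phi> (e6_act (- A) (- \<xi>) (- \<eta>) (- c) \<Psi>) = pairing (dual_lie A \<xi> \<eta> c \<Phi>) \<Psi>" for \<Phi> \<Psi>
    using bounded_bilinear.minus_right[OF bounded_bilinear_pairing] by (simp add: e6_act_uminus pairing_dual_lie[OF A])
  from pairing_op_exp[OF linear_dual_lie linear_e6_act this]
  show "pairing \<Phi> (op_exp (e6_act (- A) (- \<xi>) (- \<eta>) (- c)) (op_exp (e6_act A \<xi> \<eta> c) \<Psi>)) = pairing \<Phi> \<Psi>"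
    by (simp add: pairing_exp_invariant[OF A])
qed

lemma transpose_uminus: "transpose (- A) = - transpose A" for A :: "complex ^ 'n ^ 'm"
  by (simp add: transpose_def vec_eq_iff)

lemma op_exp_mem:
  "\<xi> \<in> \<Delta>\<^sub>p \<Longrightarrow> \<eta> \<in> \<Delta>\<^sub>m \<Longrightarrow> z \<in> rep27 \<Longrightarrow> op_exp (e6_act A \<xi> \<eta> c) z \<in> rep27"
  "\<xi> \<in> \<Delta>\<^sub>p \<Longrightarrow> \<eta> \<in> \<Delta>\<^sub>m \<Longrightarrow> z \<in> dual27 \<Longrightarrow> op_exp (dual_lie A \<xi> \<eta> c) z \<in> dual27"
  unfolding exp_curve_1[symmetric]
  by (auto intro!: exp_curve_mem linear_dual_lie linear_e6_act subspace_dual27 subspace_rep27 dual_lie_mem e6_act_mem)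

lemma cubic_form_exp_invariant:
  assumes A: "transpose A = - A" and \<xi>: "\<xi> \<in> \<Delta>\<^sub>p" and \<eta>: "\<eta> \<in> \<Delta>\<^sub>m" and z: "z \<in> dual27"
  shows "cubic_form (op_exp (dual_lie A \<xi> \<eta> c) z) = cubic_form z"
proof -
  let ?z = "exp_curve (dual_lie A \<xi> \<eta> c) z"
  have "?z \<tau> \<in> dual27" for \<tau>
    by (intro exp_curve_mem linear_dual_lie subspace_dual27 dual_lie_mem \<xi> \<eta> z)
  then have "((\<lambda>\<tau>. cubic_form (?z \<tau>)) has_vector_derivative 0) (at \<tau>)" for \<tau>
    using cubic_form_has_vector_derivative[OF exp_curve_has_vector_derivative[OF linear_dual_lie]]
    by (metis cubic_infinitesimal[OF A])
  then have "cubic_form (?z 1) = cubic_form (?z 0)" by (rule exp_curve_invariant)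
  then show ?thesis by (simp add: exp_curve_0 exp_curve_1)
qed

lemma op_exp_Bij:
  assumes A: "transpose A = - A" and \<xi>: "\<xi> \<in> \<Delta>\<^sub>p" and \<eta>: "\<eta> \<in> \<Delta>\<^sub>m"
  shows "restrict (op_exp (e6_act A \<xi> \<eta> c)) rep27 \<in> Bij rep27"
proof -
  have "op_exp (e6_act A \<xi> \<eta> c) (op_exp (e6_act (- A) (- \<xi>) (- \<eta>) (- c)) \<Psi>) = \<Psi>" for \<Psi>
    using op_exp_inverse[of "- A" "- \<xi>" "- \<eta>" "- c" \<Psi>] A by (simp add: transpose_uminus)
  then have "bij_betw (op_exp (e6_act A \<xi> \<eta> c)) rep27 rep27"
    using op_exp_inverse[OF A, of \<xi> \<eta> c]
    by (intro bij_betw_byWitness[where f' = "op_exp (e6_act (- A) (- \<xi>) (- \<eta>) (- c))"])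
      (simp_all add: image_subset_iff op_exp_mem \<xi> \<eta> Delta_closed)
  then show ?thesis by (simp add: Bij_def bij_betw_restrict_eq)
qed

lemma contragredient_exp:
  assumes "transpose A = - A" "\<xi> \<in> \<Delta>\<^sub>p" "\<eta> \<in> \<Delta>\<^sub>m"
  shows "contragredient (restrict (op_exp (e6_act A \<xi> \<eta> c)) rep27) (op_exp (dual_lie A \<xi> \<eta> c))"
  unfolding contragredient_def
  by (auto intro!: op_exp_Bij op_exp_mem assms cubic_form_exp_invariant simp: pairing_exp_invariant assms)

lemma contragredient_mult:
  assumes "contragredient g g'" "contragredient h h'"
  shows "contragredient (g \<otimes>\<^bsub>BijGroup rep27\<^esub> h) (g' \<circ> h')"
proof -
  have B: "g \<in> Bij rep27" "h \<in> Bij rep27" using assms by (auto simp: contragredient_def)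
  have "h \<Psi> \<in> rep27" if "\<Psi> \<in> rep27" for \<Psi> using B(2) that by (auto simp: Bij_def bij_betw_def)
  then show ?thesis
    using assms B unfolding contragredient_def by (simp add: BijGroup_def compose_Bij compose_eq)
qed

section \<open>The group and the plucker_cone of the Pluecker relations\<close>

definition plucker_cone :: "E set" where
  "plucker_cone = {z \<in> dual27 - {0}. \<forall>\<Phi>\<in>dual27. cubic z z \<Phi> = 0}"

lemma plucker_locus_eq: "plucker_locus = proj_point ` plucker_cone"
  by (auto simp: plucker_locus_def plucker_cone_def)

text \<open>
  The differential of the cubic form in the directions of \<open>V\<close>, of the spinors and of the last
  coordinate gives ten, sixteen and one equations.
\<close>

lemma plucker_cone_iff:
  "(u, \<phi>, t) \<in> plucker_cone \<longleftrightarrow> \<phi> \<in> \<Delta>\<^sub>m \<and> (u, \<phi>, t) \<noteq> 0 \<and>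
     (2 * t) *s u = rsqrt2 *s bilvec \<phi> \<phi> \<and> cliff u \<phi> = 0 \<and> scalar_product u u = 0"
proof -
  have cub: "cubic (u, \<phi>, t) (u, \<phi>, t) (v, \<psi>, s) =
      scalar_product ((2 * t) *s u - rsqrt2 *s bilvec \<phi> \<phi>) v + s * scalar_product u u - 2 * rsqrt2 * bil \<psi> (cliff u \<phi>)" for v \<psi> s
    by (simp add: cubic_diag scalar_product_linear bilvec_scalar_product)
  have "(2 * t) *s u = rsqrt2 *s bilvec \<phi> \<phi> \<and> cliff u \<phi> = 0 \<and> scalar_product u u = 0"
    if \<phi>: "\<phi> \<in> \<Delta>\<^sub>m" and all: "\<And>\<Phi>. \<Phi> \<in> dual27 \<Longrightarrow> cubic (u, \<phi>, t) (u, \<phi>, t) \<Phi> = 0"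
  proof (intro conjI)
    have "scalar_product ((2 * t) *s u - rsqrt2 *s bilvec \<phi> \<phi>) v = 0" for v
      using all[of "(v, 0, 0)"] by (simp add: dual27_def Delta_closed cub bil_linear)
    from this[of "axis i 1" for i] show "(2 * t) *s u = rsqrt2 *s bilvec \<phi> \<phi>"
      by (simp add: scalar_product_axis vec_eq_iff)
    show "scalar_product u u = 0"
      using all[of "(0, 0, 1)"] by (simp add: dual27_def Delta_closed cub bil_linear scalar_product_linear)
    have "cliff u \<phi> $ r = 0" for r
    proof (cases "chi r = 1")
      case True
      then have "axis (opp r) 1 \<in> \<Delta>\<^sub>m" by (auto simp: Delta_m_iff axis_def eq_minus_self_iff)
      then have "bil (axis (opp r) 1) (cliff u \<phi>) = 0"
        using all[of "(0, axis (opp r) 1, 0)"] by (simp add: dual27_def cub bil_linear scalar_product_linear rsqrt2_def)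
      then show ?thesis by (simp add: bil_sym[of "axis (opp r) 1"] bil_axis)
    next
      case False
      then show ?thesis using cliff_chirality(2)[OF \<phi>, of u] chi_cases[of r] by (simp add: Delta_p_iff)
    qed
    then show "cliff u \<phi> = 0" by (simp add: vec_eq_iff)
  qed
  moreover have "cubic (u, \<phi>, t) (u, \<phi>, t) \<Phi> = 0"
    if "(2 * t) *s u = rsqrt2 *s bilvec \<phi> \<phi>" "cliff u \<phi> = 0" "scalar_product u u = 0" for \<Phi>
  proof -
    obtain v \<psi> s where \<Phi>: "\<Phi> = (v, \<psi>, s)" by (cases \<Phi>)
    show ?thesis unfolding \<Phi> cub using that by (simp add: scalar_product_linear bil_linear)
  qed
  ultimately show ?thesis by (auto simp: plucker_cone_def dual27_def)
qed

text \<open>A linear map that preserves the cubic form therefore preserves \<open>d\<close>.\<close>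

lemma cubic_form_polarisation:
  "cubic z z w = (cubic_form (z + w) - cubic_form (z + cscale (-1) w)) / 2 - cubic_form w"
proof -
  obtain u \<phi> t where z: "z = (u, \<phi>, t)" by (cases z)
  obtain v \<psi> s where w: "w = (v, \<psi>, s)" by (cases w)
  have c: "(-1) *s x = - x" for x :: "complex ^ 'n" by (simp add: vec_eq_iff)
  have "bil \<phi> (cliff u \<psi>) = bil \<psi> (cliff u \<phi>)" "bil \<psi> (cliff v \<phi>) = bil \<phi> (cliff v \<psi>)" by (metis bil_cliff bil_sym)+
  then show ?thesis
    by (simp add: z w cubic_diag cubic_form_def cscale_def c bil_linear cliff_linear scalar_product_linear
      scalar_product_sym[of v u] field_simps)
qed

lemma cscale_simps: "cscale c (u, \<phi>, t) = (c *s u, c *s \<phi>, c * t)" "cscale a (cscale b z) = cscale (a * b) z" "cscale 1 z = z" "cscale c 0 = 0"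
  by (auto simp: cscale_def case_prod_beta zero_prod_def)

lemma cscale_eq_0: "cscale c z = 0 \<longleftrightarrow> c = 0 \<or> z = 0"
  by (cases z) (auto simp: cscale_def zero_prod_def vec_eq_iff)

lemma cscale_dual27: "z \<in> dual27 \<Longrightarrow> cscale c z \<in> dual27"
  by (auto simp: cscale_def dual27_def Delta_closed)

lemma plucker_cone_cscale: "c \<noteq> 0 \<Longrightarrow> z \<in> plucker_cone \<Longrightarrow> cscale c z \<in> plucker_cone"
proof -
  assume "c \<noteq> 0" "z \<in> plucker_cone"
  moreover obtain u \<phi> t where z: "z = (u, \<phi>, t)" by (cases z)
  moreover have "(2 * (c * t)) *s (c *s u) = (c * c) *s ((2 * t) *s u)" by (simp add: vec_eq_iff)
  moreover have "rsqrt2 *s (c *s (c *s bilvec \<phi> \<phi>)) = (c * c) *s (rsqrt2 *s bilvec \<phi> \<phi>)" by (simp add: vec_eq_iff)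
  ultimately show ?thesis
    using cscale_eq_0[of c z] by (simp add: cscale_simps plucker_cone_iff Delta_closed bilvec_linear cliff_linear scalar_product_linear)
qed

lemma pairing_cscale: "pairing (cscale c z) w = c * pairing z w"
  by (cases z; cases w) (simp add: cscale_def pairing_def bil_linear scalar_product_linear algebra_simps)

lemma proj_point_eq_iff: "proj_point z = proj_point w \<longleftrightarrow> (\<exists>c. c \<noteq> 0 \<and> z = cscale c w)"
proof
  assume "proj_point z = proj_point w"
  moreover have "z \<in> proj_point z" unfolding proj_point_def using cscale_simps(3)[of z] by (metis (mono_tags, lifting) mem_Collect_eq zero_neq_one)
  ultimately show "\<exists>c. c \<noteq> 0 \<and> z = cscale c w" unfolding proj_point_def by blast
next
  assume "\<exists>c. c \<noteq> 0 \<and> z = cscale c w"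
  then obtain c where c: "c \<noteq> 0" "z = cscale c w" by blast
  have sub: "proj_point (cscale c w) \<subseteq> proj_point w" if "c \<noteq> 0" for c w
  proof
    fix x assume "x \<in> proj_point (cscale c w)"
    then obtain a where "a \<noteq> 0" "x = cscale (a * c) w" by (auto simp: proj_point_def cscale_simps)
    then show "x \<in> proj_point w" unfolding proj_point_def using that by (intro CollectI exI[of _ "a * c"]) simp
  qed
  have "w = cscale (1 / c) z" using c by (simp add: cscale_simps)
  then show "proj_point z = proj_point w" using sub[of c w] sub[of "1 / c" z] c by auto
qed

lemma group_GC: "group G\<^sub>C" and subgroup_GC: "subgroup (carrier G\<^sub>C) (BijGroup rep27)"
proof -
  interpret B: group "BijGroup rep27" by (rule group_BijGroup)
  have "(\<lambda>X. restrict (op_exp X) rep27) ` e6_lie \<subseteq> carrier (BijGroup rep27)"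
    by (auto simp: e6_lie_def BijGroup_def intro!: op_exp_Bij)
  then have "subgroup (generate (BijGroup rep27) ((\<lambda>X. restrict (op_exp X) rep27) ` e6_lie)) (BijGroup rep27)"
    by (rule B.generate_is_subgroup)
  then show "subgroup (carrier G\<^sub>C) (BijGroup rep27)" "group G\<^sub>C"
    by (simp_all add: G\<^sub>C_def B.subgroup_imp_group)
qed

lemma exp_in_GC: "transpose A = - A \<Longrightarrow> \<xi> \<in> \<Delta>\<^sub>p \<Longrightarrow> \<eta> \<in> \<Delta>\<^sub>m \<Longrightarrow> restrict (op_exp (e6_act A \<xi> \<eta> c)) rep27 \<in> carrier G\<^sub>C"
proof -
  assume "transpose A = - A" "\<xi> \<in> \<Delta>\<^sub>p" "\<eta> \<in> \<Delta>\<^sub>m"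
  then have "e6_act A \<xi> \<eta> c \<in> e6_lie" unfolding e6_lie_def by blast
  then show ?thesis unfolding G\<^sub>C_def by (simp add: generate.incl)
qed

text \<open>
  The inverse of a generator is the exponential of the negative, hence again a generator.
\<close>

lemma GC_contragredient:
  assumes "g \<in> carrier G\<^sub>C" shows "\<exists>g'. contragredient g g'"
proof -
  interpret B: group "BijGroup rep27" by (rule group_BijGroup)
  have "g \<in> generate (BijGroup rep27) ((\<lambda>X. restrict (op_exp X) rep27) ` e6_lie)" using assms by (simp add: G\<^sub>C_def)
  then show ?thesis
  proof induct
    case one
    have "contragredient \<one>\<^bsub>BijGroup rep27\<^esub> id"
      using B.one_closed by (simp add: contragredient_def BijGroup_def)
    then show ?case by blast
  next
    case (incl h)
    then obtain A \<xi> \<eta> c where "h = restrict (op_exp (e6_act A \<xi> \<eta> c)) rep27" "transpose A = - A" "\<xi> \<in> \<Delta>\<^sub>p" "\<eta> \<in> \<Delta>\<^sub>m"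
      unfolding e6_lie_def by blast
    then show ?case using contragredient_exp by blast
  next
    case (inv h)
    then obtain A \<xi> \<eta> c where h: "h = restrict (op_exp (e6_act A \<xi> \<eta> c)) rep27" and X: "transpose A = - A" "\<xi> \<in> \<Delta>\<^sub>p" "\<eta> \<in> \<Delta>\<^sub>m"
      unfolding e6_lie_def by blast
    let ?k = "restrict (op_exp (e6_act (- A) (- \<xi>) (- \<eta>) (- c))) rep27"
    have X': "transpose (- A) = - (- A)" "- \<xi> \<in> \<Delta>\<^sub>p" "- \<eta> \<in> \<Delta>\<^sub>m" using X by (simp_all add: transpose_uminus Delta_closed)
    have hk: "h \<in> Bij rep27" "?k \<in> Bij rep27" unfolding h by (intro op_exp_Bij X X')+
    have "?k \<otimes>\<^bsub>BijGroup rep27\<^esub> h = \<one>\<^bsub>BijGroup rep27\<^esub>"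
      using hk by (simp add: BijGroup_def h compose_def op_exp_inverse[OF X(1)] op_exp_mem X fun_eq_iff)
    then have "inv\<^bsub>BijGroup rep27\<^esub> h = ?k"
      using hk by (intro B.inv_equality) (simp_all add: BijGroup_def)
    then show ?case using contragredient_exp[OF X'] by metis
  next
    case (eng h1 h2)
    then show ?case using contragredient_mult by blast
  qed
qed

text \<open>
  The description in \<open>dual_act\<close> is unique because the group element maps 27 onto itself and the
  pairing is nondegenerate.
\<close>

lemma contragredient_dual_act:
  assumes g: "contragredient g g'" and \<Phi>: "\<Phi> \<in> dual27" shows "dual_act g \<Phi> = g' \<Phi>"
  unfolding dual_act_def
proof (rule the_equality)
  show "g' \<Phi> \<in> dual27 \<and> (\<forall>\<Psi>\<in>rep27. pairing (g' \<Phi>) (g \<Psi>) = pairing \<Phi> \<Psi>)"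
    using g \<Phi> by (simp add: contragredient_def)
  fix \<Phi>' assume \<Phi>': "\<Phi>' \<in> dual27 \<and> (\<forall>\<Psi>\<in>rep27. pairing \<Phi>' (g \<Psi>) = pairing \<Phi> \<Psi>)"
  show "\<Phi>' = g' \<Phi>"
  proof (rule pairing_nondegenerate)
    fix \<Psi> assume "\<Psi> \<in> rep27"
    moreover have "g ` rep27 = rep27" using g by (simp add: contragredient_def Bij_def bij_betw_def)
    ultimately obtain \<Psi>' where "\<Psi>' \<in> rep27" "\<Psi> = g \<Psi>'" by blast
    then show "pairing \<Phi>' \<Psi> = pairing (g' \<Phi>) \<Psi>" using \<Phi>' g \<Phi> by (simp add: contragredient_def)
  qed (use \<Phi>' g \<Phi> in \<open>auto simp: contragredient_def\<close>)
qed

lemma dual_act_exp: 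
  "transpose A = - A \<Longrightarrow> \<xi> \<in> \<Delta>\<^sub>p \<Longrightarrow> \<eta> \<in> \<Delta>\<^sub>m \<Longrightarrow> \<Phi> \<in> dual27 \<Longrightarrow>
    dual_act (restrict (op_exp (e6_act A \<xi> \<eta> c)) rep27) \<Phi> = op_exp (dual_lie A \<xi> \<eta> c) \<Phi>"
  by (intro contragredient_dual_act contragredient_exp)

lemma dual_act:
  assumes "g \<in> carrier G\<^sub>C" "\<Phi> \<in> dual27"
  shows dual_act_mem: "dual_act g \<Phi> \<in> dual27" and cubic_form_dual_act: "cubic_form (dual_act g \<Phi>) = cubic_form \<Phi>"
    and pairing_dual_act: "\<Psi> \<in> rep27 \<Longrightarrow> pairing (dual_act g \<Phi>) (g \<Psi>) = pairing \<Phi> \<Psi>"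
proof -
  obtain g' where g': "contragredient g g'" using GC_contragredient[OF assms(1)] by blast
  show "dual_act g \<Phi> \<in> dual27" "cubic_form (dual_act g \<Phi>) = cubic_form \<Phi>" 
    "\<Psi> \<in> rep27 \<Longrightarrow> pairing (dual_act g \<Phi>) (g \<Psi>) = pairing \<Phi> \<Psi>"
    using g' assms(2) unfolding contragredient_dual_act[OF g' assms(2)] contragredient_def by auto
qed

lemma GC_image: "g \<in> carrier G\<^sub>C \<Longrightarrow> g ` rep27 = rep27"
proof -
  assume "g \<in> carrier G\<^sub>C"
  then have "g \<in> carrier (BijGroup rep27)" using subgroup.subset[OF subgroup_GC] by blast
  then show ?thesis by (simp add: BijGroup_def Bij_def bij_betw_def)
qed

lemma dual_act_unique:
  assumes "g \<in> carrier G\<^sub>C" "\<Phi> \<in> dual27" "\<Phi>' \<in> dual27" "\<And>\<Psi>. \<Psi> \<in> rep27 \<Longrightarrow> pairing \<Phi>' (g \<Psi>) = pairing \<Phi> \<Psi>"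
  shows "dual_act g \<Phi> = \<Phi>'"
proof (rule pairing_nondegenerate)
  fix \<Psi> assume "\<Psi> \<in> rep27"
  then obtain \<Psi>' where "\<Psi>' \<in> rep27" "\<Psi> = g \<Psi>'" using GC_image[OF assms(1)] by blast
  then show "pairing (dual_act g \<Phi>) \<Psi> = pairing \<Phi>' \<Psi>" using pairing_dual_act[OF assms(1,2)] assms(4) by simp
qed (use dual_act_mem assms in auto)

lemma pairing_add: "pairing (z + w) \<Psi> = pairing z \<Psi> + pairing w \<Psi>"
  by (rule bounded_bilinear.add_left[OF bounded_bilinear_pairing])

lemma dual27_add: "z \<in> dual27 \<Longrightarrow> w \<in> dual27 \<Longrightarrow> z + w \<in> dual27"
  by (rule subspace_add[OF subspace_dual27])

lemma dual_act_add: "g \<in> carrier G\<^sub>C \<Longrightarrow> z \<in> dual27 \<Longrightarrow> w \<in> dual27 \<Longrightarrow> dual_act g (z + w) = dual_act g z + dual_act g w"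
  by (intro dual_act_unique dual27_add dual_act_mem) (simp_all add: pairing_add pairing_dual_act)

lemma dual_act_cscale: "g \<in> carrier G\<^sub>C \<Longrightarrow> z \<in> dual27 \<Longrightarrow> dual_act g (cscale c z) = cscale c (dual_act g z)"
  by (intro dual_act_unique cscale_dual27 dual_act_mem) (simp_all add: pairing_cscale pairing_dual_act)

lemma GC_mult_apply: "g \<in> carrier G\<^sub>C \<Longrightarrow> h \<in> carrier G\<^sub>C \<Longrightarrow> \<Psi> \<in> rep27 \<Longrightarrow> (g \<otimes>\<^bsub>G\<^sub>C\<^esub> h) \<Psi> = g (h \<Psi>)"
proof -
  assume gh: "g \<in> carrier G\<^sub>C" "h \<in> carrier G\<^sub>C" and "\<Psi> \<in> rep27"
  moreover have "g \<in> carrier (BijGroup rep27)" "h \<in> carrier (BijGroup rep27)"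
    using gh subgroup.subset[OF subgroup_GC] by blast+
  ultimately show ?thesis by (simp add: G\<^sub>C_def BijGroup_def compose_eq)
qed

lemma dual_act_mult:
  assumes "g \<in> carrier G\<^sub>C" "h \<in> carrier G\<^sub>C" "\<Phi> \<in> dual27"
  shows "dual_act (g \<otimes>\<^bsub>G\<^sub>C\<^esub> h) \<Phi> = dual_act g (dual_act h \<Phi>)"
proof (rule dual_act_unique)
  show "g \<otimes>\<^bsub>G\<^sub>C\<^esub> h \<in> carrier G\<^sub>C" by (rule monoid.m_closed[OF group.is_monoid[OF group_GC] assms(1,2)])
  fix \<Psi> assume \<Psi>: "\<Psi> \<in> rep27"
  then have "h \<Psi> \<in> rep27" using GC_image[OF assms(2)] by blast
  then show "pairing (dual_act g (dual_act h \<Phi>)) ((g \<otimes>\<^bsub>G\<^sub>C\<^esub> h) \<Psi>) = pairing \<Phi> \<Psi>"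
    using assms \<Psi> by (simp add: GC_mult_apply pairing_dual_act dual_act_mem)
qed (use assms dual_act_mem in auto)

lemma dual_act_one: "\<Phi> \<in> dual27 \<Longrightarrow> dual_act \<one>\<^bsub>G\<^sub>C\<^esub> \<Phi> = \<Phi>"
proof (rule dual_act_unique)
  show "\<one>\<^bsub>G\<^sub>C\<^esub> \<in> carrier G\<^sub>C" by (rule monoid.one_closed[OF group.is_monoid[OF group_GC]])
  show "pairing \<Phi> (\<one>\<^bsub>G\<^sub>C\<^esub> \<Psi>) = pairing \<Phi> \<Psi>" if "\<Psi> \<in> rep27" for \<Psi>
    using that by (simp add: G\<^sub>C_def BijGroup_def)
qed

lemma dual_act_inv:
  assumes g: "g \<in> carrier G\<^sub>C" and \<Phi>: "\<Phi> \<in> dual27"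
  shows "dual_act (inv\<^bsub>G\<^sub>C\<^esub> g) (dual_act g \<Phi>) = \<Phi>" "dual_act g (dual_act (inv\<^bsub>G\<^sub>C\<^esub> g) \<Phi>) = \<Phi>"
proof -
  have gi: "inv\<^bsub>G\<^sub>C\<^esub> g \<in> carrier G\<^sub>C" by (rule group.inv_closed[OF group_GC g])
  show "dual_act (inv\<^bsub>G\<^sub>C\<^esub> g) (dual_act g \<Phi>) = \<Phi>"
    by (simp only: dual_act_mult[OF gi g \<Phi>, symmetric] group.l_inv[OF group_GC g] dual_act_one[OF \<Phi>])
  show "dual_act g (dual_act (inv\<^bsub>G\<^sub>C\<^esub> g) \<Phi>) = \<Phi>"
    by (simp only: dual_act_mult[OF g gi \<Phi>, symmetric] group.r_inv[OF group_GC g] dual_act_one[OF \<Phi>])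
qed

lemma dual_act_0:
  assumes "g \<in> carrier G\<^sub>C" shows "dual_act g 0 = 0"
proof -
  have "cscale 0 z = 0" for z by (simp only: cscale_eq_0) simp
  then show ?thesis using dual_act_cscale[OF assms subspace_0[OF subspace_dual27], of 0] by simp
qed

text \<open>
  By the invariance of the polarised form, \<open>d(g z, g z, \<Phi>) = d(z, z, g\<^sup>-\<^sup>1 \<Phi>)\<close>.
\<close>

lemma dual_act_cone:
  assumes g: "g \<in> carrier G\<^sub>C" and z: "z \<in> plucker_cone" shows "dual_act g z \<in> plucker_cone"
proof -
  have zd: "z \<in> dual27" "z \<noteq> 0" using z by (auto simp: plucker_cone_def)
  have gi: "inv\<^bsub>G\<^sub>C\<^esub> g \<in> carrier G\<^sub>C" by (rule group.inv_closed[OF group_GC g])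
  have "dual_act g z \<noteq> 0" using dual_act_inv(1)[OF g zd(1)] dual_act_0[OF gi] zd(2) by metis
  moreover have "cubic (dual_act g z) (dual_act g z) \<Phi> = 0" if \<Phi>: "\<Phi> \<in> dual27" for \<Phi>
  proof -
    define w where "w = dual_act (inv\<^bsub>G\<^sub>C\<^esub> g) \<Phi>"
    have w: "w \<in> dual27" "\<Phi> = dual_act g w" unfolding w_def using dual_act_mem[OF gi \<Phi>] dual_act_inv(2)[OF g \<Phi>] by auto
    have "cubic (dual_act g z) (dual_act g z) (dual_act g w) = cubic z z w"
      unfolding cubic_form_polarisation
      by (simp add: dual_act_add[OF g, symmetric] dual_act_cscale[OF g, symmetric] cubic_form_dual_act[OF g] zd w cscale_dual27 dual27_add)
    then show ?thesis using z w by (simp add: plucker_cone_def)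
  qed
  ultimately show ?thesis using dual_act_mem[OF g zd(1)] by (simp add: plucker_cone_def)
qed

section \<open>The orbit of the highest weight vector\<close>

lemma \<Phi>\<^sub>0_cone: "\<Phi>\<^sub>0 \<in> plucker_cone"
  by (simp add: \<Phi>\<^sub>0_def plucker_cone_iff Delta_closed zero_prod_def bilvec_linear cliff_linear scalar_product_linear)

lemma \<Phi>\<^sub>0_dual27: "\<Phi>\<^sub>0 \<in> dual27"
  using \<Phi>\<^sub>0_cone by (simp add: plucker_cone_def)

lemma transpose_zero: "transpose (0 :: complex ^ 'n ^ 'n) = - 0"
  by (simp add: transpose_def vec_eq_iff)

lemma spin_zero: "spin 0 \<phi> = 0" "spin A 0 = 0"
  by (simp_all add: vec_eq_iff spin_nth cliff_linear)

lemma funpow_3: "(f ^^ 3) x = f (f (f x))"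
  by (simp add: eval_nat_numeral)

text \<open>
  The big cell in exponential coordinates. The third power of the generator kills \<open>\<Phi>\<^sub>0\<close>.
\<close>

lemma dual_exp_minus:
  "op_exp (dual_lie 0 0 \<eta> 0) \<Phi>\<^sub>0 = ((rsqrt2 / 2) *s bilvec \<eta> \<eta>, \<eta>, 1)"
proof -
  let ?X = "dual_lie 0 0 \<eta> 0"
  have X: "?X (u, \<phi>, t) = (rsqrt2 *s bilvec \<phi> \<eta>, t *s \<eta>, 0)" for u \<phi> t
    by (simp add: dual_lie_def spin_zero cliff_linear bil_linear vec_eq_iff)
  have "op_exp ?X \<Phi>\<^sub>0 = \<Phi>\<^sub>0 + ?X \<Phi>\<^sub>0 + (1 / 2) *\<^sub>R ?X (?X \<Phi>\<^sub>0)"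
    by (rule op_exp_nilpotent) (simp_all add: funpow_3 X \<Phi>\<^sub>0_def zero_prod_def bilvec_linear)
  then show ?thesis by (simp add: X \<Phi>\<^sub>0_def bilvec_linear scaleR_smult vec_eq_iff)
qed

text \<open>
  These unipotent elements change the last coordinate by a polynomial of degree two in \<open>\<xi>\<close>.
\<close>

lemma dual_exp_plus:
  "op_exp (dual_lie 0 \<xi> 0 0) (u, \<phi>, t) =
     (u, \<phi> - rsqrt2 *s cliff u \<xi>, t - bil \<phi> \<xi> + rsqrt2 / 2 * bil (cliff u \<xi>) \<xi>)"
proof -
  let ?X = "dual_lie 0 \<xi> 0 0"
  have X: "?X (u, \<phi>, t) = (0, - (rsqrt2 *s cliff u \<xi>), - bil \<phi> \<xi>)" for u \<phi> t
    by (simp add: dual_lie_def spin_zero bilvec_linear vec_eq_iff)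
  have "op_exp ?X (u, \<phi>, t) = (u, \<phi>, t) + ?X (u, \<phi>, t) + (1 / 2) *\<^sub>R ?X (?X (u, \<phi>, t))"
    by (rule op_exp_nilpotent) (simp_all add: funpow_3 X zero_prod_def bil_linear cliff_linear)
  then show ?thesis by (simp add: X cliff_linear bil_linear scaleR_complex)
qed

lemma flip_other: obtains l :: 5 where "l \<noteq> k"
proof -
  have "(0::5) \<noteq> 1" by simp
  then show ?thesis using that by metis
qed

lemma even_index_with_bit: obtains s where "chi s = 1" "s k = b"
proof -
  obtain l :: 5 where l: "l \<noteq> k" by (rule flip_other)
  let ?s = "\<lambda>_ :: 5. b"
  have "chi ?s = 1 \<or> chi (flip l ?s) = 1" using chi_cases[of ?s] by auto
  moreover have "flip l ?s k = b" using l by simp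
  ultimately show ?thesis using that by metis
qed

text \<open>
  The constant, linear and quadratic parts in \<open>\<xi>\<close> would vanish separately. They determine \<open>t\<close>, \<open>\<phi>\<close>
  and \<open>u\<close>.
\<close>

lemma exists_spinor_moving_to_big_cell:
  assumes \<phi>: "\<phi> \<in> \<Delta>\<^sub>m" and nz: "(u, \<phi>, t) \<noteq> 0"
  shows "\<exists>\<xi>\<in>\<Delta>\<^sub>p. t - bil \<phi> \<xi> + rsqrt2 / 2 * bil (cliff u \<xi>) \<xi> \<noteq> 0"
proof (rule ccontr)
  assume "\<not> ?thesis"
  then have all: "t - bil \<phi> \<xi> + rsqrt2 / 2 * bil (cliff u \<xi>) \<xi> = 0" if "\<xi> \<in> \<Delta>\<^sub>p" for \<xi> using that by blast
  have t: "t = 0" using all[OF Delta_closed(1)] by (simp add: bil_linear)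
  have even_odd: "bil \<phi> \<xi> = 0 \<and> bil (cliff u \<xi>) \<xi> = 0" if "\<xi> \<in> \<Delta>\<^sub>p" for \<xi>
  proof -
    \<comment> \<open>compare the values at \<open>\<xi>\<close> and \<open>- \<xi>\<close>\<close>
    have rt: "rsqrt2 \<noteq> 0" by (simp add: rsqrt2_def)
    have 1: "rsqrt2 / 2 * bil (cliff u \<xi>) \<xi> = bil \<phi> \<xi>" using all[OF that] t by simp
    have 2: "rsqrt2 / 2 * bil (cliff u \<xi>) \<xi> = - bil \<phi> \<xi>" using all[of "- \<xi>"] that t
      by (simp add: Delta_closed cliff_linear bil_linear add_eq_0_iff)
    have 3: "bil \<phi> \<xi> = 0" using 1 2 by (simp add: eq_minus_self_iff)
    then show ?thesis using 1 rt by simp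
  qed
  have "\<phi> $ r = 0" for r
  proof (cases "chi r = 1")
    case True then show ?thesis using \<phi> by (simp add: Delta_m_iff)
  next
    case False
    then have "axis (opp r) 1 \<in> \<Delta>\<^sub>p" using chi_cases[of r] by (simp add: axis_Delta_p)
    then show ?thesis using even_odd by (fastforce simp: bil_axis)
  qed
  then have \<phi>0: "\<phi> = 0" by (simp add: vec_eq_iff)
  \<comment> \<open>polarise the quadratic part\<close>
  have pol: "bil (cliff u \<xi>) \<zeta> = 0" if "\<xi> \<in> \<Delta>\<^sub>p" "\<zeta> \<in> \<Delta>\<^sub>p" for \<xi> \<zeta>
  proof -
    have "bil (cliff u (\<xi> + \<zeta>)) (\<xi> + \<zeta>) = 0" using even_odd that by (simp add: Delta_closed)
    moreover have "bil (cliff u \<zeta>) \<xi> = bil (cliff u \<xi>) \<zeta>" by (metis bil_cliff bil_sym)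
    ultimately show ?thesis using even_odd[OF that(1)] even_odd[OF that(2)] by (simp add: cliff_linear bil_linear)
  qed
  have "wt k b u = 0" for k b
  proof -
    \<comment> \<open>\<open>wt k b u\<close> is, up to sign, the matrix element of \<open>u\<close> between \<open>s\<close> and the index with bit \<open>k\<close> flipped\<close>
    obtain s where s: "chi s = 1" "s k = (\<not> b)" by (rule even_index_with_bit)
    have "cliff u (axis s 1) $ flip k s = (\<Sum>l\<in>UNIV. if l = k then jw k (flip k s) * wt k b u else 0)"
      unfolding cliff_apply
    proof (rule sum.cong[OF refl])
      fix l show "jw l (flip k s) * wt l (flip k s l) u * axis s 1 $ flip l (flip k s) =
         (if l = k then jw k (flip k s) * wt k b u else 0)"
      proof (cases "l = k")
        case False
        then have "flip l (flip k s) k \<noteq> s k" by simp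
        then have "flip l (flip k s) \<noteq> s" by metis
        then show ?thesis using False by (simp add: axis_def)
      qed (simp add: s axis_def)
    qed
    then have 1: "cliff u (axis s 1) $ flip k s = jw k (flip k s) * wt k b u" by simp
    have "axis s 1 \<in> \<Delta>\<^sub>p" "axis (opp (flip k s)) 1 \<in> \<Delta>\<^sub>p" using s by (simp_all add: axis_Delta_p)
    from pol[OF this] have "cliff u (axis s 1) $ flip k s = 0" by (simp add: bil_axis)
    then show ?thesis using 1 by simp
  qed
  then have "u = 0" by (intro wt_eqI) (simp add: wt_linear)
  then show False using nz t \<phi>0 by (simp add: zero_prod_def)
qed

text \<open>
  The ten equations with \<open>t \<noteq> 0\<close> give \<open>u\<close> in terms of \<open>\<phi>\<close> and \<open>t\<close>, as in \<open>dual_exp_minus\<close>.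
\<close>

lemma big_cell_orbit:
  assumes z: "(u, \<phi>, t) \<in> plucker_cone" and t: "t \<noteq> 0"
  shows "(u, \<phi>, t) = cscale t (op_exp (dual_lie 0 0 ((1 / t) *s \<phi>) 0) \<Phi>\<^sub>0)"
proof -
  have "(2 * t) *s u = rsqrt2 *s bilvec \<phi> \<phi>" using z by (simp add: plucker_cone_iff)
  then have "((2 * t) *s u) $ i = (rsqrt2 *s bilvec \<phi> \<phi>) $ i" for i by simp
  then have "u $ i = (rsqrt2 / (2 * t)) * bilvec \<phi> \<phi> $ i" for i using t by (simp add: field_simps)
  then have "u = (rsqrt2 / (2 * t)) *s bilvec \<phi> \<phi>" by (simp add: vec_eq_iff)
  then show ?thesis using t by (simp add: dual_exp_minus cscale_simps bilvec_linear vec_eq_iff)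
qed

text \<open>Transitivity: move to the big cell by some \<open>\<xi>\<close>, then use the exponential of \<open>\<eta>\<close>.\<close>

lemma cone_orbit:
  assumes z: "z \<in> plucker_cone" shows "\<exists>g\<in>carrier G\<^sub>C. \<exists>c. c \<noteq> 0 \<and> z = cscale c (dual_act g \<Phi>\<^sub>0)"
proof -
  obtain u \<phi> t where z': "z = (u, \<phi>, t)" by (cases z)
  have zd: "z \<in> dual27" using z by (simp add: plucker_cone_def)
  have "\<phi> \<in> \<Delta>\<^sub>m" "(u, \<phi>, t) \<noteq> 0" using z by (auto simp: z' plucker_cone_iff)
  then obtain \<xi> where \<xi>: "\<xi> \<in> \<Delta>\<^sub>p" and nz: "t - bil \<phi> \<xi> + rsqrt2 / 2 * bil (cliff u \<xi>) \<xi> \<noteq> 0"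
    using exists_spinor_moving_to_big_cell by blast
  define g where "g = restrict (op_exp (e6_act 0 \<xi> 0 0)) rep27"
  have g: "g \<in> carrier G\<^sub>C" unfolding g_def by (intro exp_in_GC transpose_zero \<xi> Delta_closed)
  have gz: "dual_act g z = (u, \<phi> - rsqrt2 *s cliff u \<xi>, t - bil \<phi> \<xi> + rsqrt2 / 2 * bil (cliff u \<xi>) \<xi>)"
    unfolding g_def dual_act_exp[OF transpose_zero \<xi> Delta_closed(2) zd] by (simp only: z' dual_exp_plus)
  define c where "c = t - bil \<phi> \<xi> + rsqrt2 / 2 * bil (cliff u \<xi>) \<xi>"
  define \<eta> where "\<eta> = (1 / c) *s (\<phi> - rsqrt2 *s cliff u \<xi>)"
  have gzc: "(u, \<phi> - rsqrt2 *s cliff u \<xi>, c) \<in> plucker_cone" using dual_act_cone[OF g z] by (simp add: gz c_def)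
  then have "\<phi> - rsqrt2 *s cliff u \<xi> \<in> \<Delta>\<^sub>m" by (simp add: plucker_cone_iff)
  then have \<eta>: "\<eta> \<in> \<Delta>\<^sub>m" unfolding \<eta>_def by (rule Delta_closed)
  define h where "h = restrict (op_exp (e6_act 0 0 \<eta> 0)) rep27"
  have h: "h \<in> carrier G\<^sub>C" unfolding h_def by (intro exp_in_GC transpose_zero \<eta> Delta_closed)
  have hz: "dual_act h \<Phi>\<^sub>0 = op_exp (dual_lie 0 0 \<eta> 0) \<Phi>\<^sub>0"
    unfolding h_def by (rule dual_act_exp[OF transpose_zero Delta_closed(1) \<eta> \<Phi>\<^sub>0_dual27])
  have c: "c \<noteq> 0" using nz by (simp add: c_def)
  have eq: "dual_act g z = cscale c (dual_act h \<Phi>\<^sub>0)"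
    unfolding gz hz c_def[symmetric] \<eta>_def by (rule big_cell_orbit[OF gzc c])
  have gi: "inv\<^bsub>G\<^sub>C\<^esub> g \<in> carrier G\<^sub>C" by (rule group.inv_closed[OF group_GC g])
  have "z = dual_act (inv\<^bsub>G\<^sub>C\<^esub> g) (cscale c (dual_act h \<Phi>\<^sub>0))" by (simp only: dual_act_inv(1)[OF g zd] eq[symmetric])
  also have "\<dots> = cscale c (dual_act (inv\<^bsub>G\<^sub>C\<^esub> g \<otimes>\<^bsub>G\<^sub>C\<^esub> h) \<Phi>\<^sub>0)"
    by (simp only: dual_act_cscale[OF gi dual_act_mem[OF h \<Phi>\<^sub>0_dual27]] dual_act_mult[OF gi h \<Phi>\<^sub>0_dual27])
  finally show ?thesis using c monoid.m_closed[OF group.is_monoid[OF group_GC] gi h] by blast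
qed

lemma P0_iff: "g \<in> P\<^sub>0 \<longleftrightarrow> g \<in> carrier G\<^sub>C \<and> (\<exists>c. c \<noteq> 0 \<and> dual_act g \<Phi>\<^sub>0 = cscale c \<Phi>\<^sub>0)"
  by (auto simp: P\<^sub>0_def proj_point_eq_iff)

lemma one_P0: "\<one>\<^bsub>G\<^sub>C\<^esub> \<in> P\<^sub>0"
  by (simp add: P\<^sub>0_def dual_act_one[OF \<Phi>\<^sub>0_dual27] monoid.one_closed[OF group.is_monoid[OF group_GC]])

lemma proj_point_dual_act_P0:
  assumes g: "g \<in> carrier G\<^sub>C" and h: "h \<in> P\<^sub>0"
  shows "proj_point (dual_act (g \<otimes>\<^bsub>G\<^sub>C\<^esub> h) \<Phi>\<^sub>0) = proj_point (dual_act g \<Phi>\<^sub>0)"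
proof -
  obtain c where c: "c \<noteq> 0" "dual_act h \<Phi>\<^sub>0 = cscale c \<Phi>\<^sub>0" and hG: "h \<in> carrier G\<^sub>C" using h by (auto simp: P0_iff)
  have "dual_act (g \<otimes>\<^bsub>G\<^sub>C\<^esub> h) \<Phi>\<^sub>0 = cscale c (dual_act g \<Phi>\<^sub>0)"
    by (simp only: dual_act_mult[OF g hG \<Phi>\<^sub>0_dual27] c(2) dual_act_cscale[OF g \<Phi>\<^sub>0_dual27])
  then show ?thesis using c(1) by (auto simp: proj_point_eq_iff)
qed

lemma plucker_coset:
  assumes g: "g \<in> carrier G\<^sub>C" shows "plucker (g <#\<^bsub>G\<^sub>C\<^esub> P\<^sub>0) = proj_point (dual_act g \<Phi>\<^sub>0)"
proof -
  have "(\<lambda>h. proj_point (dual_act h \<Phi>\<^sub>0)) ` (g <#\<^bsub>G\<^sub>C\<^esub> P\<^sub>0) = {proj_point (dual_act g \<Phi>\<^sub>0)}"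
    using one_P0 proj_point_dual_act_P0[OF g] by (auto simp: l_coset_def image_UN)
  then show ?thesis by (simp add: plucker_def)
qed

text \<open>
  Two group elements that send \<open>\<Phi>\<^sub>0\<close> to the same line differ by an element of the stabiliser.
\<close>

lemma same_line_coset_subset:
  assumes g: "g \<in> carrier G\<^sub>C" and h: "h \<in> carrier G\<^sub>C" and eq: "proj_point (dual_act g \<Phi>\<^sub>0) = proj_point (dual_act h \<Phi>\<^sub>0)"
  shows "g <#\<^bsub>G\<^sub>C\<^esub> P\<^sub>0 \<subseteq> h <#\<^bsub>G\<^sub>C\<^esub> P\<^sub>0"
proof
  interpret G: group "G\<^sub>C" by (rule group_GC)
  fix x assume "x \<in> g <#\<^bsub>G\<^sub>C\<^esub> P\<^sub>0"
  then obtain p where p: "p \<in> P\<^sub>0" "x = g \<otimes>\<^bsub>G\<^sub>C\<^esub> p" by (auto simp: l_coset_def)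
  have pG: "p \<in> carrier G\<^sub>C" using p(1) by (simp add: P0_iff)
  have x: "x \<in> carrier G\<^sub>C" using p g pG by simp
  have "proj_point (dual_act x \<Phi>\<^sub>0) = proj_point (dual_act h \<Phi>\<^sub>0)"
    unfolding p(2) proj_point_dual_act_P0[OF g p(1)] by (rule eq)
  then obtain c where c: "c \<noteq> 0" "dual_act x \<Phi>\<^sub>0 = cscale c (dual_act h \<Phi>\<^sub>0)" by (auto simp: proj_point_eq_iff)
  have hi: "inv\<^bsub>G\<^sub>C\<^esub> h \<in> carrier G\<^sub>C" using h by simp
  have "dual_act (inv\<^bsub>G\<^sub>C\<^esub> h \<otimes>\<^bsub>G\<^sub>C\<^esub> x) \<Phi>\<^sub>0 = cscale c \<Phi>\<^sub>0"
    by (simp only: dual_act_mult[OF hi x \<Phi>\<^sub>0_dual27] c(2) dual_act_cscale[OF hi dual_act_mem[OF h \<Phi>\<^sub>0_dual27]] dual_act_inv(1)[OF h \<Phi>\<^sub>0_dual27])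
  then have "inv\<^bsub>G\<^sub>C\<^esub> h \<otimes>\<^bsub>G\<^sub>C\<^esub> x \<in> P\<^sub>0" using c(1) hi x by (auto simp: P0_iff)
  moreover have "x = h \<otimes>\<^bsub>G\<^sub>C\<^esub> (inv\<^bsub>G\<^sub>C\<^esub> h \<otimes>\<^bsub>G\<^sub>C\<^esub> x)" using h x hi by (simp add: G.m_assoc[symmetric])
  ultimately show "x \<in> h <#\<^bsub>G\<^sub>C\<^esub> P\<^sub>0" unfolding l_coset_def by blast
qed

lemma inj_on_plucker: "inj_on plucker G_mod_P"
proof (rule inj_onI)
  fix x y assume "x \<in> G_mod_P" "y \<in> G_mod_P" and eq: "plucker x = plucker y"
  then obtain g h where g: "g \<in> carrier G\<^sub>C" "x = g <#\<^bsub>G\<^sub>C\<^esub> P\<^sub>0" and h: "h \<in> carrier G\<^sub>C" "y = h <#\<^bsub>G\<^sub>C\<^esub> P\<^sub>0"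
    by (auto simp: G_mod_P_def LCOSETS_def)
  have "proj_point (dual_act g \<Phi>\<^sub>0) = proj_point (dual_act h \<Phi>\<^sub>0)"
    using eq by (simp only: g(2) h(2) plucker_coset[OF g(1)] plucker_coset[OF h(1)])
  then show "x = y" unfolding g h using same_line_coset_subset g(1) h(1) by (metis subset_antisym)
qed

lemma plucker_image: "plucker ` G_mod_P = plucker_locus"
proof -
  have "plucker ` G_mod_P = (\<lambda>g. proj_point (dual_act g \<Phi>\<^sub>0)) ` carrier G\<^sub>C"
  proof -
    have *: "G_mod_P = (\<lambda>g. g <#\<^bsub>G\<^sub>C\<^esub> P\<^sub>0) ` carrier G\<^sub>C" by (auto simp: G_mod_P_def LCOSETS_def)
    have "plucker ` G_mod_P = (\<lambda>g. plucker (g <#\<^bsub>G\<^sub>C\<^esub> P\<^sub>0)) ` carrier G\<^sub>C" unfolding * image_image ..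
    also have "\<dots> = (\<lambda>g. proj_point (dual_act g \<Phi>\<^sub>0)) ` carrier G\<^sub>C" by (intro image_cong refl plucker_coset)
    finally show ?thesis .
  qed
  also have "\<dots> = proj_point ` plucker_cone"
  proof
    show "(\<lambda>g. proj_point (dual_act g \<Phi>\<^sub>0)) ` carrier G\<^sub>C \<subseteq> proj_point ` plucker_cone"
      using dual_act_cone \<Phi>\<^sub>0_cone by blast
    show "proj_point ` plucker_cone \<subseteq> (\<lambda>g. proj_point (dual_act g \<Phi>\<^sub>0)) ` carrier G\<^sub>C"
    proof
      fix p assume "p \<in> proj_point ` plucker_cone"
      then obtain z where "z \<in> plucker_cone" "p = proj_point z" by blast
      moreover obtain g c where "g \<in> carrier G\<^sub>C" "c \<noteq> 0" "z = cscale c (dual_act g \<Phi>\<^sub>0)" using cone_orbit[OF \<open>z \<in> plucker_cone\<close>] by blast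
      moreover have "proj_point z = proj_point (dual_act g \<Phi>\<^sub>0)" using calculation proj_point_eq_iff by blast
      ultimately show "p \<in> (\<lambda>g. proj_point (dual_act g \<Phi>\<^sub>0)) ` carrier G\<^sub>C" by blast
    qed
  qed
  finally show ?thesis by (simp only: plucker_locus_eq)
qed

section \<open>Holomorphic coordinates on parts of charts\<close>

abbreviation hol :: "(complex ^ 'n \<Rightarrow> complex) \<Rightarrow> (complex ^ 'n) set \<Rightarrow> bool" where
  "hol \<equiv> holomorphic_several"

lemma holI:
  "(\<And>x. x \<in> D \<Longrightarrow> \<exists>L. (f has_derivative L) (at x) \<and> (\<forall>c v. L (c *s v) = c * L v)) \<Longrightarrow> hol f D"
  by (simp add: holomorphic_several_def)

lemma hol_const [intro]: "hol (\<lambda>x. c) D"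
  by (rule holI, rule exI[of _ "\<lambda>v. 0"]) simp

lemma hol_nth [intro]: "hol (\<lambda>x. x $ i) D"
  by (rule holI, rule exI[of _ "\<lambda>v. v $ i"])
    (auto intro!: bounded_linear_imp_has_derivative bounded_linear_vec_nth)

lemma hol_add [intro]: assumes "hol f D" "hol g D" shows "hol (\<lambda>x. f x + g x) D"
proof (rule holI)
  fix x assume "x \<in> D"
  then obtain L M where "(f has_derivative L) (at x)" "(g has_derivative M) (at x)" "\<forall>c v. L (c *s v) = c * L v" "\<forall>c v. M (c *s v) = c * M v"
    using assms unfolding holomorphic_several_def by meson
  then show "\<exists>L. ((\<lambda>x. f x + g x) has_derivative L) (at x) \<and> (\<forall>c v. L (c *s v) = c * L v)"
    by (intro exI[of _ "\<lambda>v. L v + M v"]) (auto intro: has_derivative_add simp: distrib_left)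
qed

lemma hol_mult [intro]: assumes "hol f D" "hol g D" shows "hol (\<lambda>x. f x * g x) D"
proof (rule holI)
  fix x assume "x \<in> D"
  then obtain L M where "(f has_derivative L) (at x)" "(g has_derivative M) (at x)" "\<forall>c v. L (c *s v) = c * L v" "\<forall>c v. M (c *s v) = c * M v"
    using assms unfolding holomorphic_several_def by meson
  then show "\<exists>L. ((\<lambda>x. f x * g x) has_derivative L) (at x) \<and> (\<forall>c v. L (c *s v) = c * L v)"
    by (intro exI[of _ "\<lambda>v. f x * M v + L v * g x"] conjI has_derivative_mult) (simp_all add: algebra_simps)
qed

lemma hol_compose:
  assumes "hol f D" "\<And>x. x \<in> D \<Longrightarrow> g field_differentiable at (f x)"
  shows "hol (\<lambda>x. g (f x)) D"
proof (rule holI)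
  fix x assume x: "x \<in> D"
  then obtain L where L: "(f has_derivative L) (at x)" "\<forall>c v. L (c *s v) = c * L v"
    using assms(1) unfolding holomorphic_several_def by meson
  obtain g' where "(g has_field_derivative g') (at (f x))" using assms(2)[OF x] by (auto simp: field_differentiable_def)
  then have "(g has_derivative (*) g') (at (f x))" by (simp add: has_field_derivative_def)
  from diff_chain_at[OF L(1) this] L(2)
  show "\<exists>L. ((\<lambda>x. g (f x)) has_derivative L) (at x) \<and> (\<forall>c v. L (c *s v) = c * L v)"
    by (intro exI[of _ "\<lambda>v. g' * L v"]) (auto simp: o_def)
qed

lemma hol_minus [intro]: "hol f D \<Longrightarrow> hol (\<lambda>x. - f x) D"
  using hol_mult[OF hol_const[of "-1"]] by fastforce

lemma hol_diff [intro]: "hol f D \<Longrightarrow> hol g D \<Longrightarrow> hol (\<lambda>x. f x - g x) D"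
  using hol_add[OF _ hol_minus] by fastforce

lemma hol_divide: 
  assumes "hol f D" "hol g D" "\<And>x. x \<in> D \<Longrightarrow> g x \<noteq> 0"
  shows "hol (\<lambda>x. f x / g x) D"
proof -
  have "hol (\<lambda>x. f x * inverse (g x)) D"
    by (intro hol_mult assms(1) hol_compose[OF assms(2)] field_differentiable_inverse) (use assms(3) in auto)
  then show ?thesis by (simp add: divide_inverse)
qed

lemma hol_sum [intro]: "(\<And>i. i \<in> I \<Longrightarrow> hol (f i) D) \<Longrightarrow> hol (\<lambda>x. \<Sum>i\<in>I. f i x) D"
  by (induct I rule: infinite_finite_induct) auto

lemma hol_prod [intro]: "(\<And>i. i \<in> I \<Longrightarrow> hol (f i) D) \<Longrightarrow> hol (\<lambda>x. \<Prod>i\<in>I. f i x) D"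
  by (induct I rule: infinite_finite_induct) auto

lemma hol_if: "(P \<Longrightarrow> hol f D) \<Longrightarrow> (\<not> P \<Longrightarrow> hol g D) \<Longrightarrow> hol (\<lambda>x. if P then f x else g x) D"
  by (cases P) simp_all

lemma hol_continuous: "hol f D \<Longrightarrow> continuous_on D f"
  unfolding holomorphic_several_def by (meson continuous_at_imp_continuous_on has_derivative_continuous)

lemma hol_det: 
  fixes A :: "complex ^ 'n \<Rightarrow> complex ^ 'm ^ 'm"
  assumes "\<And>i j. hol (\<lambda>x. A x $ i $ j) D" shows "hol (\<lambda>x. det (A x)) D"
  unfolding det_def by (intro hol_sum hol_mult hol_prod hol_const assms)

definition holomorphic_E :: "(complex ^ 'n \<Rightarrow> E) \<Rightarrow> (complex ^ 'n) set \<Rightarrow> bool" where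
  "holomorphic_E Z D \<longleftrightarrow> (\<forall>i. hol (\<lambda>x. fst (Z x) $ i) D) \<and>
     (\<forall>r. hol (\<lambda>x. fst (snd (Z x)) $ r) D) \<and> hol (\<lambda>x. snd (snd (Z x))) D"

lemma hol_pairing:
  assumes "holomorphic_E Z D" shows "hol (\<lambda>x. pairing (Z x) \<Psi>) D"
proof -
  obtain v \<psi> s where \<Psi>: "\<Psi> = (v, \<psi>, s)" by (cases \<Psi>)
  have "(\<lambda>x. pairing (Z x) \<Psi>) = (\<lambda>x. (\<Sum>i\<in>UNIV. fst (Z x) $ i * v $ i) + (\<Sum>r\<in>UNIV. csign r * fst (snd (Z x)) $ r * \<psi> $ opp r) + snd (snd (Z x)) * s)"
    by (simp add: \<Psi> pairing_def case_prod_beta scalar_product_def bil_apply)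
  then show ?thesis using assms unfolding holomorphic_E_def by (auto intro!: hol_add hol_sum hol_mult hol_const)
qed

lemma proj_point_self: "z \<in> proj_point z"
  unfolding proj_point_def using cscale_simps(3)[of z] by (metis (mono_tags, lifting) mem_Collect_eq zero_neq_one)

lemma affine_coord_proj_point: "affine_coord \<Psi> \<Psi>' (proj_point z) = pairing z \<Psi>' / pairing z \<Psi>"
proof -
  have "(\<lambda>z. pairing z \<Psi>' / pairing z \<Psi>) ` proj_point z = {pairing z \<Psi>' / pairing z \<Psi>}"
  proof
    show "(\<lambda>z. pairing z \<Psi>' / pairing z \<Psi>) ` proj_point z \<subseteq> {pairing z \<Psi>' / pairing z \<Psi>}"
      by (auto simp: proj_point_def pairing_cscale)
    show "{pairing z \<Psi>' / pairing z \<Psi>} \<subseteq> (\<lambda>z. pairing z \<Psi>' / pairing z \<Psi>) ` proj_point z"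
      using proj_point_self[of z] by blast
  qed
  then show ?thesis by (simp add: affine_coord_def)
qed

text \<open>
  A part of a chart, for a condition on representatives that does not depend on their scale.
\<close>

definition chart_part :: "E \<Rightarrow> (E \<Rightarrow> bool) \<Rightarrow> E set set" where
  "chart_part \<Psi> Q = proj_point ` {z \<in> dual27 - {0}. pairing z \<Psi> \<noteq> 0 \<and> Q z}"

lemma chart_part_True: "chart \<Psi> = chart_part \<Psi> (\<lambda>z. True)"
  by (simp add: chart_def chart_part_def)

lemma chart_part_cone:
  assumes Q: "\<And>c z. c \<noteq> 0 \<Longrightarrow> Q z \<Longrightarrow> Q (cscale c z)" and p: "p \<in> chart_part \<Psi> Q \<inter> plucker_locus"
  obtains z where "z \<in> plucker_cone" "pairing z \<Psi> = 1" "Q z" "p = proj_point z"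
proof -
  obtain z0 where z0: "pairing z0 \<Psi> \<noteq> 0" "Q z0" "p = proj_point z0" using p by (auto simp: chart_part_def)
  obtain z1 where z1: "z1 \<in> plucker_cone" "p = proj_point z1" using p by (auto simp: plucker_locus_eq)
  obtain c where "c \<noteq> 0" "z0 = cscale c z1" using z0(3) z1(2) proj_point_eq_iff by metis
  then have z0c: "z0 \<in> plucker_cone" using plucker_cone_cscale z1(1) by simp
  let ?z = "cscale (1 / pairing z0 \<Psi>) z0"
  have "proj_point ?z = p" using z0 unfolding z0(3) proj_point_eq_iff by (intro exI[of _ "1 / pairing z0 \<Psi>"]) simp
  moreover have "?z \<in> plucker_cone" "pairing ?z \<Psi> = 1" "Q ?z" using z0 z0c plucker_cone_cscale Q by (auto simp: pairing_cscale)
  ultimately show ?thesis using that by metis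
qed

lemma chart_part_mem: "z \<in> plucker_cone \<Longrightarrow> pairing z \<Psi> \<noteq> 0 \<Longrightarrow> Q z \<Longrightarrow> proj_point z \<in> chart_part \<Psi> Q \<inter> plucker_locus"
  by (auto simp: chart_part_def plucker_locus_eq plucker_cone_def)

text \<open>
  The coordinates are indexed by the subset \<open>J\<close> of the basis instead of the type \<open>16\<close>: \<open>Z f\<close> is
  the point with coordinates \<open>f\<close>, normalised at \<open>\<Psi>\<close>, and \<open>dom f\<close> says that \<open>f\<close> belongs to the
  domain. Coordinates are prescribed only on \<open>J\<close>, so \<open>unique\<close> is required for every \<open>f\<close> that
  agrees with those of \<open>z\<close> there. In \<open>hol\<close>, \<open>h\<close> stands for the passage from \<open>\<complex>\<^sup>1\<^sup>6\<close> to functions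
  on \<open>J\<close>.
\<close>

lemma plucker_solvableI:
  fixes Z :: "(E \<Rightarrow> complex) \<Rightarrow> E" and dom :: "(E \<Rightarrow> complex) \<Rightarrow> bool"
  assumes J: "J \<subseteq> B - {\<Psi>}" and card: "card J = 16"
    and Q: "\<And>c z. c \<noteq> 0 \<Longrightarrow> Q z \<Longrightarrow> Q (cscale c z)"
    and hol: "\<And>h :: complex ^ 16 \<Rightarrow> E \<Rightarrow> complex. (\<And>\<Psi>' D. \<Psi>' \<in> J \<Longrightarrow> hol (\<lambda>x. h x \<Psi>') D) \<Longrightarrow>
        open {x. dom (h x)} \<and> holomorphic_E (\<lambda>x. Z (h x)) {x. dom (h x)}"
    and param: "\<And>f. dom f \<Longrightarrow> Z f \<in> plucker_cone \<and> pairing (Z f) \<Psi> = 1 \<and> Q (Z f) \<and> (\<forall>\<Psi>'\<in>J. pairing (Z f) \<Psi>' = f \<Psi>')"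
    and unique: "\<And>z f. z \<in> plucker_cone \<Longrightarrow> pairing z \<Psi> = 1 \<Longrightarrow> Q z \<Longrightarrow> (\<And>\<Psi>'. \<Psi>' \<in> J \<Longrightarrow> f \<Psi>' = pairing z \<Psi>') \<Longrightarrow> dom f \<and> Z f = z"
  shows "plucker_solvable B \<Psi> (chart_part \<Psi> Q)"
proof -
  have "finite J" using card by (metis card.infinite zero_neq_numeral)
  then obtain j :: "16 \<Rightarrow> E" where j: "bij_betw j UNIV J" 
    using finite_same_card_bij[of "UNIV :: 16 set" J] card by auto
  then have inj: "inj j" and ran: "range j = J" by (auto simp: bij_betw_def)
  define h :: "complex ^ 16 \<Rightarrow> E \<Rightarrow> complex" where "h x \<Psi>' = x $ inv_into UNIV j \<Psi>'" for x \<Psi>'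
  define D where "D = {x. dom (h x)}"
  define F where "F \<Psi>' x = pairing (Z (h x)) \<Psi>'" for \<Psi>' x
  define y where "y p = (\<chi> m. affine_coord \<Psi> (j m) p)" for p
  have D: "open D" and ZD: "holomorphic_E (\<lambda>x. Z (h x)) D"
    using hol[of h] unfolding D_def h_def by (auto intro: hol_nth)
  have yz: "y (proj_point z) \<in> D \<and> Z (h (y (proj_point z))) = z" if z: "z \<in> plucker_cone" "pairing z \<Psi> = 1" "Q z" for z
  proof -
    have "h (y (proj_point z)) \<Psi>' = pairing z \<Psi>'" if \<Psi>': "\<Psi>' \<in> J" for \<Psi>'
    proof -
      obtain m where "\<Psi>' = j m" using \<Psi>' ran by blast
      then show ?thesis by (simp add: h_def y_def affine_coord_proj_point z(2) inv_f_f[OF inj])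
    qed
    from unique[OF z this] show ?thesis by (simp add: D_def)
  qed
  have yx: "y (proj_point (Z (h x))) = x \<and> proj_point (Z (h x)) \<in> chart_part \<Psi> Q \<inter> plucker_locus" if "x \<in> D" for x
  proof -
    have Z: "Z (h x) \<in> plucker_cone" "pairing (Z (h x)) \<Psi> = 1" "Q (Z (h x))" "\<And>\<Psi>'. \<Psi>' \<in> J \<Longrightarrow> pairing (Z (h x)) \<Psi>' = h x \<Psi>'"
      using param[of "h x"] that by (auto simp: D_def)
    have "j m \<in> J" for m using ran by blast
    then have "y (proj_point (Z (h x))) = x"
      by (simp add: vec_eq_iff y_def affine_coord_proj_point Z) (simp add: h_def inv_f_f[OF inj])
    moreover have "proj_point (Z (h x)) \<in> chart_part \<Psi> Q \<inter> plucker_locus" by (rule chart_part_mem) (use Z in auto)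
    ultimately show ?thesis by blast
  qed
  have norm: "y p \<in> D \<and> p = proj_point (Z (h (y p))) \<and> (\<forall>\<Psi>'. affine_coord \<Psi> \<Psi>' p = F \<Psi>' (y p))"
    if p: "p \<in> chart_part \<Psi> Q \<inter> plucker_locus" for p
  proof -
    obtain z where z: "z \<in> plucker_cone" "pairing z \<Psi> = 1" "Q z" "p = proj_point z"
      using chart_part_cone[OF Q p] by blast
    have "Z (h (y p)) = z" "y p \<in> D" using yz[OF z(1-3)] unfolding z(4) by auto
    then show ?thesis using z(2) by (simp add: F_def z(4) affine_coord_proj_point)
  qed
  have "bij_betw y (chart_part \<Psi> Q \<inter> plucker_locus) D"
    by (rule bij_betw_byWitness[where f' = "\<lambda>x. proj_point (Z (h x))"]) (use norm yx in auto)
  moreover have "\<forall>\<Psi>'\<in>B. hol (F \<Psi>') D" unfolding F_def by (intro ballI hol_pairing ZD)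
  moreover have "\<forall>p\<in>chart_part \<Psi> Q \<inter> plucker_locus. \<forall>\<Psi>'\<in>B. affine_coord \<Psi> \<Psi>' p = F \<Psi>' (y p)" using norm by blast
  ultimately show ?thesis
    unfolding plucker_solvable_def Let_def using inj ran J D
    by (intro exI[of _ j] exI[of _ D] exI[of _ F]) (simp add: y_def[abs_def])
qed

lemma cp_open_chart_part:
  assumes Q: "\<And>c z. c \<noteq> 0 \<Longrightarrow> Q z \<Longrightarrow> Q (cscale c z)" and op: "open {z. pairing z \<Psi> \<noteq> 0 \<and> Q z}"
  shows "cp_open (chart_part \<Psi> Q)"
proof -
  have "proj_point z \<in> chart_part \<Psi> Q \<longleftrightarrow> pairing z \<Psi> \<noteq> 0 \<and> Q z" if z: "z \<in> dual27 - {0}" for z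
  proof
    assume "proj_point z \<in> chart_part \<Psi> Q"
    then obtain w where w: "pairing w \<Psi> \<noteq> 0" "Q w" "proj_point z = proj_point w" by (auto simp: chart_part_def)
    then obtain c where "c \<noteq> 0" "z = cscale c w" using proj_point_eq_iff by metis
    then show "pairing z \<Psi> \<noteq> 0 \<and> Q z" using w Q by (simp add: pairing_cscale)
  next
    assume "pairing z \<Psi> \<noteq> 0 \<and> Q z"
    then show "proj_point z \<in> chart_part \<Psi> Q" using z by (auto simp: chart_part_def)
  qed
  then have "{z \<in> dual27 - {0}. proj_point z \<in> chart_part \<Psi> Q} = (dual27 - {0}) \<inter> {z. pairing z \<Psi> \<noteq> 0 \<and> Q z}" by blast
  then show ?thesis unfolding cp_open_def using op by (auto simp: chart_part_def CP26_def intro: openin_open_Int)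
qed

lemma continuous_pairing: "continuous_on S (\<lambda>z. pairing z \<Psi>)"
  by (intro linear_continuous_on bounded_bilinear.bounded_linear_left[OF bounded_bilinear_pairing])

lemma open_pairing_nz: "open {z. pairing z \<Psi> \<noteq> 0}"
  by (intro open_Collect_neq continuous_pairing continuous_on_const)

lemma cp_open_chart: "cp_open (chart \<Psi>)"
  unfolding chart_part_True by (rule cp_open_chart_part) (simp_all add: open_pairing_nz)

section \<open>Bases, charts and the big cell\<close>

definition vcoord :: "V \<Rightarrow> E" where "vcoord v = (v, 0, 0)"

text \<open>
  Pairing with this vector is the component \<open>r\<close> of the spinor up to sign, because \<open>C\<close> exchanges an
  index with its complement.
\<close>

definition scoord :: "sidx \<Rightarrow> E" where "scoord r = (0, axis (opp r) 1, 0)"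

definition tcoord :: E where "tcoord = (0, 0, 1)"

lemma pairing_coord:
  "pairing (u, \<phi>, t) (vcoord (wvec k b)) = wt k b u" "pairing (u, \<phi>, t) (vcoord (axis i 1)) = u $ i"
  "pairing (u, \<phi>, t) (scoord r) = csign r * \<phi> $ r" "pairing (u, \<phi>, t) tcoord = t"
  by (simp_all add: vcoord_def scoord_def tcoord_def pairing_simps wvec_scalar_product scalar_product_axis bil_axis)

lemma coord_eq_iff [simp]: "vcoord u = vcoord v \<longleftrightarrow> u = v" "scoord r = scoord s \<longleftrightarrow> r = s"
   "vcoord u = scoord r \<longleftrightarrow> False" "scoord r = vcoord u \<longleftrightarrow> False" "vcoord u = tcoord \<longleftrightarrow> False" "tcoord = vcoord u \<longleftrightarrow> False" 
   "scoord r = tcoord \<longleftrightarrow> False" "tcoord = scoord r \<longleftrightarrow> False"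
proof -
  show "scoord r = scoord s \<longleftrightarrow> r = s"
    unfolding scoord_def by (auto simp: axis_eq_axis) (metis opp_simps(2))
qed (auto simp: vcoord_def scoord_def tcoord_def axis_eq_0_iff)

lemma wvec_eq_iff [simp]: "wvec k b = wvec l c \<longleftrightarrow> k = l \<and> b = c"
proof
  assume "wvec k b = wvec l c"
  then have "wt k (\<not> b) (wvec k b) = wt k (\<not> b) (wvec l c)" by simp
  then show "k = l \<and> b = c" by (auto simp: wt_wvec split: if_splits)
qed simp

lemma spinor_basis_eq: "spinor_basis = scoord ` {r. chi r = -1}"
proof -
  have "{s. chi s = 1} = opp ` {r. chi r = -1}"
  proof
    show "{s. chi s = 1} \<subseteq> opp ` {r. chi r = -1}"
    proof
      fix s assume "s \<in> {s. chi s = 1}"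
      then have "s = opp (opp s)" "chi (opp s) = -1" by simp_all
      then show "s \<in> opp ` {r. chi r = -1}" by blast
    qed
  qed auto
  moreover have "spinor_basis = (\<lambda>s. (0, axis s 1, 0)) ` {s. chi s = 1}"
    by (auto simp: spinor_basis_def axis_Delta_p)
  ultimately show ?thesis by (simp add: scoord_def image_image)
qed

lemma std_basis_eq: "std_basis = (\<lambda>i. vcoord (axis i 1)) ` UNIV \<union> scoord ` {r. chi r = -1} \<union> {tcoord}"
proof -
  have "{(axis i 1, 0, 0) | i. True} = (\<lambda>i. vcoord (axis i 1)) ` UNIV" unfolding vcoord_def by blast
  then show ?thesis unfolding std_basis_def spinor_basis_eq tcoord_def by simp
qed

lemma weight_basis_eq: "weight_basis = (\<lambda>(k, b). vcoord (wvec k b)) ` UNIV \<union> scoord ` {r. chi r = -1} \<union> {tcoord}"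
proof -
  have "{(axis (k, False) 1 + \<epsilon> *s axis (k, True) 1, 0, 0) | k \<epsilon>. \<epsilon> \<in> {\<i>, - \<i>}} = (\<lambda>(k, b). vcoord (wvec k b)) ` UNIV"
  proof -
    have "{\<i>, - \<i>} = range unit_i" by (auto simp: UNIV_bool)
    then show ?thesis unfolding vcoord_def wvec_def by auto
  qed
  then show ?thesis unfolding weight_basis_def spinor_basis_eq tcoord_def by simp
qed

text \<open>
  Flipping bit \<open>k\<close> or another bit matches the four classes given by parity and by bit \<open>k\<close>.
\<close>

lemma card_odd: "card {r. chi r = -1 \<and> r k = b} = 8"
proof -
  obtain l :: 5 where l: "l \<noteq> k" by (rule flip_other)
  have S: "card (UNIV :: sidx set) = 32" by (simp add: card_fun)
  let ?A = "\<lambda>c b. {r. chi r = c \<and> r k = b}"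
  have f1: "bij_betw (flip l) (?A c b) (?A (- c) b)" for c b
    by (rule bij_betw_byWitness[where f' = "flip l"]) (use l in auto)
  have f2: "bij_betw (flip k) (?A c b) (?A (- c) (\<not> b))" for c b
    by (rule bij_betw_byWitness[where f' = "flip k"]) auto
  have e1: "card (?A (- c) b) = card (?A c b)" for c b using bij_betw_same_card[OF f1] by simp
  have e2: "card (?A c (\<not> b)) = card (?A c b)" for c b using bij_betw_same_card[OF f2, of "- c" b] e1[of c b] by simp
  have "UNIV = ?A 1 b \<union> (?A (-1) b \<union> (?A 1 (\<not> b) \<union> ?A (-1) (\<not> b)))" using chi_cases by auto
  then have "card (UNIV :: sidx set) = card (?A 1 b \<union> (?A (-1) b \<union> (?A 1 (\<not> b) \<union> ?A (-1) (\<not> b))))" by (rule arg_cong)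
  also have "\<dots> = card (?A 1 b) + (card (?A (-1) b) + (card (?A 1 (\<not> b)) + card (?A (-1) (\<not> b))))"
  proof -
    have "?A 1 b \<inter> (?A (-1) b \<union> (?A 1 (\<not> b) \<union> ?A (-1) (\<not> b))) = {}"
      "?A (-1) b \<inter> (?A 1 (\<not> b) \<union> ?A (-1) (\<not> b)) = {}" "?A 1 (\<not> b) \<inter> ?A (-1) (\<not> b) = {}"
      by (auto simp: eq_minus_self_iff)
    then show ?thesis by (simp add: card_Un_disjoint)
  qed
  also have "\<dots> = 4 * card (?A (-1) b)" using e1[of 1 b] e2[of 1 b] e2[of "-1" b] by simp
  finally show ?thesis using S by simp
qed

lemma card_odd_all: "card {r. chi r = -1} = 16"
proof -
  have "{r. chi r = -1} = {r. chi r = -1 \<and> r 0 = True} \<union> {r. chi r = -1 \<and> r 0 = False}" by auto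
  then have "card {r. chi r = -1} = card {r. chi r = -1 \<and> r 0 = True} + card {r. chi r = -1 \<and> r 0 = False}"
    by (metis (mono_tags, lifting) card_Un_disjoint disjoint_iff finite mem_Collect_eq)
  then show ?thesis by (simp only: card_odd)
qed

lemma inj_scoord: "inj_on scoord A" by (simp add: inj_on_def)

lemma card_basis:
  assumes "inj f" shows "card ((\<lambda>i :: vidx. vcoord (f i)) ` UNIV \<union> scoord ` {r. chi r = -1} \<union> {tcoord}) = 27"
proof -
  have "card ((\<lambda>i :: vidx. vcoord (f i)) ` UNIV) = 10"
    by (subst card_image) (use assms in \<open>auto simp: inj_on_def\<close>)
  moreover have "card (scoord ` {r. chi r = -1}) = 16" by (simp add: card_image inj_scoord card_odd_all)
  moreover have "card ((\<lambda>i :: vidx. vcoord (f i)) ` UNIV \<union> scoord ` {r. chi r = -1} \<union> {tcoord}) =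
    card ((\<lambda>i :: vidx. vcoord (f i)) ` UNIV) + card (scoord ` {r. chi r = -1}) + card {tcoord}"
    by (subst card_Un_disjoint, simp, simp, force)+ simp
  ultimately show ?thesis by simp
qed

lemma card_std_basis: "card std_basis = 27"
  unfolding std_basis_eq by (rule card_basis) (auto simp: inj_def axis_eq_axis)

lemma card_weight_basis: "card weight_basis = 27"
  using card_basis[of "\<lambda>(k, b). wvec k b"] unfolding weight_basis_eq by (auto simp: inj_def case_prod_beta' prod_eq_iff)

lemma charts_cover:
  assumes V: "\<And>u. (\<And>v. v \<in> A \<Longrightarrow> scalar_product u v = 0) \<Longrightarrow> u = 0"
  shows "(\<Union>\<Psi>\<in>vcoord ` A \<union> scoord ` {r. chi r = -1} \<union> {tcoord}. chart \<Psi>) = CP26"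
proof
  show "(\<Union>\<Psi>\<in>vcoord ` A \<union> scoord ` {r. chi r = -1} \<union> {tcoord}. chart \<Psi>) \<subseteq> CP26"
    unfolding chart_def CP26_def by blast
  show "CP26 \<subseteq> (\<Union>\<Psi>\<in>vcoord ` A \<union> scoord ` {r. chi r = -1} \<union> {tcoord}. chart \<Psi>)"
  proof
    fix p assume "p \<in> CP26"
    then obtain z where z: "z \<in> dual27 - {0}" "p = proj_point z" unfolding CP26_def by blast
    obtain u \<phi> t where z': "z = (u, \<phi>, t)" by (cases z)
    have "\<exists>\<Psi>\<in>vcoord ` A \<union> scoord ` {r. chi r = -1} \<union> {tcoord}. pairing z \<Psi> \<noteq> 0"
    proof (rule ccontr)
      assume "\<not> ?thesis"
      then have 0: "pairing z \<Psi> = 0" if "\<Psi> \<in> vcoord ` A \<union> scoord ` {r. chi r = -1} \<union> {tcoord}" for \<Psi> using that by blast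
      have "u = 0"
      proof (rule V)
        fix v assume "v \<in> A"
        then show "scalar_product u v = 0" using 0[of "vcoord v"] by (simp add: z' vcoord_def pairing_simps)
      qed
      moreover have "t = 0" using 0[of tcoord] by (simp add: z' pairing_coord)
      moreover have "\<phi> $ r = 0" for r
        using 0[of "scoord r"] chi_cases[of r] z(1) by (auto simp: z' pairing_coord dual27_def Delta_m_iff)
      ultimately show False using z(1) by (simp add: z' zero_prod_def vec_eq_iff)
    qed
    then show "p \<in> (\<Union>\<Psi>\<in>vcoord ` A \<union> scoord ` {r. chi r = -1} \<union> {tcoord}. chart \<Psi>)"
      using z unfolding chart_def by blast
  qed
qed

lemma std_charts_cover: "(\<Union>\<Psi>\<in>std_basis. chart \<Psi>) = CP26"
proof -
  have "std_basis = vcoord ` range (\<lambda>i. axis i 1) \<union> scoord ` {r. chi r = -1} \<union> {tcoord}"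
    unfolding std_basis_eq image_image ..
  moreover have "u = 0" if "\<And>v. v \<in> range (\<lambda>i. axis i 1) \<Longrightarrow> scalar_product u v = 0" for u :: V
  proof -
    have "u $ i = 0" for i using that[of "axis i 1"] by (simp add: scalar_product_axis)
    then show ?thesis by (simp add: vec_eq_iff)
  qed
  ultimately show ?thesis using charts_cover by metis
qed

lemma weight_charts_cover: "(\<Union>\<Psi>\<in>weight_basis. chart \<Psi>) = CP26"
proof -
  have "weight_basis = vcoord ` range (\<lambda>(k, b). wvec k b) \<union> scoord ` {r. chi r = -1} \<union> {tcoord}"
    unfolding weight_basis_eq image_image by (simp add: case_prod_beta')
  moreover have "u = 0" if all: "\<And>v. v \<in> range (\<lambda>(k, b). wvec k b) \<Longrightarrow> scalar_product u v = 0" for u :: V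
  proof (rule wt_eqI)
    fix k b
    have "wvec k b \<in> range (\<lambda>(k, b). wvec k b)" by (rule image_eqI[of _ _ "(k, b)"]) simp_all
    from all[OF this] show "wt k b u = wt k b 0" by (simp add: wvec_scalar_product wt_linear)
  qed
  ultimately show ?thesis using charts_cover by metis
qed

definition odd_vec :: "(sidx \<Rightarrow> complex) \<Rightarrow> \<Delta>" where
  "odd_vec g = (\<chi> r. if chi r = -1 then g r else 0)"

lemma odd_vec_mem: "odd_vec g \<in> \<Delta>\<^sub>m"
  by (auto simp: Delta_m_iff odd_vec_def eq_minus_self_iff)

lemma odd_vec_nth: "odd_vec g $ r = (if chi r = -1 then g r else 0)"
  by (simp add: odd_vec_def)

lemma odd_vec_eqI: "\<phi> \<in> \<Delta>\<^sub>m \<Longrightarrow> (\<And>r. chi r = -1 \<Longrightarrow> g r = \<phi> $ r) \<Longrightarrow> odd_vec g = \<phi>"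
  using chi_cases by (auto simp: vec_eq_iff odd_vec_def Delta_m_iff)

text \<open>
  By the Fierz identity, \<open>(\<phi>e\<phi>)\<close> kills \<open>\<phi>\<close>; pairing the result with \<open>\<phi>\<close> shows that it is
  isotropic.
\<close>

lemma big_cell_cone:
  assumes \<phi>: "\<phi> \<in> \<Delta>\<^sub>m" and t: "t \<noteq> 0" shows "((rsqrt2 / (2 * t)) *s bilvec \<phi> \<phi>, \<phi>, t) \<in> plucker_cone"
proof -
  have "scalar_product (bilvec \<phi> \<phi>) (bilvec \<phi> \<phi>) = 0"
    by (simp add: bilvec_scalar_product fierz[OF \<phi>] bil_linear)
  then show ?thesis
    using t by (simp add: plucker_cone_iff \<phi> zero_prod_def cliff_linear fierz[OF \<phi>] scalar_product_linear)
qed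

lemma big_cell_unique: "(u, \<phi>, t) \<in> plucker_cone \<Longrightarrow> t \<noteq> 0 \<Longrightarrow> u = (rsqrt2 / (2 * t)) *s bilvec \<phi> \<phi>"
proof -
  assume z: "(u, \<phi>, t) \<in> plucker_cone" and t: "t \<noteq> 0"
  then have "((2 * t) *s u) $ i = (rsqrt2 *s bilvec \<phi> \<phi>) $ i" for i by (simp add: plucker_cone_iff)
  then show ?thesis using t by (simp add: vec_eq_iff field_simps)
qed

lemma csign_sq: "csign r * (csign r * x) = x"
  unfolding mult.assoc[symmetric] csign_def by (simp add: sg_def)

lemma hol_bilvec:
  assumes "\<And>r. hol (\<lambda>x. f x $ r) D" "\<And>r. hol (\<lambda>x. g x $ r) D"
  shows "hol (\<lambda>x. bilvec (f x) (g x) $ i) D"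
  unfolding bilvec_nth bil_apply cliff_apply by (intro hol_sum hol_mult hol_const assms)

lemma hol_wt_bilvec:
  assumes "\<And>r. hol (\<lambda>x. f x $ r) D" "\<And>r. hol (\<lambda>x. g x $ r) D"
  shows "hol (\<lambda>x. wt k b (bilvec (f x) (g x))) D"
  unfolding wt_def by (intro hol_add hol_mult hol_const hol_bilvec assms)

lemma plucker_solvable_t:
  assumes B: "scoord ` {r. chi r = -1} \<subseteq> B" 
  shows "plucker_solvable B tcoord (chart tcoord)"
  unfolding chart_part_True
proof (rule plucker_solvableI[where J = "scoord ` {r. chi r = -1}" and dom = "\<lambda>f. True" and
    Z = "\<lambda>f. let \<phi> = odd_vec (\<lambda>r. csign r * f (scoord r)) in ((rsqrt2 / 2) *s bilvec \<phi> \<phi>, \<phi>, 1)"])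
  show "scoord ` {r. chi r = -1} \<subseteq> B - {tcoord}" using B by auto
  show "card (scoord ` {r. chi r = -1}) = 16" by (simp add: card_image inj_scoord card_odd_all)
next
  fix h :: "complex ^ 16 \<Rightarrow> E \<Rightarrow> complex"
  assume h: "\<And>\<Psi>' D. \<Psi>' \<in> scoord ` {r. chi r = -1} \<Longrightarrow> hol (\<lambda>x. h x \<Psi>') D"
  have *: "hol (\<lambda>x. odd_vec (\<lambda>r. csign r * h x (scoord r)) $ r) D" for r D
    unfolding odd_vec_nth by (intro hol_if hol_mult hol_const h) auto
  show "open {x. True} \<and> holomorphic_E (\<lambda>x. let \<phi> = odd_vec (\<lambda>r. csign r * h x (scoord r)) in ((rsqrt2 / 2) *s bilvec \<phi> \<phi>, \<phi>, 1)) {x. True}"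
    unfolding holomorphic_E_def Let_def fst_conv snd_conv vector_smult_component
    by (intro conjI allI hol_mult hol_const hol_bilvec *) simp
next
  fix f :: "E \<Rightarrow> complex"
  let ?\<phi> = "odd_vec (\<lambda>r. csign r * f (scoord r))"
  have "((rsqrt2 / 2) *s bilvec ?\<phi> ?\<phi>, ?\<phi>, 1) \<in> plucker_cone" using big_cell_cone[OF odd_vec_mem, of 1] by simp
  then show "(let \<phi> = odd_vec (\<lambda>r. csign r * f (scoord r)) in ((rsqrt2 / 2) *s bilvec \<phi> \<phi>, \<phi>, 1)) \<in> plucker_cone \<and>
    pairing (let \<phi> = odd_vec (\<lambda>r. csign r * f (scoord r)) in ((rsqrt2 / 2) *s bilvec \<phi> \<phi>, \<phi>, 1)) tcoord = 1 \<and> True \<and>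
    (\<forall>\<Psi>'\<in>scoord ` {r. chi r = -1}. pairing (let \<phi> = odd_vec (\<lambda>r. csign r * f (scoord r)) in ((rsqrt2 / 2) *s bilvec \<phi> \<phi>, \<phi>, 1)) \<Psi>' = f \<Psi>')"
    by (auto simp: Let_def pairing_coord odd_vec_nth csign_sq)
next
  fix z f assume z: "z \<in> plucker_cone" "pairing z tcoord = 1" and f: "\<And>\<Psi>'. \<Psi>' \<in> scoord ` {r. chi r = -1} \<Longrightarrow> f \<Psi>' = pairing z \<Psi>'"
  obtain u \<phi> t where z': "z = (u, \<phi>, t)" by (cases z)
  have "odd_vec (\<lambda>r. csign r * f (scoord r)) = \<phi>"
    by (rule odd_vec_eqI) (use z f in \<open>auto simp: z' plucker_cone_iff pairing_coord csign_sq\<close>)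
  then show "True \<and> (let \<phi> = odd_vec (\<lambda>r. csign r * f (scoord r)) in ((rsqrt2 / 2) *s bilvec \<phi> \<phi>, \<phi>, 1)) = z"
    using big_cell_unique[of u \<phi> t] z by (simp add: z' pairing_coord Let_def)
qed simp_all

section \<open>Charts of vector coordinates\<close>

text \<open>
  The components with \<open>r k \<noteq> b\<close> are obtained by solving the equations of \<open>u\<phi> = 0\<close> at the
  indices with bit \<open>b\<close>, in which they occur with the coefficient \<open>\<plusminus> wt k b u\<close>.
\<close>

definition kernel_spinor :: "5 \<Rightarrow> bool \<Rightarrow> V \<Rightarrow> (sidx \<Rightarrow> complex) \<Rightarrow> \<Delta>" where
  "kernel_spinor k b u g = odd_vec (\<lambda>r. if r k = b then g r
     else - (\<Sum>l\<in>UNIV - {k}. jw l (flip k r) * wt l (r l) u * g (flip l (flip k r))) / (jw k (flip k r) * wt k b u))"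

lemma cliff_apply_split: "cliff u \<psi> $ r = jw k r * wt k (r k) u * \<psi> $ flip k r + (\<Sum>l\<in>UNIV - {k}. jw l r * wt l (r l) u * \<psi> $ flip l r)"
  unfolding cliff_apply by (rule sum.remove) simp_all

text \<open>
  The equations at the other indices follow: \<open>\<omega> = u\<phi>\<close> satisfies \<open>u\<omega> = (u \<cdot> u)\<phi> = 0\<close>, so
  \<open>\<omega>\<close> is also determined by its components with bit \<open>b\<close>, which vanish.
\<close>

lemma cliff_kernel_spinor:
  assumes uu: "scalar_product u u = 0" and nz: "wt k b u \<noteq> 0"
  shows "cliff u (kernel_spinor k b u g) = 0"
proof -
  let ?\<phi> = "kernel_spinor k b u g"
  have \<phi>: "?\<phi> \<in> \<Delta>\<^sub>m" unfolding kernel_spinor_def by (rule odd_vec_mem)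
  have 1: "cliff u ?\<phi> $ r = 0" if r: "r k = b" for r
  proof (cases "chi r = 1")
    case False
    then show ?thesis using cliff_chirality(2)[OF \<phi>, of u] chi_cases[of r] by (simp add: Delta_p_iff)
  next
    case True
    have "?\<phi> $ flip l r = g (flip l r)" if "l \<noteq> k" for l
      using that r True by (simp add: kernel_spinor_def odd_vec_nth)
    moreover have "?\<phi> $ flip k r = - (\<Sum>l\<in>UNIV - {k}. jw l r * wt l (r l) u * g (flip l r)) / (jw k r * wt k b u)"
    proof -
      have "(\<Sum>l\<in>UNIV - {k}. jw l r * wt l (flip k r l) u * g (flip l r)) = (\<Sum>l\<in>UNIV - {k}. jw l r * wt l (r l) u * g (flip l r))"
        by (rule sum.cong) auto
      then show ?thesis using r True by (simp add: kernel_spinor_def odd_vec_nth)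
    qed
    ultimately show ?thesis
      using nz r by (simp add: cliff_apply_split[of u ?\<phi> r k])
  qed
  have "cliff u ?\<phi> $ r = 0" if r: "r k \<noteq> b" for r
  proof -
    have "cliff u (cliff u ?\<phi>) $ flip k r = 0" by (simp add: cliff_sq uu)
    moreover have "cliff u ?\<phi> $ flip l (flip k r) = 0" if "l \<noteq> k" for l
      by (rule 1) (use that r in auto)
    ultimately show ?thesis
      using nz r by (simp add: cliff_apply_split[of u "cliff u ?\<phi>" "flip k r" k])
  qed
  then have "cliff u ?\<phi> $ r = 0" for r using 1 by (cases "r k = b") blast+
  then show ?thesis by (simp add: vec_eq_iff)
qed

lemma kernel_spinor_unique:
  assumes \<phi>: "\<phi> \<in> \<Delta>\<^sub>m" and z: "cliff u \<phi> = 0" and nz: "wt k b u \<noteq> 0"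
    and g: "\<And>r. chi r = -1 \<Longrightarrow> r k = b \<Longrightarrow> g r = \<phi> $ r"
  shows "kernel_spinor k b u g = \<phi>"
  unfolding kernel_spinor_def
proof (rule odd_vec_eqI[OF \<phi>])
  fix r assume r: "chi r = -1"
  show "(if r k = b then g r else - (\<Sum>l\<in>UNIV - {k}. jw l (flip k r) * wt l (r l) u * g (flip l (flip k r))) / (jw k (flip k r) * wt k b u)) = \<phi> $ r"
  proof (cases "r k = b")
    case True then show ?thesis using g r by simp
  next
    case False
    have "(\<Sum>l\<in>UNIV - {k}. jw l (flip k r) * wt l (r l) u * g (flip l (flip k r))) =
        (\<Sum>l\<in>UNIV - {k}. jw l (flip k r) * wt l (flip k r l) u * \<phi> $ flip l (flip k r))"
      by (rule sum.cong) (use False r g in auto)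
    moreover have "cliff u \<phi> $ flip k r = 0" by (simp add: z)
    ultimately have "(jw k (flip k r) * wt k b u) * \<phi> $ r +
        (\<Sum>l\<in>UNIV - {k}. jw l (flip k r) * wt l (r l) u * g (flip l (flip k r))) = 0"
      using False by (simp add: cliff_apply_split[of u \<phi> "flip k r" k])
    then have "- (\<Sum>l\<in>UNIV - {k}. jw l (flip k r) * wt l (r l) u * g (flip l (flip k r))) = (jw k (flip k r) * wt k b u) * \<phi> $ r"
      by (simp only: add_eq_0_iff minus_minus)
    then show ?thesis using False nz by simp
  qed
qed

text \<open>
  A spinor killed by \<open>u\<close> has the form \<open>u\<omega>\<close>: take \<open>\<omega>\<close> to be a multiple of \<open>w\<phi>\<close> for a vector \<open>w\<close>
  with \<open>u \<cdot> w \<noteq> 0\<close>. Then \<open>(\<phi>v\<phi>) = (\<omega> u v u \<omega>) = 2 (u \<cdot> v) (\<omega>u\<omega>)\<close> for all \<open>v\<close>, so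
  \<open>(\<phi>e\<phi>)\<close> is a multiple of \<open>u\<close>.
\<close>

lemma vector_cone:
  assumes uu: "scalar_product u u = 0" and nz: "wt k b u \<noteq> 0" and \<phi>: "\<phi> \<in> \<Delta>\<^sub>m" and z: "cliff u \<phi> = 0"
  shows "(u, \<phi>, rsqrt2 * wt k b (bilvec \<phi> \<phi>) / (2 * wt k b u)) \<in> plucker_cone"
proof -
  \<comment> \<open>\<open>wvec k b\<close> serves as \<open>w\<close>, since \<open>u \<cdot> wvec k b = wt k b u\<close>\<close>
  define \<omega> where "\<omega> = (1 / (2 * wt k b u)) *s cliff (wvec k b) \<phi>"
  have "cliff u (cliff (wvec k b) \<phi>) = (2 * wt k b u) *s \<phi>"
    using cliff_cliff[of u "wvec k b" \<phi>] by (simp add: z cliff_linear wvec_scalar_product)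
  then have \<omega>: "\<phi> = cliff u \<omega>" using nz by (simp add: \<omega>_def cliff_linear vec_eq_iff)
  define c where "c = 2 * bil \<omega> (cliff u \<omega>)"
  have "scalar_product (bilvec \<phi> \<phi>) v = scalar_product (c *s u) v" for v
  proof -
    have "cliff u (cliff v (cliff u \<omega>)) = (2 * scalar_product u v) *s cliff u \<omega>"
      using cliff_cliff[of u v "cliff u \<omega>"] by (simp add: cliff_sq uu cliff_linear)
    then have "bil (cliff u \<omega>) (cliff v (cliff u \<omega>)) = 2 * scalar_product u v * bil \<omega> (cliff u \<omega>)"
      by (simp add: bil_cliff[symmetric] bil_linear)
    then show ?thesis by (simp add: bilvec_scalar_product \<omega>[symmetric] scalar_product_linear c_def)
  qed
  from this[of "axis i 1" for i] have bv: "bilvec \<phi> \<phi> = c *s u" by (simp add: vec_eq_iff scalar_product_axis)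
  have "u \<noteq> 0" using nz by (auto simp: wt_linear)
  then show ?thesis using uu z \<phi> nz by (simp add: plucker_cone_iff bv wt_linear zero_prod_def vec_eq_iff)
qed

lemma vector_cone_t:
  assumes "(u, \<phi>, t) \<in> plucker_cone" "wt k b u \<noteq> 0" shows "rsqrt2 * wt k b (bilvec \<phi> \<phi>) / (2 * wt k b u) = t"
proof -
  have "wt k b ((2 * t) *s u) = wt k b (rsqrt2 *s bilvec \<phi> \<phi>)" using assms(1) by (simp add: plucker_cone_iff)
  then show ?thesis using assms(2) by (simp add: wt_linear field_simps)
qed

lemma hol_wt: "(\<And>i. hol (\<lambda>x. U x $ i) D) \<Longrightarrow> hol (\<lambda>x. wt k b (U x)) D"
  unfolding wt_def by (intro hol_add hol_mult hol_const)

lemma cscale_fst: "fst (cscale c z) = c *s fst z" by (simp add: cscale_def case_prod_beta)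

lemma pairing_vcoord: "pairing (u, \<phi>, t) (vcoord v) = scalar_product u v"
  by (simp add: vcoord_def pairing_simps)

text \<open>
  Reduces a chart of a vector coordinate to the quadric \<open>u \<cdot> u = 0\<close>: a parametrisation \<open>U\<close> of
  isotropic vectors by eight coordinates is completed by the eight components of \<open>\<phi>\<close> with
  \<open>r k = b\<close>.
\<close>

lemma plucker_solvable_vector:
  fixes U :: "(E \<Rightarrow> complex) \<Rightarrow> V" and dom :: "(E \<Rightarrow> complex) \<Rightarrow> bool"
  assumes B: "vcoord ` JV \<union> scoord ` {r. chi r = -1 \<and> r k = b} \<subseteq> B" and v0: "v0 \<notin> JV" and card: "card JV = 8"
    and Q: "\<And>c u. c \<noteq> 0 \<Longrightarrow> Q u \<Longrightarrow> Q (c *s u)"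
    and hol: "\<And>h :: complex ^ 16 \<Rightarrow> E \<Rightarrow> complex. (\<And>v D. v \<in> JV \<Longrightarrow> hol (\<lambda>x. h x (vcoord v)) D) \<Longrightarrow>
        open {x. dom (h x)} \<and> (\<forall>i. hol (\<lambda>x. U (h x) $ i) {x. dom (h x)})"
    and param: "\<And>f. dom f \<Longrightarrow> scalar_product (U f) (U f) = 0 \<and> wt k b (U f) \<noteq> 0 \<and> scalar_product (U f) v0 = 1 \<and> Q (U f) \<and>
        (\<forall>v\<in>JV. scalar_product (U f) v = f (vcoord v))"
    and unique: "\<And>u f. scalar_product u u = 0 \<Longrightarrow> scalar_product u v0 = 1 \<Longrightarrow> Q u \<Longrightarrow> (\<And>v. v \<in> JV \<Longrightarrow> f (vcoord v) = scalar_product u v) \<Longrightarrow> dom f \<and> U f = u"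
  shows "plucker_solvable B (vcoord v0) (chart_part (vcoord v0) (\<lambda>z. Q (fst z)))"
proof -
  define J where "J = vcoord ` JV \<union> scoord ` {r. chi r = -1 \<and> r k = b}"
  define S where "S f = kernel_spinor k b (U f) (\<lambda>r. csign r * f (scoord r))" for f :: "E \<Rightarrow> complex"
  define Z where "Z f = (U f, S f, rsqrt2 * wt k b (bilvec (S f) (S f)) / (2 * wt k b (U f)))" for f :: "E \<Rightarrow> complex"
  show ?thesis
  proof (rule plucker_solvableI[where J = J and dom = dom and Z = Z])
    show "J \<subseteq> B - {vcoord v0}" using B v0 unfolding J_def by auto
    have "finite JV" using card by (metis card.infinite zero_neq_numeral)
    moreover have "card (vcoord ` JV) = 8" using card by (simp add: card_image inj_on_def)
    ultimately show "card J = 16" unfolding J_def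
      by (subst card_Un_disjoint) (auto simp: card_image inj_scoord card_odd)
    show "Q (fst (cscale c z))" if "c \<noteq> 0" "Q (fst z)" for c z using that Q by (simp add: cscale_fst)
  next
    fix h :: "complex ^ 16 \<Rightarrow> E \<Rightarrow> complex"
    assume h: "\<And>\<Psi>' D. \<Psi>' \<in> J \<Longrightarrow> hol (\<lambda>x. h x \<Psi>') D"
    let ?D = "{x. dom (h x)}"
    have o: "open ?D" and U: "\<And>i. hol (\<lambda>x. U (h x) $ i) ?D" using hol[of h] h by (auto simp: J_def)
    have nz: "wt k b (U (h x)) \<noteq> 0" if "x \<in> ?D" for x using param[of "h x"] that by simp
    have hs: "hol (\<lambda>x. h x (scoord r)) D" if "chi r = -1" "r k = b" for r D
      using that by (intro h) (auto simp: J_def)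
    have Sr: "hol (\<lambda>x. S (h x) $ r) ?D" for r
    proof (cases "chi r = -1")
      case False then show ?thesis by (simp add: S_def kernel_spinor_def odd_vec_nth hol_const)
    next
      case True
      show ?thesis
      proof (cases "r k = b")
        case True': True
        have "hol (\<lambda>x. csign r * h x (scoord r)) ?D" by (intro hol_mult hol_const hs True True')
        then show ?thesis using True True' by (simp add: S_def kernel_spinor_def odd_vec_nth)
      next
        case False
        have "hol (\<lambda>x. - (\<Sum>l\<in>UNIV - {k}. jw l (flip k r) * wt l (r l) (U (h x)) * (csign (flip l (flip k r)) * h x (scoord (flip l (flip k r))))) / (jw k (flip k r) * wt k b (U (h x)))) ?D"
          by (intro hol_divide hol_minus hol_sum hol_mult hol_const hol_wt U hs) (use True False nz in auto)
        then show ?thesis using True False by (simp add: S_def kernel_spinor_def odd_vec_nth)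
      qed
    qed
    have "hol (\<lambda>x. rsqrt2 * wt k b (bilvec (S (h x)) (S (h x))) / (2 * wt k b (U (h x)))) ?D"
      by (intro hol_divide hol_mult hol_const hol_wt_bilvec hol_wt Sr U) (use nz in auto)
    then show "open ?D \<and> holomorphic_E (\<lambda>x. Z (h x)) ?D"
      using o U Sr by (simp add: holomorphic_E_def Z_def)
  next
    fix f assume "dom f"
    note p = param[OF this]
    have 1: "Z f \<in> plucker_cone" unfolding Z_def
      by (rule vector_cone) (use p in \<open>simp_all add: S_def cliff_kernel_spinor\<close>, simp add: kernel_spinor_def odd_vec_mem)
    have "pairing (Z f) (scoord r) = f (scoord r)" if "chi r = -1" "r k = b" for r
      using that by (simp add: Z_def pairing_coord S_def kernel_spinor_def odd_vec_nth csign_sq)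
    then have 2: "\<forall>\<Psi>'\<in>J. pairing (Z f) \<Psi>' = f \<Psi>'" using p by (auto simp: J_def Z_def pairing_vcoord)
    show "Z f \<in> plucker_cone \<and> pairing (Z f) (vcoord v0) = 1 \<and> Q (fst (Z f)) \<and> (\<forall>\<Psi>'\<in>J. pairing (Z f) \<Psi>' = f \<Psi>')"
      using 1 2 p by (simp add: Z_def pairing_vcoord)
  next
    fix z f assume z: "z \<in> plucker_cone" "pairing z (vcoord v0) = 1" "Q (fst z)" and f: "\<And>\<Psi>'. \<Psi>' \<in> J \<Longrightarrow> f \<Psi>' = pairing z \<Psi>'"
    obtain u \<phi> t where z': "z = (u, \<phi>, t)" by (cases z)
    have c: "\<phi> \<in> \<Delta>\<^sub>m" "cliff u \<phi> = 0" "scalar_product u u = 0" using z(1) by (auto simp: z' plucker_cone_iff)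
    have "dom f \<and> U f = u"
    proof (rule unique)
      fix v assume "v \<in> JV"
      then have "vcoord v \<in> J" by (simp add: J_def)
      from f[OF this] show "f (vcoord v) = scalar_product u v" by (simp add: z' pairing_vcoord)
    qed (use c z in \<open>auto simp: z' pairing_vcoord\<close>)
    then have d: "dom f" "U f = u" by auto
    have nz: "wt k b u \<noteq> 0" using param[OF d(1)] d(2) by simp
    have "S f = \<phi>" unfolding S_def d(2)
    proof (rule kernel_spinor_unique[OF c(1,2) nz])
      fix r assume "chi r = -1" "r k = b"
      then have "scoord r \<in> J" by (simp add: J_def)
      from f[OF this] show "csign r * f (scoord r) = \<phi> $ r" by (simp add: z' pairing_coord csign_sq)
    qed
    then show "dom f \<and> Z f = z" using d vector_cone_t[OF z(1)[unfolded z'] nz] by (simp add: Z_def z')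
  qed
qed

lemma scalar_product_self_wt: "scalar_product u u = (\<Sum>k\<in>UNIV. wt k True u * wt k False u)"
  unfolding scalar_product_wt by (rule sum.cong) (simp_all add: mult.commute)

text \<open>
  In weight coordinates the quadric is \<open>\<Sum>\<^sub>l u\<^sub>l\<^sup>+ u\<^sub>l\<^sup>- = 0\<close>, which is linear in the
  coordinate opposite to the one that is normalised to 1.
\<close>

lemma weight_chart_vector: "plucker_solvable weight_basis (vcoord (wvec k b)) (chart (vcoord (wvec k b)))"
proof -
  define JV where "JV = (\<lambda>(l, c). wvec l c) ` ((UNIV - {k}) \<times> UNIV)"
  define F where "F f l c = (if l \<noteq> k then f (vcoord (wvec l c)) else if c = b then 1
     else - (\<Sum>l\<in>UNIV - {k}. f (vcoord (wvec l True)) * f (vcoord (wvec l False))))" for f :: "E \<Rightarrow> complex" and l c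
  have "plucker_solvable weight_basis (vcoord (wvec k b)) (chart_part (vcoord (wvec k b)) (\<lambda>z. True))"
  proof (rule plucker_solvable_vector[where JV = JV and k = k and b = b and dom = "\<lambda>f. True" and U = "\<lambda>f. of_wt (F f)" and Q = "\<lambda>u. True"])
    show "vcoord ` JV \<union> scoord ` {r. chi r = -1 \<and> r k = b} \<subseteq> weight_basis"
    proof -
      have "vcoord ` JV \<subseteq> (\<lambda>(k, b). vcoord (wvec k b)) ` UNIV" unfolding JV_def by (auto simp: image_iff)
      then show ?thesis unfolding weight_basis_eq by blast
    qed
    show "wvec k b \<notin> JV" by (auto simp: JV_def)
    have "card JV = card ((UNIV - {k}) \<times> (UNIV :: bool set))" unfolding JV_def by (rule card_image) (auto simp: inj_on_def)
    then show "card JV = 8" by (simp add: card_cartesian_product card_Diff_singleton)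
  next
    fix h :: "complex ^ 16 \<Rightarrow> E \<Rightarrow> complex"
    assume h: "\<And>v D. v \<in> JV \<Longrightarrow> hol (\<lambda>x. h x (vcoord v)) D"
    have hl: "hol (\<lambda>x. h x (vcoord (wvec l c))) D" if "l \<noteq> k" for l c D
      using that by (intro h) (auto simp: JV_def)
    have "hol (\<lambda>x. F (h x) l c) D" for l c D
      unfolding F_def by (intro hol_if hol_minus hol_sum hol_mult hol_const hl) auto
    then have "hol (\<lambda>x. of_wt (F (h x)) $ i) D" for i D
      unfolding of_wt_def vec_lambda_beta by (intro hol_if hol_divide hol_add hol_diff hol_const) auto
    then show "open {x :: complex ^ 16. True} \<and> (\<forall>i. hol (\<lambda>x. of_wt (F (h x)) $ i) {x. True})" by simp
  next
    fix f
    let ?u = "of_wt (F f)"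
    have "scalar_product ?u ?u = wt k True ?u * wt k False ?u + (\<Sum>l\<in>UNIV - {k}. wt l True ?u * wt l False ?u)"
      unfolding scalar_product_self_wt by (rule sum.remove) simp_all
    also have "(\<Sum>l\<in>UNIV - {k}. wt l True ?u * wt l False ?u) = (\<Sum>l\<in>UNIV - {k}. f (vcoord (wvec l True)) * f (vcoord (wvec l False)))"
      by (rule sum.cong) (auto simp: F_def)
    also have "wt k True ?u * wt k False ?u = wt k b ?u * wt k (\<not> b) ?u" by (cases b) (simp_all add: mult.commute)
    also have "wt k b ?u = 1" by (simp add: F_def)
    also have "wt k (\<not> b) ?u = - (\<Sum>l\<in>UNIV - {k}. f (vcoord (wvec l True)) * f (vcoord (wvec l False)))" by (simp add: F_def)
    finally have "scalar_product ?u ?u = 0" by simp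
    then show "scalar_product ?u ?u = 0 \<and> wt k b ?u \<noteq> 0 \<and> scalar_product ?u (wvec k b) = 1 \<and> True \<and> (\<forall>v\<in>JV. scalar_product ?u v = f (vcoord v))"
      by (auto simp: wvec_scalar_product JV_def F_def)
  next
    fix u f assume u: "scalar_product u u = 0" "scalar_product u (wvec k b) = 1" and f: "\<And>v. v \<in> JV \<Longrightarrow> f (vcoord v) = scalar_product u v"
    have fl: "f (vcoord (wvec l c)) = wt l c u" if "l \<noteq> k" for l c
      using f[of "wvec l c"] that by (auto simp: JV_def wvec_scalar_product)
    have kb: "wt k b u = 1" using u(2) by (simp add: wvec_scalar_product)
    have "(\<Sum>l\<in>UNIV - {k}. f (vcoord (wvec l True)) * f (vcoord (wvec l False))) = (\<Sum>l\<in>UNIV - {k}. wt l True u * wt l False u)"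
      by (rule sum.cong) (auto simp: fl)
    moreover have "wt k True u * wt k False u + (\<Sum>l\<in>UNIV - {k}. wt l True u * wt l False u) = 0"
      using u(1) unfolding scalar_product_self_wt by (subst (asm) sum.remove[of _ k]) simp_all
    moreover have "wt k True u * wt k False u = wt k (\<not> b) u" using kb by (cases b) simp_all
    ultimately have "wt k (\<not> b) u + (\<Sum>l\<in>UNIV - {k}. f (vcoord (wvec l True)) * f (vcoord (wvec l False))) = 0"
      by (simp only:)
    then have "wt k (\<not> b) u = - (\<Sum>l\<in>UNIV - {k}. f (vcoord (wvec l True)) * f (vcoord (wvec l False)))"
      by (simp only: eq_neg_iff_add_eq_0)
    then have kb': "F f k (\<not> b) = wt k (\<not> b) u" unfolding F_def by simp
    have kb1: "F f k b = wt k b u" unfolding F_def using kb by simp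
    have "F f l c = wt l c u" if "l \<noteq> k" for l c
      unfolding F_def using fl that by simp
    then have "F f l c = wt l c u" for l c
      using kb1 kb' by (cases "l = k"; cases "c = b") auto
    then have "F f = (\<lambda>l c. wt l c u)" by blast
    then show "True \<and> of_wt (F f) = u" by (simp only: of_wt_wt)
  qed simp_all
  then show ?thesis by (simp add: chart_part_True)
qed

lemma Re_csqrt_pos_iff: "Re (csqrt z) > 0 \<longleftrightarrow> z \<notin> \<real>\<^sub>\<le>\<^sub>0"
proof
  assume "Re (csqrt z) > 0"
  then show "z \<notin> \<real>\<^sub>\<le>\<^sub>0" by (auto simp: complex_nonpos_Reals_iff cmod_eq_Re)
next
  assume z: "z \<notin> \<real>\<^sub>\<le>\<^sub>0"
  show "Re (csqrt z) > 0"
  proof (rule ccontr)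
    assume "\<not> ?thesis"
    then have "Re (csqrt z) = 0" using Re_csqrt[of z] by linarith
    then have "z = (\<i> * Im (csqrt z))\<^sup>2" by (metis complex_eq add_0 of_real_0 power2_csqrt)
    then have "z = of_real (- (Im (csqrt z))\<^sup>2)" by (simp add: power_mult_distrib)
    then show False using z by (metis nonpos_Reals_of_real_iff neg_le_0_iff_le zero_le_power2)
  qed
qed

text \<open>
  The omitted coordinate \<open>u\<^sub>j\<close> is a square root. The factor \<open>a\<close>, which is the value of \<open>u\<^sub>j\<close> at
  the given point, rotates the picture such that the principal branch applies: on the part of the
  chart under consideration, \<open>u\<^sub>j / (u\<^sub>i a)\<close> has positive real part.
\<close>

lemma std_chart_vector:
  fixes i j :: vidx and a :: complex and b :: bool
  assumes ij: "i \<noteq> j" and a: "a \<noteq> 0" and ik: "fst i = k"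
  defines "Q \<equiv> \<lambda>u :: V. Re (u $ j / (u $ i * a)) > 0 \<and> wt k b u \<noteq> 0"
  shows "plucker_solvable std_basis (vcoord (axis i 1)) (chart_part (vcoord (axis i 1)) (\<lambda>z. Q (fst z)))"
proof -
  let ?L = "UNIV - {i} - {j}"
  define JV where "JV = (\<lambda>l. axis l 1 :: V) ` ?L"
  define R where "R f = (- 1 - (\<Sum>l\<in>?L. (f (vcoord (axis l 1)))\<^sup>2)) / a\<^sup>2" for f :: "E \<Rightarrow> complex"
  define U :: "(E \<Rightarrow> complex) \<Rightarrow> V" where
    "U f = (\<chi> l. if l = i then 1 else if l = j then a * csqrt (R f) else f (vcoord (axis l 1)))" for f
  define dom where "dom f \<longleftrightarrow> R f \<notin> \<real>\<^sub>\<le>\<^sub>0 \<and> wt k b (U f) \<noteq> 0" for f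
  have sq: "scalar_product u u = (u $ i)\<^sup>2 + ((u $ j)\<^sup>2 + (\<Sum>l\<in>?L. (u $ l)\<^sup>2))" for u :: V
  proof -
    have "scalar_product u u = (\<Sum>l\<in>UNIV. (u $ l)\<^sup>2)" by (simp add: scalar_product_def power2_eq_square)
    also have "\<dots> = (u $ i)\<^sup>2 + (\<Sum>l\<in>UNIV - {i}. (u $ l)\<^sup>2)" by (rule sum.remove) simp_all
    also have "(\<Sum>l\<in>UNIV - {i}. (u $ l)\<^sup>2) = (u $ j)\<^sup>2 + (\<Sum>l\<in>?L. (u $ l)\<^sup>2)" by (rule sum.remove) (use ij in simp_all)
    finally show ?thesis .
  qed
  show ?thesis
  proof (rule plucker_solvable_vector[where JV = JV and k = k and b = b and dom = dom and U = U and Q = Q])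
    show "vcoord ` JV \<union> scoord ` {r. chi r = -1 \<and> r k = b} \<subseteq> std_basis"
      unfolding std_basis_eq JV_def by blast
    show "axis i 1 \<notin> JV" by (auto simp: JV_def axis_eq_axis)
    have "card JV = card ?L" unfolding JV_def by (rule card_image) (auto simp: inj_on_def axis_eq_axis)
    also have "\<dots> = card (UNIV :: vidx set) - 2" using ij by (simp add: card_Diff_singleton)
    finally show "card JV = 8" by simp
    show "Q (c *s u)" if "c \<noteq> 0" "Q u" for c u
      using that by (simp add: Q_def wt_linear)
  next
    fix h :: "complex ^ 16 \<Rightarrow> E \<Rightarrow> complex"
    assume h: "\<And>v D. v \<in> JV \<Longrightarrow> hol (\<lambda>x. h x (vcoord v)) D"
    have hl: "hol (\<lambda>x. h x (vcoord (axis l 1))) D" if "l \<in> ?L" for l D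
      using that by (intro h) (auto simp: JV_def)
    have hR: "hol (\<lambda>x. R (h x)) D" for D
      unfolding R_def power2_eq_square by (intro hol_divide hol_diff hol_sum hol_mult hol_const hl) (use a in auto)
    let ?S = "{x. R (h x) \<notin> \<real>\<^sub>\<le>\<^sub>0}"
    have "open ((\<lambda>x. R (h x)) -` (- \<real>\<^sub>\<le>\<^sub>0))"
      using hol_continuous[OF hR, of UNIV] by (intro open_vimage) (simp_all add: open_Compl)
    moreover have "(\<lambda>x. R (h x)) -` (- \<real>\<^sub>\<le>\<^sub>0) = ?S" by auto
    ultimately have S: "open ?S" by simp
    have hU: "hol (\<lambda>x. U (h x) $ l) D" if "D \<subseteq> ?S" for l D
    proof -
      have "hol (\<lambda>x. csqrt (R (h x))) D"
        by (rule hol_compose[OF hR]) (use that in \<open>auto intro: field_differentiable_at_csqrt\<close>)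
      then show ?thesis unfolding U_def vec_lambda_beta by (intro hol_if hol_mult hol_const hl) auto
    qed
    have "open (?S \<inter> (\<lambda>x. wt k b (U (h x))) -` (- {0}))"
      by (intro continuous_open_preimage hol_continuous hol_wt hU S) auto
    moreover have "?S \<inter> (\<lambda>x. wt k b (U (h x))) -` (- {0}) = {x. dom (h x)}" by (auto simp: dom_def)
    ultimately show "open {x. dom (h x)} \<and> (\<forall>i. hol (\<lambda>x. U (h x) $ i) {x. dom (h x)})"
      using hU[of "{x. dom (h x)}"] by (auto simp: dom_def)
  next
    fix f assume d: "dom f"
    have "(\<Sum>l\<in>?L. (U f $ l)\<^sup>2) = (\<Sum>l\<in>?L. (f (vcoord (axis l 1)))\<^sup>2)"
      by (rule sum.cong) (auto simp: U_def)
    moreover have "(U f $ j)\<^sup>2 = a\<^sup>2 * R f" using ij by (simp add: U_def power_mult_distrib)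
    moreover have "U f $ i = 1" by (simp add: U_def)
    ultimately have "scalar_product (U f) (U f) = 0" using a by (simp add: sq R_def)
    moreover have "U f $ j / (U f $ i * a) = csqrt (R f)" using a ij by (simp add: U_def)
    moreover have "\<forall>v\<in>JV. scalar_product (U f) v = f (vcoord v)"
      by (auto simp: JV_def scalar_product_axis U_def)
    ultimately show "scalar_product (U f) (U f) = 0 \<and> wt k b (U f) \<noteq> 0 \<and> scalar_product (U f) (axis i 1) = 1 \<and> Q (U f) \<and>
        (\<forall>v\<in>JV. scalar_product (U f) v = f (vcoord v))"
      using d Re_csqrt_pos_iff[of "R f"] by (simp add: dom_def Q_def scalar_product_axis U_def)
  next
    fix u f assume u: "scalar_product u u = 0" "scalar_product u (axis i 1) = 1" "Q u" and f: "\<And>v. v \<in> JV \<Longrightarrow> f (vcoord v) = scalar_product u v"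
    have fl: "f (vcoord (axis l 1)) = u $ l" if "l \<in> ?L" for l
      using f[of "axis l 1"] that by (auto simp: JV_def scalar_product_axis)
    have ui: "u $ i = 1" using u(2) by (simp add: scalar_product_axis)
    \<comment> \<open>by the choice of the branch, \<open>w\<close> is the principal root of its square\<close>
    define w where "w = u $ j / a"
    have w: "Re w > 0" "u $ j = a * w" using u(3) a by (simp_all add: Q_def ui w_def)
    have "(\<Sum>l\<in>?L. (f (vcoord (axis l 1)))\<^sup>2) = (\<Sum>l\<in>?L. (u $ l)\<^sup>2)" by (rule sum.cong) (simp_all add: fl)
    moreover have "1 + ((u $ j)\<^sup>2 + (\<Sum>l\<in>?L. (u $ l)\<^sup>2)) = 0" using u(1) by (simp add: sq ui)
    moreover have "x = (1 + (x + y)) - 1 - y" for x y :: complex by simp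
    ultimately have eq: "(u $ j)\<^sup>2 = - 1 - (\<Sum>l\<in>?L. (f (vcoord (axis l 1)))\<^sup>2)" by (metis diff_0)
    have R: "R f = w\<^sup>2" unfolding R_def eq[symmetric] using a by (simp add: w(2) power_mult_distrib)
    have cs: "csqrt (R f) = w" unfolding R by (rule csqrt_square) (use w in simp)
    have "U f $ l = u $ l" for l using fl[of l] cs w(2) ui ij by (auto simp: U_def)
    then have U: "U f = u" by (simp add: vec_eq_iff)
    show "dom f \<and> U f = u" using U u(3) w(1) cs Re_csqrt_pos_iff[of "R f"] by (simp add: dom_def Q_def)
  qed
qed

lemma continuous_fst_nth: "continuous_on S (\<lambda>z :: E. fst z $ i)"
  by (intro continuous_on_component continuous_on_fst continuous_on_id)

text \<open>
  Since \<open>u\<^sub>i = 1\<close> and \<open>u \<cdot> u = 0\<close>, another \<open>u\<^sub>j\<close> is nonzero, and so is one of the two weight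
  coordinates in the tensor factor of \<open>i\<close>.
\<close>

lemma std_chart_vector_local:
  assumes p: "p \<in> chart (vcoord (axis i 1)) \<inter> plucker_locus"
  shows "\<exists>W. cp_open W \<and> p \<in> W \<and> W \<subseteq> chart (vcoord (axis i 1)) \<and> plucker_solvable std_basis (vcoord (axis i 1)) W"
proof -
  obtain k c where i: "i = (k, c)" by (cases i)
  obtain z where z: "z \<in> plucker_cone" "pairing z (vcoord (axis i 1)) = 1" "p = proj_point z"
    using p unfolding chart_part_True by (rule chart_part_cone[rotated]) auto
  obtain u \<phi> t where z': "z = (u, \<phi>, t)" by (cases z)
  have ui: "u $ i = 1" using z(2) by (simp add: z' pairing_coord)
  have uu: "(\<Sum>l\<in>UNIV. u $ l * u $ l) = 0" using z(1) by (simp add: z' plucker_cone_iff scalar_product_def)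
  have "\<exists>j. j \<noteq> i \<and> u $ j \<noteq> 0"
  proof (rule ccontr)
    assume "\<not> ?thesis"
    then have "(\<Sum>l\<in>UNIV. u $ l * u $ l) = (\<Sum>l\<in>UNIV. if l = i then 1 else 0)" by (intro sum.cong) (auto simp: ui)
    then show False using uu by simp
  qed
  then obtain j where j: "j \<noteq> i" "u $ j \<noteq> 0" by blast
  have "\<exists>b. wt k b u \<noteq> 0"
  proof (rule ccontr)
    assume "\<not> ?thesis"
    then have 0: "wt k True u = 0" "wt k False u = 0" by blast+
    have "2 * u $ (k, False) = wt k True u + wt k False u" "2 * \<i> * u $ (k, True) = wt k True u - wt k False u"
      by (simp_all add: wt_def)
    then have "u $ (k, c) = 0" using 0 by (cases c) simp_all
    then show False using ui by (simp add: i)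
  qed
  then obtain b where b: "wt k b u \<noteq> 0" by blast
  define Q where "Q u' \<longleftrightarrow> Re (u' $ j / (u' $ i * u $ j)) > 0 \<and> wt k b u' \<noteq> 0" for u' :: V
  let ?\<Psi> = "vcoord (axis i 1)"
  let ?W = "chart_part ?\<Psi> (\<lambda>z. Q (fst z))"
  have "plucker_solvable std_basis ?\<Psi> ?W"
    unfolding Q_def by (rule std_chart_vector) (use j i in auto)
  moreover have "cp_open ?W"
  proof (rule cp_open_chart_part)
    show "Q (fst (cscale c z))" if "c \<noteq> 0" "Q (fst z)" for c z
      using that by (simp add: Q_def wt_linear cscale_fst)
    let ?N = "{z :: E. fst z $ i \<noteq> 0}"
    have N: "open ?N" by (intro open_Collect_neq continuous_fst_nth continuous_on_const)
    have "open (?N \<inter> (\<lambda>z. Re (fst z $ j / (fst z $ i * u $ j))) -` {0<..} \<inter> {z. wt k b (fst z) \<noteq> 0})"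
      using j N by (intro open_Int continuous_open_preimage open_Collect_neq continuous_intros continuous_fst_nth) (auto simp: wt_def intro!: continuous_intros continuous_fst_nth)
    moreover have "?N \<inter> (\<lambda>z. Re (fst z $ j / (fst z $ i * u $ j))) -` {0<..} \<inter> {z. wt k b (fst z) \<noteq> 0} =
       {z. pairing z ?\<Psi> \<noteq> 0 \<and> Q (fst z)}"
      by (auto simp: Q_def pairing_coord)
    ultimately show "open {z. pairing z ?\<Psi> \<noteq> 0 \<and> Q (fst z)}" by simp
  qed
  moreover have "Q u" using j b by (simp add: Q_def ui)
  then have "p \<in> ?W" using chart_part_mem[OF z(1), of ?\<Psi> "\<lambda>z. Q (fst z)"] z(2,3) by (simp add: z')
  moreover have "?W \<subseteq> chart ?\<Psi>" unfolding chart_def chart_part_def by blast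
  ultimately show ?thesis by blast
qed

section \<open>Charts of spinor coordinates\<close>

text \<open>The five indices of the same parity as \<open>q\<close> that differ from it in four bits.\<close>

definition antipode :: "sidx \<Rightarrow> 5 \<Rightarrow> sidx" where "antipode q k = flip k (opp q)"

text \<open>
  The coefficients with which \<open>u\<phi> = 0\<close> expresses the weight coordinate \<open>wt k (\<not> q k) u\<close> by
  the \<open>wt l (q l) u\<close>.
\<close>

definition mix :: "sidx \<Rightarrow> (sidx \<Rightarrow> complex) \<Rightarrow> 5 \<Rightarrow> 5 \<Rightarrow> complex" where
  "mix q g k l = (if l = k then 0 else - (jw l (flip k q) * g (flip l (flip k q))) / (jw k (flip k q) * g q))"

text \<open>
  In the weight coordinate \<open>wt k (q k)\<close> of \<open>(\<phi>e\<phi>)\<close>, the terms that involve neither \<open>q\<close> nor an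
  antipode.
\<close>

definition rest_sum :: "sidx \<Rightarrow> (sidx \<Rightarrow> complex) \<Rightarrow> 5 \<Rightarrow> complex" where
  "rest_sum q g k = (\<Sum>r\<in>{r. r k = q k} - {q} - {antipode q k}. 2 * csign r * jw k (opp r) * g r * g (flip k (opp r)))"

text \<open>The equation \<open>2tu = (\<phi>e\<phi>) / \<surd>2\<close>, solved for the component at the antipode \<open>k\<close>.\<close>

definition antipode_entry :: "sidx \<Rightarrow> (sidx \<Rightarrow> complex) \<Rightarrow> (5 \<Rightarrow> complex) \<Rightarrow> complex \<Rightarrow> 5 \<Rightarrow> complex" where
  "antipode_entry q g \<beta> t k = (2 * t * \<beta> k / rsqrt2 - rest_sum q g k) / (4 * csign q * jw k (opp q) * g q)"

definition completed :: "sidx \<Rightarrow> (sidx \<Rightarrow> complex) \<Rightarrow> (5 \<Rightarrow> complex) \<Rightarrow> complex \<Rightarrow> sidx \<Rightarrow> complex" where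
  "completed q g \<beta> t r = (if r \<in> range (antipode q) then antipode_entry q g \<beta> t (inv_into UNIV (antipode q) r) else g r)"

definition isotropic_vec :: "sidx \<Rightarrow> (sidx \<Rightarrow> complex) \<Rightarrow> (5 \<Rightarrow> complex) \<Rightarrow> V" where
  "isotropic_vec q g \<beta> = of_wt (\<lambda>k c. if c = q k then \<beta> k else \<Sum>l\<in>UNIV. mix q g k l * \<beta> l)"

lemma rsqrt2_nz [simp]: "rsqrt2 \<noteq> 0" by (simp add: rsqrt2_def)

lemma inj_antipode: "inj (antipode q)"
proof (rule injI)
  fix k l assume eq: "antipode q k = antipode q l"
  show "k = l"
  proof (rule ccontr)
    assume "k \<noteq> l"
    then have "antipode q k k \<noteq> antipode q l k" by (simp add: antipode_def)
    then show False using eq by simp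
  qed
qed

lemma chi_antipode [simp]: "chi (antipode q k) = chi q" by (simp add: antipode_def)

lemma antipode_neq: "q \<noteq> antipode q k"
proof -
  obtain l :: 5 where "l \<noteq> k" by (rule flip_other)
  then have "q l \<noteq> antipode q k l" by (simp add: antipode_def)
  then show ?thesis by metis
qed

lemma q_notin: "q \<notin> range (antipode q)" using antipode_neq by blast

text \<open>The index on the left differs from \<open>q\<close> in two bits, an antipode in four.\<close>

lemma flip2_notin: assumes "k \<noteq> l" shows "flip l (flip k q) \<notin> range (antipode q)"
proof
  assume "flip l (flip k q) \<in> range (antipode q)"
  then obtain m where m: "flip l (flip k q) = antipode q m" by blast
  have "card {k, l, m} \<le> 3" by (simp add: card_insert_if)
  moreover have "card (UNIV :: 5 set) = 5" by simp
  ultimately have "card {k, l, m} \<noteq> card (UNIV :: 5 set)" by linarith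
  then have "{k, l, m} \<noteq> UNIV" by metis
  then obtain n where n: "n \<notin> {k, l, m}" by blast
  then have "flip l (flip k q) n = q n" "antipode q m n = (\<not> q n)" by (simp_all add: antipode_def)
  then show False using m by simp
qed

text \<open>So the terms of \<open>rest_sum\<close> do not depend on the components at the antipodes.\<close>

lemma rest_notin:
  assumes "r k = q k" "r \<noteq> q" "r \<noteq> antipode q k"
  shows "r \<notin> range (antipode q)" "flip k (opp r) \<notin> range (antipode q)"
proof -
  have "r \<noteq> antipode q m" for m
  proof (cases "m = k")
    case False then have "antipode q m k \<noteq> r k" using assms(1) by (simp add: antipode_def)
    then show ?thesis by metis
  qed (use assms in simp)
  then show "r \<notin> range (antipode q)" by blast
  have "flip k (opp r) \<noteq> antipode q m" for m
  proof (cases "m = k")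
    case True
    then show ?thesis using assms(2) unfolding antipode_def by (metis flip_simps(3) opp_simps(2))
  next
    case False then have "antipode q m k \<noteq> flip k (opp r) k" using assms(1) by (simp add: antipode_def)
    then show ?thesis by metis
  qed
  then show "flip k (opp r) \<notin> range (antipode q)" by blast
qed

lemma mix_cong: "(\<And>r. r \<notin> range (antipode q) \<Longrightarrow> g r = g' r) \<Longrightarrow> mix q g = mix q g'"
  by (intro ext) (simp add: mix_def flip2_notin q_notin)

lemma rest_sum_cong: "(\<And>r. r \<notin> range (antipode q) \<Longrightarrow> g r = g' r) \<Longrightarrow> rest_sum q g k = rest_sum q g' k"
  unfolding rest_sum_def
proof (rule sum.cong[OF refl])
  fix r assume g: "\<And>r. r \<notin> range (antipode q) \<Longrightarrow> g r = g' r" and "r \<in> {r. r k = q k} - {q} - {antipode q k}"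
  then have r: "r k = q k" "r \<noteq> q" "r \<noteq> antipode q k" by auto
  show "2 * csign r * jw k (opp r) * g r * g (flip k (opp r)) = 2 * csign r * jw k (opp r) * g' r * g' (flip k (opp r))"
    by (simp only: g[OF rest_notin(1)[OF r]] g[OF rest_notin(2)[OF r]])
qed

lemma antipode_entry_cong: "(\<And>r. r \<notin> range (antipode q) \<Longrightarrow> g r = g' r) \<Longrightarrow> antipode_entry q g \<beta> t k = antipode_entry q g' \<beta> t k"
  using rest_sum_cong[of q g g' k] by (simp add: antipode_entry_def q_notin)

text \<open>The index \<open>q\<close> and its antipode contribute the same term.\<close>

lemma wt_bilvec_split:
  "wt k (q k) (bilvec \<phi> \<phi>) = 4 * csign q * jw k (opp q) * \<phi> $ q * \<phi> $ antipode q k + rest_sum q (\<lambda>r. \<phi> $ r) k"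
proof -
  let ?f = "\<lambda>r. 2 * csign r * jw k (opp r) * \<phi> $ r * \<phi> $ flip k (opp r)"
  have 1: "(\<Sum>r | r k = q k. ?f r) = ?f q + (\<Sum>r\<in>{r. r k = q k} - {q}. ?f r)"
    by (rule sum.remove) simp_all
  have 2: "(\<Sum>r\<in>{r. r k = q k} - {q}. ?f r) = ?f (antipode q k) + (\<Sum>r\<in>{r. r k = q k} - {q} - {antipode q k}. ?f r)"
    by (rule sum.remove) (use antipode_neq[of q k] in \<open>simp_all add: antipode_def\<close>)
  have "csign (flip k (opp q)) = csign (flip k q)" by (simp add: csign_flip)
  then have 3: "?f (antipode q k) = ?f q"
    using csign_jw[of q k] by (simp add: antipode_def)
  show ?thesis unfolding wt_bilvec 1 2 3 by (simp add: rest_sum_def antipode_def)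
qed

text \<open>This is the component of \<open>u\<phi> = 0\<close> at the index with bit \<open>k\<close> of \<open>q\<close> flipped.\<close>

lemma spinor_cone_mix:
  assumes z: "cliff u \<phi> = 0" and nz: "\<phi> $ q \<noteq> 0"
  shows "wt k (\<not> q k) u = (\<Sum>l\<in>UNIV. mix q (\<lambda>r. \<phi> $ r) k l * wt l (q l) u)"
proof -
  let ?r = "flip k q"
  have "cliff u \<phi> $ ?r = 0" by (simp add: z)
  then have "jw k ?r * wt k (\<not> q k) u * \<phi> $ q + (\<Sum>l\<in>UNIV - {k}. jw l ?r * wt l (?r l) u * \<phi> $ flip l ?r) = 0"
    by (simp add: cliff_apply_split[of u \<phi> ?r k])
  then have "(jw k ?r * \<phi> $ q) * wt k (\<not> q k) u = - (\<Sum>l\<in>UNIV - {k}. jw l ?r * wt l (?r l) u * \<phi> $ flip l ?r)"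
    by (simp only: eq_neg_iff_add_eq_0 mult_ac)
  then have "wt k (\<not> q k) u = - (\<Sum>l\<in>UNIV - {k}. jw l ?r * wt l (?r l) u * \<phi> $ flip l ?r) / (jw k ?r * \<phi> $ q)"
    using nz by (metis jw_nz mult_eq_0_iff nonzero_mult_div_cancel_left)
  also have "\<dots> = (\<Sum>l\<in>UNIV - {k}. mix q (\<lambda>r. \<phi> $ r) k l * wt l (q l) u)"
    unfolding sum_negf[symmetric] sum_divide_distrib by (rule sum.cong) (simp_all add: mix_def)
  also have "\<dots> = (\<Sum>l\<in>UNIV. mix q (\<lambda>r. \<phi> $ r) k l * wt l (q l) u)"
    by (rule sum.mono_neutral_left) (auto simp: mix_def)
  finally show ?thesis .
qed

lemma spinor_cone_antipode:
  assumes z: "(u, \<phi>, t) \<in> plucker_cone" and nz: "\<phi> $ q \<noteq> 0"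
  shows "\<phi> $ antipode q k = antipode_entry q (\<lambda>r. \<phi> $ r) (\<lambda>l. wt l (q l) u) t k"
proof -
  have "wt k (q k) ((2 * t) *s u) = wt k (q k) (rsqrt2 *s bilvec \<phi> \<phi>)" using z by (simp add: plucker_cone_iff)
  then have "2 * t * wt k (q k) u / rsqrt2 = 4 * csign q * jw k (opp q) * \<phi> $ q * \<phi> $ antipode q k + rest_sum q (\<lambda>r. \<phi> $ r) k"
    by (simp add: wt_linear wt_bilvec_split)
  then show ?thesis using nz by (simp add: antipode_entry_def)
qed

lemma completed_off: "r \<notin> range (antipode q) \<Longrightarrow> completed q g \<beta> t r = g r"
  by (simp add: completed_def)

lemma completed_antipode: "completed q g \<beta> t (antipode q k) = antipode_entry q g \<beta> t k"
  by (simp add: completed_def inv_f_f[OF inj_antipode])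

lemma odd_vec_completed_off:
  assumes g: "\<And>r. chi r = 1 \<Longrightarrow> g r = 0" and r: "r \<notin> range (antipode q)"
  shows "odd_vec (completed q g \<beta> t) $ r = g r"
  using g r chi_cases[of r] by (auto simp: odd_vec_nth completed_off)

lemma spinor_cone_unique:
  assumes z: "(u, \<phi>, t) \<in> plucker_cone" and nz: "\<phi> $ q \<noteq> 0" and g: "\<And>r. r \<notin> range (antipode q) \<Longrightarrow> g r = \<phi> $ r"
    and \<beta>: "\<And>k. \<beta> k = wt k (q k) u"
  shows "isotropic_vec q g \<beta> = u" "odd_vec (completed q g \<beta> t) = \<phi>"
proof -
  have c: "cliff u \<phi> = 0" "\<phi> \<in> \<Delta>\<^sub>m" using z by (simp_all add: plucker_cone_iff)
  have \<beta>': "\<beta> = (\<lambda>k. wt k (q k) u)" using \<beta> by blast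
  have m: "mix q g = mix q (\<lambda>r. \<phi> $ r)" by (rule mix_cong) (rule g)
  show "isotropic_vec q g \<beta> = u"
  proof (rule wt_eqI)
    fix k b show "wt k b (isotropic_vec q g \<beta>) = wt k b u"
    proof (cases "b = q k")
      case True then show ?thesis by (simp add: isotropic_vec_def \<beta>)
    next
      case False
      then have "b = (\<not> q k)" by blast
      then show ?thesis using spinor_cone_mix[OF c(1) nz, of k] by (simp add: isotropic_vec_def \<beta>' m)
    qed
  qed
  show "odd_vec (completed q g \<beta> t) = \<phi>"
  proof (rule odd_vec_eqI[OF c(2)])
    fix r
    show "completed q g \<beta> t r = \<phi> $ r"
    proof (cases "r \<in> range (antipode q)")
      case True
      then obtain k where k: "r = antipode q k" by blast
      have "antipode_entry q g \<beta> t k = antipode_entry q (\<lambda>r. \<phi> $ r) \<beta> t k" by (rule antipode_entry_cong) (rule g)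
      then show ?thesis unfolding k completed_antipode spinor_cone_antipode[OF z nz] by (simp add: \<beta>')
    qed (simp add: completed_off g)
  qed
qed

text \<open>
  If \<open>t \<noteq> 0\<close>, the spinor with the prescribed components, completed at the antipodes, belongs to
  a point of the big cell. Its weight coordinates \<open>wt k (q k)\<close> are \<open>\<beta>\<close> by the choice of the
  components at the antipodes, and the other ones are then forced, so the point is the given one.
  The spinor is an affine function \<open>A + t B\<close> of \<open>t\<close>, while \<open>u\<close> is independent of \<open>t\<close>. The
  equations are polynomial in \<open>t\<close>, and their values at \<open>t = \<plusminus> 1\<close> and \<open>t = \<plusminus> 2\<close> suffice to
  deduce those at \<open>t = 0\<close>.
\<close>

lemma spinor_cone:
  assumes q: "chi q = -1" and even: "\<And>r. chi r = 1 \<Longrightarrow> g r = 0" and nz: "g q \<noteq> 0"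
  shows "(isotropic_vec q g \<beta>, odd_vec (completed q g \<beta> t), t) \<in> plucker_cone"
proof -
  let ?u = "isotropic_vec q g \<beta>" and ?\<phi> = "\<lambda>t. odd_vec (completed q g \<beta> t)"
  have off: "?\<phi> t $ r = g r" if "r \<notin> range (antipode q)" for t r
    by (rule odd_vec_completed_off[OF even that])
  have \<phi>q: "?\<phi> t $ q = g q" for t by (rule off[OF q_notin])
  have generic: "(?u, ?\<phi> t, t) \<in> plucker_cone" if t: "t \<noteq> 0" for t
  proof -
    let ?u' = "(rsqrt2 / (2 * t)) *s bilvec (?\<phi> t) (?\<phi> t)"
    have z: "(?u', ?\<phi> t, t) \<in> plucker_cone" by (rule big_cell_cone[OF odd_vec_mem t])
    have "wt k (q k) ?u' = \<beta> k" for k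
    proof -
      have r: "rest_sum q (\<lambda>r. ?\<phi> t $ r) k = rest_sum q g k" by (rule rest_sum_cong) (rule off)
      have d: "?\<phi> t $ antipode q k = antipode_entry q g \<beta> t k" by (simp add: odd_vec_nth q completed_antipode)
      have nz': "4 * csign q * jw k (opp q) * g q \<noteq> 0" using nz by simp
      have "wt k (q k) (bilvec (?\<phi> t) (?\<phi> t)) = 2 * t * \<beta> k / rsqrt2"
        unfolding wt_bilvec_split \<phi>q d r antipode_entry_def using nz' by simp
      then show ?thesis using t by (simp add: wt_linear)
    qed
    then have "?u = ?u'" by (intro spinor_cone_unique(1)[OF z]) (simp_all add: \<phi>q nz off)
    then show ?thesis using z by simp
  qed
  show ?thesis
  proof (cases "t = 0")
    case False then show ?thesis by (rule generic)
  next
    case True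
    \<comment> \<open>the part of the spinor that is linear in \<open>t\<close>\<close>
    define B where "B = odd_vec (\<lambda>r. if r \<in> range (antipode q) then (2 * \<beta> (inv_into UNIV (antipode q) r) / rsqrt2) / (4 * csign q * jw (inv_into UNIV (antipode q) r) (opp q) * g q) else 0)"
    let ?A = "?\<phi> 0"
    have AB: "?\<phi> t = ?A + t *s B" for t
      by (simp add: vec_eq_iff odd_vec_nth B_def completed_def antipode_entry_def diff_divide_distrib)
    have eqs: "(2 * t) *s ?u = rsqrt2 *s (bilvec ?A ?A + (2 * t) *s bilvec ?A B + (t * t) *s bilvec B B) \<and>
       cliff ?u ?A + t *s cliff ?u B = 0 \<and> scalar_product ?u ?u = 0" if "t \<noteq> 0" for t
    proof -
      have "bilvec (?A + t *s B) (?A + t *s B) = bilvec ?A ?A + (2 * t) *s bilvec ?A B + (t * t) *s bilvec B B"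
        by (simp add: bilvec_linear bilvec_sym[of B ?A] vec_eq_iff algebra_simps)
      then show ?thesis using generic[OF that] unfolding AB[of t] by (simp add: plucker_cone_iff cliff_linear)
    qed
    have "cliff ?u ?A $ r = 0" for r
    proof -
      have "cliff ?u ?A $ r + cliff ?u B $ r = 0" "cliff ?u ?A $ r - cliff ?u B $ r = 0"
        using eqs[of 1] eqs[of "-1"] by (simp_all add: vec_eq_iff)
      then show ?thesis by (simp add: eq_minus_self_iff add_eq_0_iff)
    qed
    then have 1: "cliff ?u ?A = 0" by (simp add: vec_eq_iff)
    have "bilvec ?A ?A $ i = 0" for i
    proof -
      define a b c w where "a = bilvec ?A ?A $ i" and "b = bilvec ?A B $ i" and "c = bilvec B B $ i" and "w = ?u $ i"
      have e: "2 * t * w = rsqrt2 * (a + 2 * t * b + t * t * c)" if "t \<noteq> 0" for t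
        using arg_cong[OF conjunct1[OF eqs[OF that]], of "\<lambda>v. v $ i"] by (simp add: a_def b_def c_def w_def distrib_left mult.assoc)
      \<comment> \<open>adding the equations at \<open>t\<close> and \<open>- t\<close> eliminates \<open>b\<close> and \<open>w\<close>\<close>
      have "rsqrt2 * (2 * a + 2 * c) = 0" using e[of 1] e[of "-1"] by (simp add: algebra_simps)
      moreover have "rsqrt2 * (2 * a + 8 * c) = 0" using e[of 2] e[of "-2"] by (simp add: algebra_simps)
      ultimately have "2 * a + 2 * c = 0" "2 * a + 8 * c = 0" by simp_all
      then have "6 * a = 0" by algebra
      then show ?thesis by (simp add: a_def)
    qed
    then have 2: "bilvec ?A ?A = 0" by (simp add: vec_eq_iff)
    have "?A \<noteq> 0" using \<phi>q[of 0] nz by auto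
    then show ?thesis using True 1 2 eqs[of 1] by (simp add: plucker_cone_iff odd_vec_mem zero_prod_def)
  qed
qed

text \<open>
  The matrix that takes the weight coordinates \<open>\<beta>\<^sub>k = wt k (q k) u\<close> to
  \<open>\<beta>\<^sub>k + \<epsilon>\<^sub>k wt k (\<not> q k) u\<close>. Up to a factor, the latter is an orthonormal coordinate for
  \<open>\<epsilon>\<^sub>k = \<plusminus> 1\<close> and a weight coordinate for \<open>\<epsilon>\<^sub>k = 0\<close>.
\<close>

definition mixmat :: "sidx \<Rightarrow> (5 \<Rightarrow> complex) \<Rightarrow> (sidx \<Rightarrow> complex) \<Rightarrow> complex ^ 5 ^ 5" where
  "mixmat q \<epsilon> g = (\<chi> k l. (if k = l then 1 else 0) + \<epsilon> k * mix q g k l)"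

lemma mixmat_apply: "(mixmat q \<epsilon> g *v \<beta>) $ k = \<beta> $ k + \<epsilon> k * (\<Sum>l\<in>UNIV. mix q g k l * \<beta> $ l)"
proof -
  have "(\<Sum>l\<in>UNIV. (if k = l then 1 else 0) * \<beta> $ l) = (\<Sum>l\<in>UNIV. if l = k then \<beta> $ k else 0)"
    by (rule sum.cong) auto
  then show ?thesis
    by (simp add: mixmat_def matrix_vector_mult_def distrib_right sum.distrib sum_distrib_left mult.assoc)
qed

text \<open>
  Replace the rows of the identity matrix one after the other. By linearity in a row, the
  determinants for the two signs add up to twice the previous one.
\<close>

lemma exists_signs_det_nonzero:
  fixes A :: "complex ^ 'n ^ 'n"
  shows "\<exists>\<epsilon>. (\<forall>k. \<epsilon> k \<in> {1, -1}) \<and> det (\<chi> k l. (if k = l then 1 else 0) + \<epsilon> k * A $ k $ l) \<noteq> 0"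
proof -
  define row where "row \<epsilon> K k = (if k \<in> K then axis k 1 + \<epsilon> k *s A $ k else axis k 1)" for \<epsilon> :: "'n \<Rightarrow> complex" and K :: "'n set" and k
  have "\<exists>\<epsilon>. (\<forall>k. \<epsilon> k \<in> {1, -1}) \<and> det (\<chi> k. row \<epsilon> K k) \<noteq> 0" if "finite K" for K
    using that
  proof induct
    case empty
    have "(\<chi> k. row (\<lambda>_. 1) {} k) = mat 1" by (auto simp: row_def mat_def vec_eq_iff axis_def)
    then have "det (\<chi> k. row (\<lambda>_. 1) {} k) \<noteq> 0" by simp
    then show ?case by (intro exI[of _ "\<lambda>_. 1"]) simp
  next
    case (insert m K)
    then obtain \<epsilon> where \<epsilon>: "\<forall>k. \<epsilon> k \<in> {1, -1}" "det (\<chi> k. row \<epsilon> K k) \<noteq> 0" by blast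
    let ?e = "\<lambda>s. \<epsilon>(m := s)"
    have r: "(\<chi> k. row (?e s) (insert m K) k) = (\<chi> k. if k = m then axis m 1 + s *s A $ m else row \<epsilon> K k)" for s
      using insert(2) by (auto simp: row_def vec_eq_iff)
    have r0: "(\<chi> k. row \<epsilon> K k) = (\<chi> k. if k = m then axis m 1 else row \<epsilon> K k)"
      using insert(2) by (auto simp: row_def vec_eq_iff)
    have "det (\<chi> k. row (?e s) (insert m K) k) = det (\<chi> k. row \<epsilon> K k) + s * det (\<chi> k. if k = m then A $ m else row \<epsilon> K k)" for s
      unfolding r r0 det_row_add det_row_mul by simp
    then have "det (\<chi> k. row (?e 1) (insert m K) k) + det (\<chi> k. row (?e (-1)) (insert m K) k) = 2 * det (\<chi> k. row \<epsilon> K k)"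
      by simp
    then have "det (\<chi> k. row (?e 1) (insert m K) k) \<noteq> 0 \<or> det (\<chi> k. row (?e (-1)) (insert m K) k) \<noteq> 0"
      using \<epsilon>(2) by auto
    then obtain s where s: "s \<in> {1, -1}" "det (\<chi> k. row (?e s) (insert m K) k) \<noteq> 0" by blast
    have "\<forall>k. ?e s k \<in> {1, -1}" using \<epsilon>(1) s(1) by auto
    then show ?case using s(2) by blast
  qed
  from this[OF finite] obtain \<epsilon> where \<epsilon>: "\<forall>k. \<epsilon> k \<in> {1, -1}" "det (\<chi> k. row \<epsilon> UNIV k) \<noteq> 0" by blast
  have "(\<chi> k. row \<epsilon> UNIV k) = (\<chi> k l. (if k = l then 1 else 0) + \<epsilon> k * A $ k $ l)"
    by (auto simp: row_def vec_eq_iff axis_def)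
  with \<epsilon>(2) have "det (\<chi> k l. (if k = l then 1 else 0) + \<epsilon> k * A $ k $ l) \<noteq> 0" by (simp only:) simp
  with \<epsilon>(1) show ?thesis by blast
qed

lemma hol_mix:
  assumes "\<And>r. hol (\<lambda>x. g x r) D" "\<And>x. x \<in> D \<Longrightarrow> g x q \<noteq> 0"
  shows "hol (\<lambda>x. mix q (g x) k l) D"
  unfolding mix_def by (intro hol_if hol_divide hol_minus hol_mult hol_const assms(1)) (use assms(2) in auto)

text \<open>
  Treats both bases at once. The five vectors \<open>vv k\<close> give the coordinates of \<open>u\<close>, and Cramer's
  rule recovers \<open>\<beta>\<close> from them where the determinant does not vanish.
\<close>

lemma plucker_solvable_spinor:
  fixes vv :: "5 \<Rightarrow> V" and \<epsilon> \<gamma> :: "5 \<Rightarrow> complex"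
  assumes q: "chi q = -1" and inj: "inj vv" and \<gamma>: "\<And>k. \<gamma> k \<noteq> 0"
    and B: "insert tcoord (range (\<lambda>k. vcoord (vv k)) \<union> scoord ` {r. chi r = -1}) \<subseteq> B"
    and vv: "\<And>u k. scalar_product u (vv k) = \<gamma> k * (wt k (q k) u + \<epsilon> k * wt k (\<not> q k) u)"
  shows "plucker_solvable B (scoord q) (chart_part (scoord q) (\<lambda>z. det (mixmat q \<epsilon> (\<lambda>r. fst (snd z) $ r)) \<noteq> 0))"
proof -
  define Fr where "Fr = {r. chi r = -1} - {q} - range (antipode q)"
  define J where "J = insert tcoord (range (\<lambda>k. vcoord (vv k)) \<union> scoord ` Fr)"
  define g where "g f r = (if r = q then csign q else if r \<in> Fr then csign r * f (scoord r) else 0)" for f :: "E \<Rightarrow> complex" and r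
  define N where "N f = mixmat q \<epsilon> (g f)" for f :: "E \<Rightarrow> complex"
  define b where "b f k = f (vcoord (vv k)) / \<gamma> k" for f :: "E \<Rightarrow> complex" and k
  define \<beta> where "\<beta> f k = det (\<chi> i j. if j = k then b f i else N f $ i $ j) / det (N f)" for f :: "E \<Rightarrow> complex" and k
  define dom where "dom f \<longleftrightarrow> det (N f) \<noteq> 0" for f
  define Z where "Z f = (isotropic_vec q (g f) (\<beta> f), odd_vec (completed q (g f) (\<beta> f) (f tcoord)), f tcoord)" for f
  have gq: "g f q = csign q" for f by (simp add: g_def)
  have geven: "g f r = 0" if "chi r = 1" for f r using that q by (auto simp: g_def Fr_def eq_minus_self_iff)
  have cramer: "N f *v v = (\<chi> i. b f i) \<longleftrightarrow> v = (\<chi> k. \<beta> f k)" if "dom f" for f v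
    using cramer[of "N f" v "\<chi> i. b f i"] that by (simp add: dom_def \<beta>_def cong: if_cong)
  show ?thesis
  proof (rule plucker_solvableI[where J = J and dom = dom and Z = Z])
    show "J \<subseteq> B - {scoord q}" using B unfolding J_def Fr_def by auto
    have "card (scoord ` Fr) = 10"
    proof -
      have "card (range (antipode q)) = 5" by (simp add: card_image inj_antipode)
      moreover have "range (antipode q) \<subseteq> {r. chi r = -1} - {q}" using q antipode_neq[THEN not_sym] by auto
      moreover have "card ({r. chi r = -1} - {q}) = 15" using q by (simp add: card_Diff_singleton card_odd_all)
      ultimately have "card Fr = 10" unfolding Fr_def by (simp add: card_Diff_subset)
      then show ?thesis by (simp add: card_image inj_scoord)
    qed
    moreover have "card (range (\<lambda>k. vcoord (vv k))) = 5"
      by (subst card_image) (use inj in \<open>auto simp: inj_def\<close>)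
    moreover have "card (range (\<lambda>k. vcoord (vv k)) \<union> scoord ` Fr) = card (range (\<lambda>k. vcoord (vv k))) + card (scoord ` Fr)"
      by (rule card_Un_disjoint) auto
    ultimately show "card J = 16" unfolding J_def by (subst card_insert_disjoint) auto
    show "det (mixmat q \<epsilon> (\<lambda>r. fst (snd (cscale c z)) $ r)) \<noteq> 0"
      if "c \<noteq> 0" "det (mixmat q \<epsilon> (\<lambda>r. fst (snd z) $ r)) \<noteq> 0" for c z
    proof -
      have "mix q (\<lambda>r. fst (snd (cscale c z)) $ r) = mix q (\<lambda>r. fst (snd z) $ r)"
        using that(1) by (simp add: fun_eq_iff mix_def cscale_def case_prod_beta)
      then show ?thesis using that(2) by (simp add: mixmat_def)
    qed
  next
    fix h :: "complex ^ 16 \<Rightarrow> E \<Rightarrow> complex"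
    assume h: "\<And>\<Psi>' D. \<Psi>' \<in> J \<Longrightarrow> hol (\<lambda>x. h x \<Psi>') D"
    have hg: "hol (\<lambda>x. g (h x) r) D" for r D
      unfolding g_def by (intro hol_if hol_mult hol_const h) (auto simp: J_def)
    have hm: "hol (\<lambda>x. mix q (g (h x)) k l) D" for k l D
      by (rule hol_mix[OF hg]) (simp add: gq)
    have hN: "hol (\<lambda>x. N (h x) $ i $ j) D" for i j D
      unfolding N_def mixmat_def vec_lambda_beta by (intro hol_add hol_mult hol_const hm)
    have hdet: "hol (\<lambda>x. det (N (h x))) D" for D by (rule hol_det[OF hN])
    have hb: "hol (\<lambda>x. b (h x) i) D" for i D
      unfolding b_def by (intro hol_divide hol_const h) (auto simp: J_def \<gamma>)
    have "open ((\<lambda>x. det (N (h x))) -` (- {0}))"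
      using hol_continuous[OF hdet, of UNIV] by (intro open_vimage) auto
    moreover have "(\<lambda>x. det (N (h x))) -` (- {0}) = {x. dom (h x)}" by (auto simp: dom_def)
    ultimately have o: "open {x. dom (h x)}" by simp
    let ?D = "{x. dom (h x)}"
    have hnum: "hol (\<lambda>x. det (\<chi> i j. if j = k then b (h x) i else N (h x) $ i $ j)) ?D" for k
      by (rule hol_det) (simp only: vec_lambda_beta, intro hol_if hb hN)
    have h\<beta>: "hol (\<lambda>x. \<beta> (h x) k) ?D" for k
      unfolding \<beta>_def by (intro hol_divide hnum hdet) (simp add: dom_def)
    have hu: "hol (\<lambda>x. isotropic_vec q (g (h x)) (\<beta> (h x)) $ i) ?D" for i
      unfolding isotropic_vec_def of_wt_def vec_lambda_beta
      by (intro hol_if hol_divide hol_add hol_diff hol_sum hol_mult hol_const hm h\<beta>) auto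
    have ht: "hol (\<lambda>x. h x tcoord) D" for D by (intro h) (simp add: J_def)
    have hr: "hol (\<lambda>x. rest_sum q (g (h x)) k) D" for k D
      unfolding rest_sum_def by (intro hol_sum hol_mult hol_const hg)
    have hd: "hol (\<lambda>x. antipode_entry q (g (h x)) (\<beta> (h x)) (h x tcoord) k) ?D" for k
      unfolding antipode_entry_def gq by (intro hol_divide hol_diff hol_mult hol_const h\<beta> ht hr) auto
    have hp: "hol (\<lambda>x. odd_vec (completed q (g (h x)) (\<beta> (h x)) (h x tcoord)) $ r) ?D" for r
      unfolding odd_vec_nth completed_def by (intro hol_if hol_const hd hg)
    show "open ?D \<and> holomorphic_E (\<lambda>x. Z (h x)) ?D"
      using o hu hp ht by (simp add: holomorphic_E_def Z_def)
  next
    fix f assume d: "dom f"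
    let ?u = "isotropic_vec q (g f) (\<beta> f)" and ?\<phi> = "odd_vec (completed q (g f) (\<beta> f) (f tcoord))"
    have plucker_cone: "Z f \<in> plucker_cone" unfolding Z_def by (rule spinor_cone[OF q geven]) (simp_all add: gq)
    have off: "?\<phi> $ r = g f r" if "r \<notin> range (antipode q)" for r
      by (rule odd_vec_completed_off[OF geven that])
    have "pairing (Z f) (scoord q) = 1"
      using csign_sq[of q 1] by (simp add: Z_def pairing_coord off[OF q_notin] gq)
    moreover have "mix q (\<lambda>r. ?\<phi> $ r) = mix q (g f)" by (rule mix_cong) (rule off)
    then have "det (mixmat q \<epsilon> (\<lambda>r. fst (snd (Z f)) $ r)) \<noteq> 0"
      using d by (simp add: Z_def mixmat_def dom_def N_def)
    moreover have "pairing (Z f) \<Psi>' = f \<Psi>'" if "\<Psi>' \<in> J" for \<Psi>'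
    proof -
      consider "\<Psi>' = tcoord" | k where "\<Psi>' = vcoord (vv k)" | r where "\<Psi>' = scoord r" "r \<in> Fr" using \<open>\<Psi>' \<in> J\<close> unfolding J_def by blast
      then show ?thesis
      proof cases
        case 1 then show ?thesis by (simp add: Z_def pairing_coord)
      next
        case 2
        have "N f *v (\<chi> k. \<beta> f k) = (\<chi> i. b f i)" using cramer[OF d] by blast
        then have "(N f *v (\<chi> k. \<beta> f k)) $ k = b f k" by simp
        then have "\<beta> f k + \<epsilon> k * (\<Sum>l\<in>UNIV. mix q (g f) k l * \<beta> f l) = b f k" by (simp add: N_def mixmat_apply)
        then have "scalar_product ?u (vv k) = f (vcoord (vv k))"
          using \<gamma>[of k] by (simp add: vv isotropic_vec_def b_def)
        then show ?thesis by (simp add: 2 Z_def pairing_vcoord)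
      next
        case 3
        then have "r \<notin> range (antipode q)" "r \<noteq> q" unfolding Fr_def by auto
        then show ?thesis using 3 by (simp add: Z_def pairing_coord off g_def csign_sq)
      qed
    qed
    ultimately show "Z f \<in> plucker_cone \<and> pairing (Z f) (scoord q) = 1 \<and> det (mixmat q \<epsilon> (\<lambda>r. fst (snd (Z f)) $ r)) \<noteq> 0 \<and>
        (\<forall>\<Psi>'\<in>J. pairing (Z f) \<Psi>' = f \<Psi>')" using plucker_cone by blast
  next
    fix z f assume z: "z \<in> plucker_cone" "pairing z (scoord q) = 1" "det (mixmat q \<epsilon> (\<lambda>r. fst (snd z) $ r)) \<noteq> 0"
      and f: "\<And>\<Psi>'. \<Psi>' \<in> J \<Longrightarrow> f \<Psi>' = pairing z \<Psi>'"
    obtain u \<phi> t where z': "z = (u, \<phi>, t)" by (cases z)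
    have \<phi>: "\<phi> \<in> \<Delta>\<^sub>m" "cliff u \<phi> = 0" using z(1) by (simp_all add: z' plucker_cone_iff)
    have \<phi>q: "\<phi> $ q = csign q" using z(2) csign_sq[of q "\<phi> $ q"] by (simp add: z' pairing_coord)
    have nz: "\<phi> $ q \<noteq> 0" by (simp add: \<phi>q)
    have g: "g f r = \<phi> $ r" if "r \<notin> range (antipode q)" for r
    proof (cases "r \<in> Fr")
      case True
      then have "scoord r \<in> J" "r \<noteq> q" by (auto simp: J_def Fr_def)
      then show ?thesis using True f[of "scoord r"] by (simp add: g_def z' pairing_coord csign_sq)
    next
      case False
      then have "r = q \<or> chi r = 1" using that chi_cases[of r] by (auto simp: Fr_def)
      then show ?thesis using \<phi>q geven \<phi>(1) gq by (auto simp: Delta_m_iff)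
    qed
    have m: "mix q (g f) = mix q (\<lambda>r. \<phi> $ r)" by (rule mix_cong) (rule g)
    then have d: "dom f" using z(3) by (simp add: dom_def N_def mixmat_def z')
    have t: "f tcoord = t" using f[of tcoord] by (simp add: J_def z' pairing_coord)
    have "(N f *v (\<chi> k. wt k (q k) u)) $ k = b f k" for k
    proof -
      have "f (vcoord (vv k)) = scalar_product u (vv k)" using f[of "vcoord (vv k)"] by (simp add: J_def z' pairing_vcoord)
      then show ?thesis
        using \<gamma>[of k] spinor_cone_mix[OF \<phi>(2) nz, of k] by (simp add: N_def mixmat_apply b_def vv m)
    qed
    then have "N f *v (\<chi> k. wt k (q k) u) = (\<chi> i. b f i)" by (simp add: vec_eq_iff)
    then have "(\<chi> k. wt k (q k) u) = (\<chi> k. \<beta> f k)" using cramer[OF d] by blast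
    then have \<beta>: "\<beta> f k = wt k (q k) u" for k by (simp add: vec_eq_iff)
    show "dom f \<and> Z f = z"
      using d spinor_cone_unique[OF z(1)[unfolded z'] nz g \<beta>] by (simp add: Z_def z' t)
  qed
qed

text \<open>For \<open>\<epsilon> = 0\<close> the matrix is the identity, so the whole chart is covered.\<close>

lemma weight_chart_spinor:
  assumes q: "chi q = -1" shows "plucker_solvable weight_basis (scoord q) (chart (scoord q))"
proof -
  have "mixmat q (\<lambda>_. 0) g = mat 1" for g by (simp add: mixmat_def mat_def)
  then have "chart (scoord q) = chart_part (scoord q) (\<lambda>z. det (mixmat q (\<lambda>_. 0) (\<lambda>r. fst (snd z) $ r)) \<noteq> 0)"
    by (simp add: chart_part_True)
  moreover have "plucker_solvable weight_basis (scoord q) \<dots>"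
  proof (rule plucker_solvable_spinor[where vv = "\<lambda>k. wvec k (q k)" and \<gamma> = "\<lambda>_. 1", OF q])
    have "range (\<lambda>k. vcoord (wvec k (q k))) \<subseteq> (\<lambda>(k, b). vcoord (wvec k b)) ` UNIV" by (auto simp: image_iff)
    then show "insert tcoord (range (\<lambda>k. vcoord (wvec k (q k))) \<union> scoord ` {r. chi r = -1}) \<subseteq> weight_basis"
      unfolding weight_basis_eq by blast
  qed (auto simp: inj_def wvec_scalar_product)
  ultimately show ?thesis by simp
qed

lemma std_chart_spinor_local:
  assumes q: "chi q = -1" and p: "p \<in> chart (scoord q) \<inter> plucker_locus"
  shows "\<exists>W. cp_open W \<and> p \<in> W \<and> W \<subseteq> chart (scoord q) \<and> plucker_solvable std_basis (scoord q) W"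
proof -
  obtain z where z: "z \<in> plucker_cone" "pairing z (scoord q) = 1" "p = proj_point z"
    using p unfolding chart_part_True by (rule chart_part_cone[rotated]) auto
  obtain \<epsilon> where \<epsilon>: "\<And>k. \<epsilon> k \<in> {1, -1}"
    and det: "det (\<chi> k l. (if k = l then 1 else 0) + \<epsilon> k * (\<chi> k l. mix q (\<lambda>r. fst (snd z) $ r) k l) $ k $ l) \<noteq> (0 :: complex)"
    using exists_signs_det_nonzero[of "\<chi> k l. mix q (\<lambda>r. fst (snd z) $ r) k l"] by blast
  define Q where "Q z \<longleftrightarrow> det (mixmat q \<epsilon> (\<lambda>r. fst (snd z) $ r)) \<noteq> 0" for z :: E
  \<comment> \<open>the sum of the two weight coordinates of factor \<open>k\<close> is twice its first orthonormal coordinate, their difference is \<open>\<plusminus> 2 \<i>\<close> times the second\<close>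
  define \<gamma> where "\<gamma> k = (if \<epsilon> k = 1 then 1 / 2 else if q k then 1 / (2 * \<i>) else - 1 / (2 * \<i>))" for k
  let ?W = "chart_part (scoord q) Q"
  have "plucker_solvable std_basis (scoord q) ?W" unfolding Q_def
  proof (rule plucker_solvable_spinor[where vv = "\<lambda>k. axis (k, \<epsilon> k \<noteq> 1) 1" and \<gamma> = \<gamma>, OF q])
    show "inj (\<lambda>k. axis (k, \<epsilon> k \<noteq> 1) 1 :: V)" by (auto simp: inj_def axis_eq_axis)
    show "\<gamma> k \<noteq> 0" for k by (simp add: \<gamma>_def)
    show "insert tcoord (range (\<lambda>k. vcoord (axis (k, \<epsilon> k \<noteq> 1) 1)) \<union> scoord ` {r. chi r = -1}) \<subseteq> std_basis"
      unfolding std_basis_eq by blast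
    show "scalar_product u (axis (k, \<epsilon> k \<noteq> 1) 1) = \<gamma> k * (wt k (q k) u + \<epsilon> k * wt k (\<not> q k) u)" for u k
    proof (cases "\<epsilon> k = 1")
      case True
      then show ?thesis by (cases "q k") (simp_all add: scalar_product_axis \<gamma>_def wt_def)
    next
      case False
      then have "\<epsilon> k = -1" using \<epsilon>[of k] by simp
      then show ?thesis by (cases "q k") (simp_all add: scalar_product_axis \<gamma>_def wt_def)
    qed
  qed
  moreover have "cp_open ?W"
  proof (rule cp_open_chart_part)
    show "Q (cscale c z)" if "c \<noteq> 0" "Q z" for c z
    proof -
      have "mix q (\<lambda>r. fst (snd (cscale c z)) $ r) = mix q (\<lambda>r. fst (snd z) $ r)"
        using that(1) by (simp add: fun_eq_iff mix_def cscale_def case_prod_beta)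
      then show ?thesis using that(2) by (simp add: mixmat_def Q_def)
    qed
    let ?N = "{z :: E. fst (snd z) $ q \<noteq> 0}"
    have c: "continuous_on S (\<lambda>z :: E. fst (snd z) $ r)" for r S
      by (intro continuous_on_component continuous_on_fst continuous_on_snd continuous_on_id)
    have N: "open ?N" by (intro open_Collect_neq c continuous_on_const)
    have cm: "continuous_on ?N (\<lambda>z. mix q (\<lambda>r. fst (snd z) $ r) k l)" for k l
      by (cases "l = k") (auto simp: mix_def intro!: continuous_intros c)
    have "continuous_on ?N (\<lambda>z. det (mixmat q \<epsilon> (\<lambda>r. fst (snd z) $ r)))"
      unfolding det_def mixmat_def vec_lambda_beta by (intro continuous_intros cm)
    then have "open (?N \<inter> (\<lambda>z. det (mixmat q \<epsilon> (\<lambda>r. fst (snd z) $ r))) -` (- {0}))"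
      by (rule continuous_open_preimage) (use N in auto)
    moreover have "?N \<inter> (\<lambda>z. det (mixmat q \<epsilon> (\<lambda>r. fst (snd z) $ r))) -` (- {0}) = {z. pairing z (scoord q) \<noteq> 0 \<and> Q z}"
      by (auto simp: Q_def pairing_coord)
    ultimately show "open {z. pairing z (scoord q) \<noteq> 0 \<and> Q z}" by simp
  qed
  moreover have "Q z" using det by (simp add: Q_def mixmat_def)
  then have "p \<in> ?W" using chart_part_mem[OF z(1), of "scoord q" Q] z(2,3) by simp
  moreover have "?W \<subseteq> chart (scoord q)" unfolding chart_def chart_part_def by blast
  ultimately show ?thesis by blast
qed

section \<open>The Pluecker embedding\<close>

theorem theorem2p2:
  shows "(\<forall>g\<in>carrier G\<^sub>C. plucker (g <#\<^bsub>G\<^sub>C\<^esub> P\<^sub>0) = proj_point (dual_act g \<Phi>\<^sub>0))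
    \<and> inj_on plucker G_mod_P
    \<and> plucker ` G_mod_P = {proj_point z | z. z \<in> dual27 - {0} \<and> (\<forall>\<Phi>\<in>dual27. cubic z z \<Phi> = 0)}
    \<and> (\<forall>B\<in>{std_basis, weight_basis}.
         card B = 27 \<and> (\<forall>\<Psi>\<in>B. cp_open (chart \<Psi>)) \<and> (\<Union>\<Psi>\<in>B. chart \<Psi>) = CP26)
    \<and> (\<forall>\<Psi>\<in>weight_basis. plucker_solvable weight_basis \<Psi> (chart \<Psi>))
    \<and> (\<forall>\<Psi>\<in>std_basis. \<forall>p\<in>chart \<Psi> \<inter> plucker_locus.
         \<exists>W. cp_open W \<and> p \<in> W \<and> W \<subseteq> chart \<Psi> \<and> plucker_solvable std_basis \<Psi> W)"
proof (intro conjI)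
  show "\<forall>g\<in>carrier G\<^sub>C. plucker (g <#\<^bsub>G\<^sub>C\<^esub> P\<^sub>0) = proj_point (dual_act g \<Phi>\<^sub>0)"
    using plucker_coset by blast
  show "inj_on plucker G_mod_P" by (rule inj_on_plucker)
  show "plucker ` G_mod_P = {proj_point z | z. z \<in> dual27 - {0} \<and> (\<forall>\<Phi>\<in>dual27. cubic z z \<Phi> = 0)}"
    unfolding plucker_image plucker_locus_def ..
  show "\<forall>B\<in>{std_basis, weight_basis}.
         card B = 27 \<and> (\<forall>\<Psi>\<in>B. cp_open (chart \<Psi>)) \<and> (\<Union>\<Psi>\<in>B. chart \<Psi>) = CP26"
    using card_std_basis card_weight_basis cp_open_chart std_charts_cover weight_charts_cover by blast
  show "\<forall>\<Psi>\<in>weight_basis. plucker_solvable weight_basis \<Psi> (chart \<Psi>)"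
  proof
    fix \<Psi> assume "\<Psi> \<in> weight_basis"
    then consider k b where "\<Psi> = vcoord (wvec k b)" | q where "\<Psi> = scoord q" "chi q = -1" | "\<Psi> = tcoord"
      unfolding weight_basis_eq by auto
    then show "plucker_solvable weight_basis \<Psi> (chart \<Psi>)"
    proof cases
      case 3
      have "plucker_solvable weight_basis tcoord (chart tcoord)"
        by (rule plucker_solvable_t) (unfold weight_basis_eq, blast)
      then show ?thesis by (simp only: 3)
    qed (simp_all only: weight_chart_vector weight_chart_spinor)
  qed
  show "\<forall>\<Psi>\<in>std_basis. \<forall>p\<in>chart \<Psi> \<inter> plucker_locus.
         \<exists>W. cp_open W \<and> p \<in> W \<and> W \<subseteq> chart \<Psi> \<and> plucker_solvable std_basis \<Psi> W"
  proof (intro ballI)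
    fix \<Psi> p assume "\<Psi> \<in> std_basis" and p: "p \<in> chart \<Psi> \<inter> plucker_locus"
    then consider i where "\<Psi> = vcoord (axis i 1)" | q where "\<Psi> = scoord q" "chi q = -1" | "\<Psi> = tcoord"
      unfolding std_basis_eq by auto
    then show "\<exists>W. cp_open W \<and> p \<in> W \<and> W \<subseteq> chart \<Psi> \<and> plucker_solvable std_basis \<Psi> W"
    proof cases
      case 1 then show ?thesis using std_chart_vector_local p by blast
    next
      case 2 then show ?thesis using std_chart_spinor_local p by blast
    next
      case 3
      have "plucker_solvable std_basis tcoord (chart tcoord)"
        by (rule plucker_solvable_t) (unfold std_basis_eq, blast)
      then show ?thesis using p cp_open_chart unfolding 3 by blast
    qed
  qed
qed

end
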